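(* Assume that $$\operatorname{rank}\overline{Q}_{k}=\operatorname{rank}\overline{Q}_{k+l}=m_k\quad\text{for all }k=1,\dots,l,$$ and that the eigenvalues $\{-\mu_j^{\pm}\}_{j=1}^N$ of $P_{2N}$ are semisimple. Then there is a controller $u$ of the form $$u(t)=\sum_{i=1}^{M}\Phi_i v_i(t),\qquad t\ge 0,$$ which exponentially stabilizes the system $$\frac{dy}{dt}(t)+Ay(t)+\int_0^t \beta(t-s)Ay(s)\,ds=Bu(t)\quad(t>0),\qquad y(0)=y_0\in H,$$ where $\beta'(t)+\delta\beta(t)=0$ for $t>0$ and $\beta(0)=1$ (so $\beta(t)=e^{-\delta t}$). In other words, the solution $y\in C^1([0,\infty);\tilde H)$ of this system with this control satisfies $$|y(t)|_{\tilde H}\le C e^{-\gamma t}|y_0|_{\tilde H},\qquad t\ge 0 .$$ Moreover, for any $T>0$ the controller $v=\{v_i\}_{i=1}^M$ can be chosen in $C([0,T);\mathbb C^M)$ such that, with $w_i=v_i'+\delta v_i$, $$v_i(t)=-\int_t^T \beta(t-s)w_i(s)\,ds,\qquad \int_0^T|w_i(t)|^2\,dt\le C|y_0|_{\tilde H}^2,\qquad v_i(t)=0=w_i(t)\ \text{ for } t\ge T,$$ and $\{\Phi_i\}_{i=1}^M\subset D(A)$ is a system of eigenfunctions, namely $\Phi_i=\phi_i^*$. In addition, the controller $v=\{v_i\}_{i=1}^M$ can also be found as a $C^2([0,\infty);\mathbb C^M)$ function such that $$|v_j(t)|+|v_j'(t)|+|v_j''(t)|\le C e^{-\gamma t}|y_0|_{\tilde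 H}\qquad\forall\, t>0,\ j=1,\dots,M .$$
   Context: $H$ is a real Hilbert space with norm $|\cdot|$ and inner product $(\cdot,\cdot)$; $\tilde H=H+iH$ is its complexification, with norm $|\cdot|_{\tilde H}$. $A:D(A)\subset H\to H$ is a closed, densely defined, linear, self-adjoint, positive definite operator with compact resolvent. $U$ is a Hilbert space (control space) and $B:U\to H$ is a bounded linear operator. $\delta>0$ is a constant. $C$ denotes a generic constant. Let $\lambda_1,\lambda_2,\dots$ be the eigenvalues of $A$ repeated according to multiplicity (equal ones listed consecutively, $\lambda_j\to\infty$), and $\{\phi_n\}_{n\ge1}$ a corresponding orthonormal basis of $H$ of eigenvectors. Set $$\mu_n^{\pm}=\tfrac12\Big(\lambda_n+\delta\pm\sqrt{(\lambda_n-\delta)^2-4\lambda_n}\Big),\qquad \omega_0=1+\delta .$$ Then $\mu_n^+\to\infty$ and $\mu_n^-\to\omega_0$. Standing assumptions: $\delta\ne\lambda_j\pm2\sqrt{\lambda_j}$ for all $j$, and $\mu_j^+\neq\mu_m^-$ for all $j\ne m$. Fix $0<\gamma<\omega_0$. Let $N_1=\sup\{j:\operatorname{Re}\mu_j^+\le\gamma\}$, $N_2=\sup\{j:\operatorname{Re}\mu_j^-\le\gamma\}$, $N=\max\{N_1,N_2\}<\infty$. Among $\lambda_1,\dots,\lambda_N$ there are $l$ distinct values with multiplicities $m_1,\dots,m_l$, so $m_1+\dots+m_l=N$ (the first $m_1$ are equal, the next $m_2$ are equal, and so on). Let $M=\max\{m_1,\dots,m_l\}$. Let $\{\phi_j^*\}_{j=1}^N$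 be the system biorthogonal to $\{\phi_j\}_{j=1}^N$, i.e. $(\phi_i,\phi_j^* )=\delta_{ij}$ (Kronecker delta). Matrices: $A_N=\operatorname{diag}\{\lambda_j+\delta\}_{j=1}^N$, $B_N=\operatorname{diag}\{\lambda_j(1+\delta)\}_{j=1}^N$, $C_{NM}$ is the $N\times M$ matrix with $(j,i)$ entry $(B\phi_i^*,\phi_j^* )$, and $$P_{2N}=\begin{pmatrix}0_N&I_N\\-B_N&-A_N\end{pmatrix},\qquad Q_{2NM}=\begin{pmatrix}0\\ C_{NM}\end{pmatrix}\ (2N\times M).$$ The eigenvalues of $P_{2N}$ are $-\mu_j^{+},-\mu_j^-$, $j=1,\dots,N$. When they are semisimple, $R_{2N}$ is an invertible $2N\times2N$ matrix with $P_{2N}=R_{2N}^{-1}D_{2N}R_{2N}$, $D_{2N}=\operatorname{diag}(-\mu_1^+,\dots,-\mu_N^+,-\mu_1^-,\dots,-\mu_N^-)$, and $\overline Q_{2NM}=R_{2N}Q_{2NM}$. For $k=1,\dots,l$, $\overline Q_k$ is the $M\times m_k$ submatrix of the $M\times 2N$ matrix $\overline Q_{2NM}^*$ (adjoint) consisting of columns $m_1+\dots+m_{k-1}+1,\dots,m_1+\dots+m_k$, and $\overline Q_{l+k}$ is the $M\times m_k$ submatrix consisting of columns $N+m_1+\dots+m_{k-1}+1,\dots,N+m_1+\dots+m_k$.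
   Formalization: y in C^1([0,∞)) is claimed only for y_0 in D(A), since it fails for every y_0 outside D(A); for general y_0 in H the solution is continuous on [0,∞), C^1 on (0,∞), and solves the equation for all t>0 with the memory integral possibly improper at 0. *)

theory Defs
  imports
    "HOL-Analysis.Analysis"
    "Jordan_Normal_Form.DL_Rank"
    "Jordan_Normal_Form.Matrix_Kernel"
    "Jordan_Normal_Form.Char_Poly"
    "Jordan_Normal_Form.Schur_Decomposition"
begin

text \<open>
  An unbounded linear operator in a real Hilbert space is a pair of a domain \<open>D\<close> and a total
  function \<open>A\<close> whose values off \<open>D\<close> are never used.
\<close>

definition densely_defined_linear :: "'h::real_inner set \<Rightarrow> ('h \<Rightarrow> 'h) \<Rightarrow> bool" where
  "densely_defined_linear D A \<longleftrightarrow>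
     Real_Vector_Spaces.subspace D \<and> closure D = UNIV \<and>
     (\<forall>x\<in>D. \<forall>y\<in>D. A (x + y) = A x + A y) \<and>
     (\<forall>c. \<forall>x\<in>D. A (c *\<^sub>R x) = c *\<^sub>R A x)"

definition closed_operator :: "'h::real_inner set \<Rightarrow> ('h \<Rightarrow> 'h) \<Rightarrow> bool" where
  "closed_operator D A \<longleftrightarrow> closed ((\<lambda>x. (x, A x)) ` D)"

text \<open>
  The left-hand side below says that \<open>y\<close> lies in the domain of the adjoint and that the adjoint
  maps \<open>y\<close> to \<open>z\<close>; so the graphs of \<open>A\<close> and of its adjoint coincide, domains included.
\<close>

definition selfadjoint_operator :: "'h::real_inner set \<Rightarrow> ('h \<Rightarrow> 'h) \<Rightarrow> bool" where
  "selfadjoint_operator D A \<longleftrightarrow>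
     (\<forall>y z. (\<forall>x\<in>D. inner (A x) y = inner x z) \<longleftrightarrow> (y \<in> D \<and> z = A y))"

definition positive_definite_operator :: "'h::real_inner set \<Rightarrow> ('h \<Rightarrow> 'h) \<Rightarrow> bool" where
  "positive_definite_operator D A \<longleftrightarrow> (\<forall>x\<in>D. x \<noteq> 0 \<longrightarrow> 0 < inner (A x) x)"

definition compact_resolvent :: "'h::real_inner set \<Rightarrow> ('h \<Rightarrow> 'h) \<Rightarrow> bool" where
  "compact_resolvent D A \<longleftrightarrow>
     (\<exists>z. bij_betw (\<lambda>x. A x - z *\<^sub>R x) D UNIV \<and>
          compact (closure (inv_into D (\<lambda>x. A x - z *\<^sub>R x) ` cball 0 1)))"

definition eigenvector_of :: "'h::real_inner set \<Rightarrow> ('h \<Rightarrow> 'h) \<Rightarrow> 'h \<Rightarrow> bool" where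
  "eigenvector_of D A x \<longleftrightarrow> x \<in> D \<and> x \<noteq> 0 \<and> (\<exists>c. A x = c *\<^sub>R x)"

definition orthonormal_basis :: "(nat \<Rightarrow> 'h::real_inner) \<Rightarrow> bool" where
  "orthonormal_basis \<phi> \<longleftrightarrow>
     (\<forall>i j. inner (\<phi> i) (\<phi> j) = (if i = j then 1 else 0)) \<and> closure (Real_Vector_Spaces.span (range \<phi>)) = UNIV"

text \<open>
  Biorthogonality to the first \<open>N\<close> vectors does not determine a family in the whole space;
  \<^emph>\<open>the\<close> biorthogonal system is the one in the span of these vectors.
\<close>

definition biorthogonal_system :: "nat \<Rightarrow> (nat \<Rightarrow> 'h::real_inner) \<Rightarrow> (nat \<Rightarrow> 'h) \<Rightarrow> bool" where
  "biorthogonal_system N \<phi> \<psi> \<longleftrightarrow>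
     (\<forall>j<N. \<psi> j \<in> Real_Vector_Spaces.span (\<phi> ` {..<N})) \<and>
     (\<forall>i<N. \<forall>j<N. inner (\<phi> i) (\<psi> j) = (if i = j then 1 else 0))"

text \<open>
  The complexification of \<open>'h\<close> is \<open>'h \<times> 'h\<close>, with \<open>(x, y)\<close> standing for \<open>x + i y\<close>: the product
  norm is the norm of the complexification, and a real operator acts componentwise.
\<close>

definition cscale :: "complex \<Rightarrow> 'h::real_vector \<times> 'h \<Rightarrow> 'h \<times> 'h" where
  "cscale c p = (Re c *\<^sub>R fst p - Im c *\<^sub>R snd p, Re c *\<^sub>R snd p + Im c *\<^sub>R fst p)"

definition cembed :: "'h::real_vector \<Rightarrow> 'h \<times> 'h" where
  "cembed x = (x, 0)"

abbreviation complexify :: "('g \<Rightarrow> 'h) \<Rightarrow> 'g \<times> 'g \<Rightarrow> 'h \<times> 'h" where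
  "complexify A \<equiv> map_prod A A"

definition mem_kernel :: "real \<Rightarrow> real \<Rightarrow> real" where
  "mem_kernel \<delta> t = exp (- \<delta> * t)"

text \<open>
  For \<open>y0\<close> outside the domain, \<open>A (y s)\<close> need not be absolutely integrable at \<open>s = 0\<close>; the
  Henstock--Kurzweil integral covers the improper integral.  For the same reason the derivative is
  only required to exist, and to be continuous, on the open half-line.
\<close>

definition memory_solution ::
  "'h::{real_inner,banach} set \<Rightarrow> ('h \<Rightarrow> 'h) \<Rightarrow> real \<Rightarrow> (real \<Rightarrow> 'h \<times> 'h) \<Rightarrow> 'h \<times> 'h \<Rightarrow>
   (real \<Rightarrow> 'h \<times> 'h) \<Rightarrow> bool" where
  "memory_solution D A \<delta> f y0 y \<longleftrightarrow>
     continuous_on {0..} y \<and> y 0 = y0 \<and>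
     (\<exists>y'. continuous_on {0<..} y' \<and>
        (\<forall>t>0. y t \<in> D \<times> D \<and>
           (y has_vector_derivative y' t) (at t) \<and>
           (\<lambda>s. mem_kernel \<delta> (t - s) *\<^sub>R complexify A (y s)) integrable_on {0..t} \<and>
           y' t + complexify A (y t) +
             integral {0..t} (\<lambda>s. mem_kernel \<delta> (t - s) *\<^sub>R complexify A (y s)) = f t))"

definition C1_on_halfline :: "(real \<Rightarrow> 'a::real_normed_vector) \<Rightarrow> bool" where
  "C1_on_halfline y \<longleftrightarrow>
     (\<exists>y'. continuous_on {0..} y' \<and>
        (\<forall>t\<ge>0. (y has_vector_derivative y' t) (at t within {0..})))"

text \<open>
  \<open>J\<close> is the identification through which elements of \<open>'h\<close> are regarded as elements of the
  control space \<open>'u\<close> (identity, inclusion, restriction to a subdomain, ...).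
\<close>

definition modal_control ::
  "('h \<Rightarrow> 'u::real_vector) \<Rightarrow> nat \<Rightarrow> (nat \<Rightarrow> 'h) \<Rightarrow> (nat \<Rightarrow> real \<Rightarrow> complex) \<Rightarrow> real \<Rightarrow> 'u \<times> 'u" where
  "modal_control J M \<Phi> v t = (\<Sum>i<M. cscale (v i t) (cembed (J (\<Phi> i))))"

definition stabilized ::
  "'h::{real_inner,banach} set \<Rightarrow> ('h \<Rightarrow> 'h) \<Rightarrow> real \<Rightarrow> ('u \<Rightarrow> 'h) \<Rightarrow> real \<Rightarrow> real \<Rightarrow> 'h \<Rightarrow>
   (real \<Rightarrow> 'u \<times> 'u) \<Rightarrow> bool" where
  "stabilized D A \<delta> B \<gamma> C y0 u \<longleftrightarrow>
     (\<exists>y. memory_solution D A \<delta> (\<lambda>t. complexify B (u t)) (cembed y0) y \<and>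
        (\<forall>z. memory_solution D A \<delta> (\<lambda>t. complexify B (u t)) (cembed y0) z \<longrightarrow>
             (\<forall>t\<ge>0. z t = y t)) \<and>
        (y0 \<in> D \<longrightarrow> C1_on_halfline y) \<and>
        (\<forall>t\<ge>0. norm (y t) \<le> C * exp (- \<gamma> * t) * norm (cembed y0)))"

text \<open>
  All families are indexed from \<open>0\<close>: \<open>lam j\<close> is the eigenvalue with number \<open>j + 1\<close>.
\<close>

definition mu_plus :: "real \<Rightarrow> (nat \<Rightarrow> real) \<Rightarrow> nat \<Rightarrow> complex" where
  "mu_plus \<delta> lam j =
     (of_real (lam j + \<delta>) + csqrt (of_real ((lam j - \<delta>)\<^sup>2 - 4 * lam j))) / 2"

definition mu_minus :: "real \<Rightarrow> (nat \<Rightarrow> real) \<Rightarrow> nat \<Rightarrow> complex" where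
  "mu_minus \<delta> lam j =
     (of_real (lam j + \<delta>) - csqrt (of_real ((lam j - \<delta>)\<^sup>2 - 4 * lam j))) / 2"

text \<open>The supremum of the empty set of naturals is \<open>0\<close>, the case of no slow modes.\<close>

definition num_modes :: "real \<Rightarrow> (nat \<Rightarrow> real) \<Rightarrow> real \<Rightarrow> nat" where
  "num_modes \<delta> lam \<gamma> =
     max (Sup {Suc j |j. Re (mu_plus \<delta> lam j) \<le> \<gamma>}) (Sup {Suc j |j. Re (mu_minus \<delta> lam j) \<le> \<gamma>})"

text \<open>
  As equal eigenvalues are adjacent, removing adjacent duplicates lists the distinct ones in
  order of appearance.
\<close>

definition distinct_vals :: "(nat \<Rightarrow> real) \<Rightarrow> nat \<Rightarrow> real list" where
  "distinct_vals lam N = remdups_adj (map lam [0..<N])"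

definition num_distinct :: "(nat \<Rightarrow> real) \<Rightarrow> nat \<Rightarrow> nat" where
  "num_distinct lam N = length (distinct_vals lam N)"

definition eig_mult :: "(nat \<Rightarrow> real) \<Rightarrow> nat \<Rightarrow> nat \<Rightarrow> nat" where
  "eig_mult lam N k = card {j. j < N \<and> lam j = distinct_vals lam N ! k}"

text \<open>The inserted \<open>0\<close> only matters if \<open>N = 0\<close>.\<close>

definition max_mult :: "(nat \<Rightarrow> real) \<Rightarrow> nat \<Rightarrow> nat" where
  "max_mult lam N = Max (insert 0 (eig_mult lam N ` {..<num_distinct lam N}))"

definition C_mat ::
  "('u \<Rightarrow> 'h::real_inner) \<Rightarrow> ('h \<Rightarrow> 'u) \<Rightarrow> (nat \<Rightarrow> 'h) \<Rightarrow> nat \<Rightarrow> nat \<Rightarrow> complex mat" where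
  "C_mat B J \<psi> N M = mat N M (\<lambda>(j, i). of_real (inner (B (J (\<psi> i))) (\<psi> j)))"

definition P_mat :: "real \<Rightarrow> (nat \<Rightarrow> real) \<Rightarrow> nat \<Rightarrow> complex mat" where
  "P_mat \<delta> lam N = four_block_mat
     (0\<^sub>m N N) (1\<^sub>m N)
     (- mat_diag N (\<lambda>j. of_real (lam j * (1 + \<delta>)))) (- mat_diag N (\<lambda>j. of_real (lam j + \<delta>)))"

definition Q_mat ::
  "('u \<Rightarrow> 'h::real_inner) \<Rightarrow> ('h \<Rightarrow> 'u) \<Rightarrow> (nat \<Rightarrow> 'h) \<Rightarrow> nat \<Rightarrow> nat \<Rightarrow> complex mat" where
  "Q_mat B J \<psi> N M = 0\<^sub>m N M @\<^sub>r C_mat B J \<psi> N M"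

definition D_mat :: "real \<Rightarrow> (nat \<Rightarrow> real) \<Rightarrow> nat \<Rightarrow> complex mat" where
  "D_mat \<delta> lam N =
     mat_diag (2 * N) (\<lambda>j. if j < N then - mu_plus \<delta> lam j else - mu_minus \<delta> lam (j - N))"

definition semisimple_eigenvalue :: "complex mat \<Rightarrow> complex \<Rightarrow> bool" where
  "semisimple_eigenvalue X e \<longleftrightarrow>
     eigenvalue X e \<and> kernel_dim (char_matrix X e) = Polynomial.order e (char_poly X)"

definition col_block :: "'a mat \<Rightarrow> nat \<Rightarrow> nat \<Rightarrow> 'a mat" where
  "col_block X c m = mat (dim_row X) m (\<lambda>(i, j). X $$ (i, c + j))"

definition mat_rank :: "'a::field mat \<Rightarrow> nat" where
  "mat_rank X = vec_space.rank (dim_row X) X"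

text \<open>
  \<open>Qbar_plus k\<close> and \<open>Qbar_minus k\<close> are the blocks belonging to the eigenvalues
  \<open>- mu_plus\<close> and \<open>- mu_minus\<close> over the \<open>k\<close>-th distinct eigenvalue.
\<close>

definition Qbar_plus :: "complex mat \<Rightarrow> complex mat \<Rightarrow> (nat \<Rightarrow> real) \<Rightarrow> nat \<Rightarrow> nat \<Rightarrow> complex mat" where
  "Qbar_plus R Q lam N k =
     col_block (mat_adjoint (R * Q)) (\<Sum>i<k. eig_mult lam N i) (eig_mult lam N k)"

definition Qbar_minus :: "complex mat \<Rightarrow> complex mat \<Rightarrow> (nat \<Rightarrow> real) \<Rightarrow> nat \<Rightarrow> nat \<Rightarrow> complex mat" where
  "Qbar_minus R Q lam N k =
     col_block (mat_adjoint (R * Q)) (N + (\<Sum>i<k. eig_mult lam N i)) (eig_mult lam N k)"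

end

theory Submission
  imports Defs "HOL-Real_Asymp.Real_Asymp"
begin

text \<open>
  Put \<open>z(t)\<close> for the integral of \<open>exp (- \<delta> * (t - s)) * y(s)\<close> over \<open>[0, t]\<close>.  Expansion in the
  eigenbasis turns the equation into independent planar systems \<open>y' = - \<lambda> y - \<lambda> z + f\<close>,
  \<open>z' = y - \<delta> z\<close>, one for each eigenvalue \<open>\<lambda>\<close>, whose matrix has the eigenvalues \<open>- \<mu>\<^sup>+\<close> and
  \<open>- \<mu>\<^sup>-\<close>.  From the mode with index \<open>N\<close> on, both exponents have real part above \<open>\<gamma>\<close>, so only the first
  \<open>N\<close> pairs \<open>(y, z)\<close> need a control.  The equation, its datum and the control are real,
  and the complexified solution is the real one with imaginary part zero.

  The control is an open-loop pulse: a \<open>C\<^sup>2\<close> function with support in \<open>[0, T]\<close>, depending linearly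
  on the datum, that takes the first \<open>N\<close> pairs exactly to zero at time \<open>T\<close>.  Once it is switched off
  these pairs stay at zero and the remaining modes decay like \<open>exp (- \<gamma> * t)\<close>
  (\<open>stabilizing_pulses\<close>).  Such a pulse serves all claims at once: it vanishes after \<open>T\<close>; the
  formula for \<open>v\<close> in terms of \<open>w = v' + \<delta> v\<close> is the fundamental theorem of calculus
  for \<open>exp (\<delta> * s) * v(s)\<close>; and a compactly supported \<open>C\<^sup>2\<close> function is, with its derivatives,
  smaller than a constant times any given decaying exponential.

  The pulse exists (\<open>null_control\<close>) because the \<open>2 N\<close> linear functionals that send a pulse to its
  contributions to the pairs at time \<open>T\<close> are linearly independent, hence have a dual
  basis among the pulses (\<open>dual_basis\<close>).  A vanishing combination of these functionals gives, for
  each actuator, a vanishing combination of the exponentials \<open>exp (- \<mu>\<^sup>\<plusminus> * t)\<close> on an interval.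
  Exponentials with different exponents are independent, which separates the distinct eigenvalues;
  inside one eigenvalue the rank hypothesis says that the rows of the control matrix are
  independent (\<open>control_rows_independent\<close>), because a left eigenvector of the matrix \<open>P\<close> is a
  combination of the corresponding rows of \<open>R\<close>.

  Well-posedness rests on bounds that are uniform in the mode: the responses of \<open>y\<close> and \<open>z\<close> to a
  unit datum are at most a constant times \<open>1/\<lambda> + exp (- \<lambda> t / 2)\<close> and \<open>1/\<lambda>\<close>.  Thus
  \<open>\<lambda> y\<close> is square summable over the modes for \<open>t > 0\<close>, while \<open>\<lambda> z\<close> is so up to \<open>t = 0\<close>; the
  latter sums to the improper integral of the memory term.  Solutions are unique because
  \<open>y\<^sup>2 + \<lambda> z\<^sup>2\<close> never increases when \<open>f = 0\<close>.
\<close>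

section \<open>Square-summable coefficients and expansion in an orthonormal basis\<close>

definition ell2 :: "(nat \<Rightarrow> real) \<Rightarrow> bool" where
  "ell2 a \<longleftrightarrow> summable (\<lambda>j. (a j)\<^sup>2)"

lemma ell2_dominated:
  assumes "ell2 b" and "\<And>j. \<bar>a j\<bar> \<le> b j"
  shows "ell2 a"
  unfolding ell2_def
proof (rule summable_comparison_test)
  show "\<exists>n. \<forall>j\<ge>n. norm ((a j)\<^sup>2) \<le> (b j)\<^sup>2"
    using power_mono[OF assms(2) abs_ge_zero, of _ 2] by simp
qed (use assms in \<open>simp add: ell2_def\<close>)

lemma ell2_add:
  assumes "ell2 a" "ell2 b"
  shows "ell2 (\<lambda>j. a j + b j)"
  unfolding ell2_def
proof (rule summable_comparison_test)
  have "(a j + b j)\<^sup>2 \<le> 2 * (a j)\<^sup>2 + 2 * (b j)\<^sup>2" for j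
    using sum_squares_bound[of "a j" "b j"] by (simp add: power2_sum)
  then show "\<exists>n. \<forall>j\<ge>n. norm ((a j + b j)\<^sup>2) \<le> 2 * (a j)\<^sup>2 + 2 * (b j)\<^sup>2"
    by simp
qed (use assms in \<open>auto simp: ell2_def intro!: summable_add summable_mult\<close>)

lemma ell2_scale: "ell2 a \<Longrightarrow> ell2 (\<lambda>j. c * a j)"
  by (simp add: ell2_def power_mult_distrib summable_mult)

lemma ell2_abs: "ell2 a \<Longrightarrow> ell2 (\<lambda>j. \<bar>a j\<bar>)"
  by (simp add: ell2_def)

lemma ell2_sum: "(\<And>i. i \<in> I \<Longrightarrow> ell2 (a i)) \<Longrightarrow> ell2 (\<lambda>j. \<Sum>i\<in>I. a i j)"
proof (induction I rule: infinite_finite_induct)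
  case (insert x F)
  then show ?case using ell2_add[of "a x" "\<lambda>j. \<Sum>i\<in>F. a i j"] by simp
qed (simp_all add: ell2_def)

text \<open>
  A majorant in \<open>\<ell>\<^sup>2\<close> that does not depend on the time is what allows term-by-term continuity and
  differentiation of an orthogonal expansion.
\<close>

definition dominated :: "real set \<Rightarrow> (nat \<Rightarrow> real \<Rightarrow> real) \<Rightarrow> bool" where
  "dominated S q \<longleftrightarrow> (\<exists>M. ell2 M \<and> (\<forall>t\<in>S. \<forall>j. \<bar>q j t\<bar> \<le> M j))"

lemma dominatedI: "ell2 M \<Longrightarrow> (\<And>j t. t \<in> S \<Longrightarrow> \<bar>q j t\<bar> \<le> M j) \<Longrightarrow> dominated S q"
  by (auto simp: dominated_def)

lemma dominated_subset: "dominated S q \<Longrightarrow> T \<subseteq> S \<Longrightarrow> dominated T q"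
  by (auto simp: dominated_def)

lemma dominated_ell2:
  assumes "dominated S q" "t \<in> S"
  shows "ell2 (\<lambda>j. q j t)"
proof -
  obtain M where M: "ell2 M" "\<forall>t\<in>S. \<forall>j. \<bar>q j t\<bar> \<le> M j"
    using assms(1) unfolding dominated_def by blast
  then show ?thesis by (intro ell2_dominated[OF M(1)]) (use assms in simp)
qed

lemma dominated_add:
  assumes "dominated S q" "dominated S r"
  shows "dominated S (\<lambda>j t. q j t + r j t)"
proof -
  obtain M where M: "ell2 M" "\<forall>t\<in>S. \<forall>j. \<bar>q j t\<bar> \<le> M j"
    using assms(1) unfolding dominated_def by blast
  obtain N where N: "ell2 N" "\<forall>t\<in>S. \<forall>j. \<bar>r j t\<bar> \<le> N j"
    using assms(2) unfolding dominated_def by blast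
  show ?thesis
  proof (rule dominatedI[OF ell2_add[OF M(1) N(1)]])
    fix j t assume t: "t \<in> S"
    show "\<bar>q j t + r j t\<bar> \<le> M j + N j" using M(2)[rule_format, OF t, of j] N(2)[rule_format, OF t, of j] by linarith
  qed
qed

lemma dominated_scale:
  assumes "dominated S q"
  shows "dominated S (\<lambda>j t. k * q j t)"
proof -
  obtain M where M: "ell2 M" "\<forall>t\<in>S. \<forall>j. \<bar>q j t\<bar> \<le> M j"
    using assms unfolding dominated_def by blast
  show ?thesis
    by (rule dominatedI[OF ell2_scale[OF M(1), of "\<bar>k\<bar>"]]) (simp add: abs_mult mult_left_mono M(2))
qed

locale onb =
  fixes \<phi> :: "nat \<Rightarrow> 'h::{real_inner,banach}"
  assumes basis: "orthonormal_basis \<phi>"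
begin

definition synth :: "(nat \<Rightarrow> real) \<Rightarrow> 'h" where
  "synth a = (\<Sum>j. a j *\<^sub>R \<phi> j)"

lemma inner_phi: "inner (\<phi> i) (\<phi> j) = (if i = j then 1 else 0)"
  using basis by (simp add: orthonormal_basis_def)

lemma norm_sum_phi:
  assumes "finite I"
  shows "(norm (\<Sum>j\<in>I. a j *\<^sub>R \<phi> j))\<^sup>2 = (\<Sum>j\<in>I. (a j)\<^sup>2)"
  unfolding power2_norm_eq_inner using assms
  by (simp add: inner_sum_left inner_sum_right inner_phi power2_eq_square
      if_distrib[of "\<lambda>x. _ * x"] sum.delta cong: if_cong)

text \<open>
  Orthogonality makes the norm of a block of the series the root of the block of squares, so both
  series are Cauchy together.
\<close>

lemma synth_summable:
  assumes "ell2 a"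
  shows "summable (\<lambda>j. a j *\<^sub>R \<phi> j)"
  unfolding summable_Cauchy
proof (intro allI impI)
  fix e :: real assume e: "e > 0"
  obtain K where K: "\<And>m n. m \<ge> K \<Longrightarrow> norm (sum (\<lambda>j. (a j)\<^sup>2) {m..<n}) < e\<^sup>2"
    using assms[unfolded ell2_def summable_Cauchy, rule_format, of "e\<^sup>2"] e by auto
  have "norm (\<Sum>j=m..<n. a j *\<^sub>R \<phi> j) < e" if "m \<ge> K" for m n
  proof -
    have "(norm (\<Sum>j=m..<n. a j *\<^sub>R \<phi> j))\<^sup>2 < e\<^sup>2"
      using K[OF that, of n] by (simp add: norm_sum_phi abs_of_nonneg sum_nonneg)
    then show ?thesis by (rule power_less_imp_less_base) (use e in simp)
  qed
  then show "\<exists>K. \<forall>m\<ge>K. \<forall>n. norm (\<Sum>j=m..<n. a j *\<^sub>R \<phi> j) < e" by blast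
qed

lemma synth_sums: "ell2 a \<Longrightarrow> (\<lambda>j. a j *\<^sub>R \<phi> j) sums synth a"
  unfolding synth_def by (rule summable_sums[OF synth_summable])

lemma inner_synth_sums:
  assumes "ell2 a"
  shows "(\<lambda>j. inner x (\<phi> j) * a j) sums inner x (synth a)"
  using bounded_linear.sums[OF bounded_linear_inner_right synth_sums[OF assms], of x]
  by (simp add: mult.commute)

lemma coef_synth:
  assumes "ell2 a"
  shows "inner (synth a) (\<phi> k) = a k"
proof -
  have "(\<lambda>j. inner (\<phi> k) (\<phi> j) * a j) sums a k"
    using sums_single[of k a] by (simp add: inner_phi if_distrib[of "\<lambda>x. x * _"] eq_commute cong: if_cong)
  then show ?thesis
    using inner_synth_sums[OF assms, of "\<phi> k"] sums_unique2 by (metis inner_commute)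
qed

lemma norm_synth:
  assumes "ell2 a"
  shows "(norm (synth a))\<^sup>2 = (\<Sum>j. (a j)\<^sup>2)"
proof -
  have "(\<lambda>j. (a j)\<^sup>2) sums inner (synth a) (synth a)"
    using inner_synth_sums[OF assms, of "synth a"] assms by (simp add: coef_synth power2_eq_square)
  then show ?thesis by (simp add: power2_norm_eq_inner sums_iff)
qed

lemma norm_synth_le:
  assumes "ell2 m" and "\<And>j. \<bar>a j\<bar> \<le> m j"
  shows "(norm (synth a))\<^sup>2 \<le> (\<Sum>j. (m j)\<^sup>2)"
proof -
  have a: "ell2 a" using ell2_dominated[OF assms] .
  have "(\<Sum>j. (a j)\<^sup>2) \<le> (\<Sum>j. (m j)\<^sup>2)"
  proof (rule suminf_le)
    show "(a j)\<^sup>2 \<le> (m j)\<^sup>2" for j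
      using power_mono[OF assms(2) abs_ge_zero, of j 2] by simp
  qed (use a assms in \<open>auto simp: ell2_def\<close>)
  then show ?thesis by (simp add: norm_synth[OF a])
qed

lemma ell2_coef: "ell2 (\<lambda>j. inner x (\<phi> j))"
  unfolding ell2_def
proof (rule summableI_nonneg_bounded)
  fix n
  let ?p = "\<Sum>j<n. inner x (\<phi> j) *\<^sub>R \<phi> j"
  have "inner x ?p = (\<Sum>j<n. (inner x (\<phi> j))\<^sup>2)"
    by (simp add: inner_sum_right power2_eq_square)
  moreover have "inner ?p ?p = (\<Sum>j<n. (inner x (\<phi> j))\<^sup>2)"
    using norm_sum_phi[of "{..<n}"] by (simp add: power2_norm_eq_inner)
  moreover have "0 \<le> inner (x - ?p) (x - ?p)" by simp
  ultimately show "(\<Sum>j<n. (inner x (\<phi> j))\<^sup>2) \<le> inner x x"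
    by (simp add: inner_diff_left inner_diff_right inner_commute)
qed simp

text \<open>
  The difference is orthogonal to the span of the basis, which is dense.
\<close>

lemma coef_eqI:
  assumes "\<And>j. inner x (\<phi> j) = inner y (\<phi> j)"
  shows "x = y"
proof -
  let ?d = "x - y"
  have *: "inner ?d v = 0" if "v \<in> Real_Vector_Spaces.span (range \<phi>)" for v
    using that
  proof (induction rule: Real_Vector_Spaces.span_induct_alt)
    case (step c w z)
    then show ?case using assms by (auto simp: inner_add_right inner_diff_left)
  qed simp
  have "closed {v. inner ?d v = 0}"
    by (intro closed_Collect_eq continuous_intros)
  then have "closure (Real_Vector_Spaces.span (range \<phi>)) \<subseteq> {v. inner ?d v = 0}"
    using * by (intro closure_minimal) auto
  then have "?d \<in> {v. inner ?d v = 0}"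
    using basis unfolding orthonormal_basis_def by blast
  then show ?thesis by simp
qed

lemma synth_coef: "synth (\<lambda>j. inner x (\<phi> j)) = x"
  by (rule coef_eqI) (simp add: coef_synth ell2_coef)

lemma parseval: "(norm x)\<^sup>2 = (\<Sum>j. (inner x (\<phi> j))\<^sup>2)"
  using norm_synth[OF ell2_coef[of x]] by (simp add: synth_coef)

lemma abs_coef_le: "\<bar>inner x (\<phi> j)\<bar> \<le> norm x"
  using Cauchy_Schwarz_ineq2[of x "\<phi> j"] inner_phi[of j j] by (simp add: norm_eq_sqrt_inner)

text \<open>
  By orthogonality the tails of the series are bounded by the tails of the majorant, so the partial
  sums converge uniformly.
\<close>

lemma synth_continuous:
  assumes cont: "\<And>j. continuous_on S (c j)" and dom: "dominated S c"
  shows "continuous_on S (\<lambda>t. synth (\<lambda>j. c j t))"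
proof -
  obtain m where m: "ell2 m" and "\<forall>t\<in>S. \<forall>j. \<bar>c j t\<bar> \<le> m j"
    using dom unfolding dominated_def by blast
  then have le: "\<bar>c j t\<bar> \<le> m j" if "t \<in> S" for j t using that by blast
  let ?p = "\<lambda>n t. \<Sum>j<n. c j t *\<^sub>R \<phi> j"
  have c: "ell2 (\<lambda>j. c j t)" if "t \<in> S" for t
    by (rule ell2_dominated[OF m le[OF that]])
  have sm: "summable (\<lambda>j. (m j)\<^sup>2)" using m by (simp add: ell2_def)
  have tail: "(norm (?p n t - synth (\<lambda>j. c j t)))\<^sup>2 \<le> (\<Sum>j. (m (j + n))\<^sup>2)" if "t \<in> S" for n t
  proof -
    let ?r = "\<lambda>j. if j < n then 0 else c j t"
    let ?m = "\<lambda>j. if j < n then 0 else m j"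
    have nonneg: "0 \<le> m j" for j using le[OF that, of j] by linarith
    have em: "ell2 ?m" by (rule ell2_dominated[OF m]) (simp add: nonneg)
    have er: "ell2 ?r" by (rule ell2_dominated[OF em]) (use le[OF that] in auto)
    have "synth (\<lambda>j. c j t) - ?p n t = synth ?r"
      by (rule coef_eqI)
        (simp add: inner_diff_left coef_synth[OF c[OF that]] coef_synth[OF er] inner_sum_left inner_phi
          if_distrib[of "\<lambda>x. _ * x"] sum.delta cong: if_cong)
    moreover have "(norm (synth ?r))\<^sup>2 \<le> (\<Sum>j. (?m j)\<^sup>2)"
      by (rule norm_synth_le[OF em]) (use le[OF that] in auto)
    moreover have "(\<Sum>j. (?m j)\<^sup>2) = (\<Sum>j. (?m (j + n))\<^sup>2)"
      using suminf_split_initial_segment[of "\<lambda>j. (?m j)\<^sup>2" n] em by (simp add: ell2_def)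
    ultimately show ?thesis by (simp add: norm_minus_commute)
  qed
  have "uniform_limit S ?p (\<lambda>t. synth (\<lambda>j. c j t)) sequentially"
  proof (rule uniform_limitI)
    fix e :: real assume e: "e > 0"
    have "(\<lambda>n. \<Sum>j. (m (j + n))\<^sup>2) \<longlonglongrightarrow> 0"
      by (rule suminf_exist_split2[OF sm])
    then have "\<forall>\<^sub>F n in sequentially. (\<Sum>j. (m (j + n))\<^sup>2) < e\<^sup>2"
      using e by (intro order_tendstoD) auto
    then show "\<forall>\<^sub>F n in sequentially. \<forall>t\<in>S. dist (?p n t) (synth (\<lambda>j. c j t)) < e"
    proof eventually_elim
      case (elim n)
      show ?case
      proof
        fix t assume "t \<in> S"
        then have "(norm (?p n t - synth (\<lambda>j. c j t)))\<^sup>2 < e\<^sup>2"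
          using tail[of t n] elim by linarith
        then have "norm (?p n t - synth (\<lambda>j. c j t)) < e"
          by (rule power_less_imp_less_base) (use e in simp)
        then show "dist (?p n t) (synth (\<lambda>j. c j t)) < e"
          by (simp add: dist_norm)
      qed
    qed
  qed
  then show ?thesis
    by (rule uniform_limit_theorem[rotated]) (auto intro!: always_eventually continuous_intros cont)
qed

text \<open>
  The integral of the series of derivatives has the same coefficients as the increment of the
  series, so the two agree and the fundamental theorem of calculus applies.
\<close>

lemma synth_has_vector_derivative:
  assumes der: "\<And>j t. t \<in> {a..b} \<Longrightarrow> (c j has_real_derivative c' j t) (at t within {a..b})"
    and cont: "\<And>j. continuous_on {a..b} (c' j)" and dom: "dominated {a..b} c'"
    and c: "\<And>t. t \<in> {a..b} \<Longrightarrow> ell2 (\<lambda>j. c j t)"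
    and t: "t \<in> {a..b}"
  shows "((\<lambda>t. synth (\<lambda>j. c j t)) has_vector_derivative synth (\<lambda>j. c' j t)) (at t within {a..b})"
proof -
  let ?F = "\<lambda>t. synth (\<lambda>j. c' j t)"
  have F: "continuous_on {a..b} ?F" by (rule synth_continuous[OF cont dom])
  have c': "ell2 (\<lambda>j. c' j t)" if "t \<in> {a..b}" for t
    by (rule dominated_ell2[OF dom that])
  have eq: "synth (\<lambda>j. c j u) = synth (\<lambda>j. c j a) + integral {a..u} ?F" if u: "u \<in> {a..b}" for u
  proof (rule coef_eqI)
    fix j
    have a: "a \<in> {a..b}" using u by auto
    have "continuous_on {a..u} ?F" by (rule continuous_on_subset[OF F]) (use u in auto)
    then have int: "?F integrable_on {a..u}" by (rule integrable_continuous_real)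
    have "inner (integral {a..u} ?F) (\<phi> j) = integral {a..u} (\<lambda>s. inner (?F s) (\<phi> j))"
      using integral_linear[OF int bounded_linear_inner_left[of "\<phi> j"]] by (simp add: o_def)
    also have "\<dots> = integral {a..u} (c' j)"
      by (rule integral_cong) (use u in \<open>simp add: coef_synth c'\<close>)
    also have "\<dots> = c j u - c j a"
    proof (rule integral_unique, rule fundamental_theorem_of_calculus)
      fix x assume "x \<in> {a..u}"
      then show "(c j has_vector_derivative c' j x) (at x within {a..u})"
        using der[of x j] u
        by (auto simp: has_real_derivative_iff_has_vector_derivative intro: has_vector_derivative_within_subset)
    qed (use u in auto)
    finally show "inner (synth (\<lambda>j. c j u)) (\<phi> j) = inner (synth (\<lambda>j. c j a) + integral {a..u} ?F) (\<phi> j)"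
      by (simp add: inner_add_left coef_synth[OF c[OF a]] coef_synth[OF c[OF u]])
  qed
  have D: "((\<lambda>u. synth (\<lambda>j. c j a) + integral {a..u} ?F) has_vector_derivative ?F t) (at t within {a..b})"
    using has_vector_derivative_add[OF has_vector_derivative_const integral_has_vector_derivative[OF F t]]
    by simp
  show ?thesis
    by (rule has_vector_derivative_transform[OF t _ D]) (rule eq)
qed

end

section \<open>A single mode with memory\<close>

lemma at_within_halfline: "0 \<le> t \<Longrightarrow> at t within {0..t+1} = at t within {0..}" for t :: real
  by (rule at_within_nhd[of _ "{..<t+1}"]) auto

text \<open>
  The solution of \<open>x' = - p x + f\<close>, \<open>x(0) = y0\<close>, by variation of constants.  The exponential is
  kept outside the integral, so that differentiation needs no parameter under the integral sign.
\<close>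

definition duhamel :: "complex \<Rightarrow> real \<Rightarrow> (real \<Rightarrow> real) \<Rightarrow> real \<Rightarrow> complex" where
  "duhamel p y0 f t =
     exp (- p * of_real t) * (of_real y0 + integral {0..t} (\<lambda>s. exp (p * of_real s) * of_real (f s)))"

lemma duhamel_0 [simp]: "duhamel p y0 f 0 = of_real y0"
  by (simp add: duhamel_def)

lemma continuous_duhamel_integrand:
  assumes "continuous_on {0..} f"
  shows "continuous_on {0..t} (\<lambda>s. exp (p * of_real s) * of_real (f s) :: complex)"
  by (intro continuous_intros continuous_on_subset[OF assms]) auto

lemma duhamel_deriv:
  assumes f: "continuous_on {0..} f" and t: "t \<ge> 0"
  shows "(duhamel p y0 f has_vector_derivative of_real (f t) - p * duhamel p y0 f t) (at t within {0..})"
proof -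
  let ?k = "\<lambda>s. exp (p * of_real s) * of_real (f s) :: complex"
  have "((\<lambda>u. integral {0..u} ?k) has_vector_derivative ?k t) (at t within {0..t+1})"
    by (rule integral_has_vector_derivative[OF continuous_duhamel_integrand[OF f]]) (use t in auto)
  then have I: "((\<lambda>u. integral {0..u} ?k) has_vector_derivative ?k t) (at t within {0..})"
    by (simp add: at_within_halfline t)
  have E: "((\<lambda>u. exp (- p * of_real u)) has_vector_derivative (- p * exp (- p * of_real t))) (at t within {0..})"
    by (rule has_vector_derivative_real_field) (auto intro!: derivative_eq_intros)
  have "((\<lambda>u. exp (- p * of_real u) * (of_real y0 + integral {0..u} ?k)) has_vector_derivative
      exp (- p * of_real t) * (0 + ?k t) + - p * exp (- p * of_real t) * (of_real y0 + integral {0..t} ?k))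
      (at t within {0..})"
    by (rule has_vector_derivative_mult[OF E has_vector_derivative_add[OF has_vector_derivative_const I]])
  moreover have "exp (- p * of_real t) * exp (p * of_real t) = 1"
    by (simp flip: exp_add)
  ultimately show ?thesis
    unfolding duhamel_def[abs_def] by (simp add: algebra_simps)
qed

lemma duhamel_split:
  assumes f: "continuous_on {0..} f"
  shows "duhamel p y0 f t = of_real y0 * exp (- p * of_real t)
    + integral {0..t} (\<lambda>s. exp (- p * of_real (t - s)) * of_real (f s))"
proof -
  have "exp (- p * of_real t) * integral {0..t} (\<lambda>s. exp (p * of_real s) * of_real (f s))
    = integral {0..t} (\<lambda>s. exp (- p * of_real t) * (exp (p * of_real s) * of_real (f s)))"
    by simp
  also have "\<dots> = integral {0..t} (\<lambda>s. exp (- p * of_real (t - s)) * of_real (f s))"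
    by (intro integral_cong) (simp add: algebra_simps flip: exp_add)
  finally show ?thesis by (simp add: duhamel_def algebra_simps)
qed

lemma norm_exp_le:
  assumes "r \<le> Re p" "0 \<le> t"
  shows "norm (exp (- p * of_real t)) \<le> exp (- r * t)"
  using assms by (simp add: mult_right_mono)

lemma norm_duhamel_bounded:
  assumes f: "continuous_on {0..} f" and m: "\<And>s. s \<ge> 0 \<Longrightarrow> \<bar>f s\<bar> \<le> m"
    and p: "0 \<le> Re p" and t: "t \<ge> 0"
  shows "norm (duhamel p y0 f t) \<le> \<bar>y0\<bar> + t * m"
proof -
  have e: "norm (exp (- p * of_real u)) \<le> 1" if "u \<ge> 0" for u
    using norm_exp_le[of 0 p u] p that by simp
  have "norm (integral {0..t} (\<lambda>s. exp (- p * of_real (t - s)) * of_real (f s))) \<le> m * (t - 0)"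
  proof (rule integral_bound)
    fix s assume s: "s \<in> {0..t}"
    then show "norm (exp (- p * of_real (t - s)) * of_real (f s) :: complex) \<le> m"
      using mult_mono[OF e[of "t - s"] m[of s]] by (simp only: norm_mult norm_of_real) auto
  qed (use t in \<open>auto intro!: continuous_intros continuous_on_subset[OF f]\<close>)
  moreover have "norm (of_real y0 * exp (- p * of_real t)) \<le> \<bar>y0\<bar> * 1"
    unfolding norm_mult norm_of_real by (rule mult_left_mono[OF e[OF t]]) simp
  ultimately show ?thesis
    unfolding duhamel_split[OF f] by (intro order_trans[OF norm_triangle_ineq]) (simp add: mult.commute)
qed

text \<open>
  The gain \<open>m / r\<close> from the forcing, with \<open>r\<close> of the order of an eigenvalue, is what later keeps the
  eigenvalue times the solution bounded.
\<close>

lemma norm_duhamel_dissipative: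
  assumes f: "continuous_on {0..} f" and m: "\<And>s. s \<ge> 0 \<Longrightarrow> \<bar>f s\<bar> \<le> m"
    and r: "0 < r" "r \<le> Re p" and t: "t \<ge> 0"
  shows "norm (duhamel p y0 f t) \<le> exp (- r * t) * \<bar>y0\<bar> + m / r"
proof -
  have m0: "0 \<le> m" using m[of 0] by simp
  have I: "((\<lambda>s. exp (- r * (t - s)) * m) has_integral
      exp (- r * (t - t)) * m / r - exp (- r * (t - 0)) * m / r) {0..t}"
    by (rule fundamental_theorem_of_calculus[OF t])
      (use r in \<open>auto intro!: derivative_eq_intros simp flip: has_real_derivative_iff_has_vector_derivative\<close>)
  have "norm (integral {0..t} (\<lambda>s. exp (- p * of_real (t - s)) * of_real (f s)))
      \<le> integral {0..t} (\<lambda>s. exp (- r * (t - s)) * m)"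
  proof (rule integral_norm_bound_integral)
    show "(\<lambda>s. exp (- p * of_real (t - s)) * of_real (f s) :: complex) integrable_on {0..t}"
      by (rule integrable_continuous_real) (auto intro!: continuous_intros continuous_on_subset[OF f])
    fix s assume s: "s \<in> {0..t}"
    then show "norm (exp (- p * of_real (t - s)) * of_real (f s) :: complex) \<le> exp (- r * (t - s)) * m"
      unfolding norm_mult norm_of_real
      by (intro mult_mono norm_exp_le m) (use r in auto)
  qed (use I in \<open>auto simp: integrable_on_def\<close>)
  also have "\<dots> \<le> m / r"
    using integral_unique[OF I] m0 r by simp
  finally have "norm (integral {0..t} (\<lambda>s. exp (- p * of_real (t - s)) * of_real (f s))) \<le> m / r" .
  moreover have "norm (of_real y0 * exp (- p * of_real t)) \<le> \<bar>y0\<bar> * exp (- r * t)"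
    unfolding norm_mult norm_of_real by (rule mult_left_mono[OF norm_exp_le]) (use r t in auto)
  ultimately show ?thesis
    unfolding duhamel_split[OF f] by (intro order_trans[OF norm_triangle_ineq]) (simp add: mult.commute)
qed

text \<open>
  The forcing acts on \<open>[0, T]\<close> only.  The integral is cut at \<open>min t T\<close>: the bound then contains
  \<open>exp (- Re p * (t - min t T))\<close>, in which \<open>Re p\<close> may be replaced by \<open>r\<close>, so that the
  constant does not depend on \<open>p\<close>.
\<close>

lemma norm_duhamel_decay:
  assumes f: "continuous_on {0..} f" and m: "\<And>s. s \<ge> 0 \<Longrightarrow> \<bar>f s\<bar> \<le> m"
    and supp: "\<And>s. s \<ge> T \<Longrightarrow> f s = 0" and T: "T \<ge> 0"
    and r: "0 < r" "r \<le> Re p" and t: "t \<ge> 0"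
  shows "norm (duhamel p y0 f t) \<le> exp (- r * t) * (\<bar>y0\<bar> + T * exp (r * T) * m)"
proof -
  have m0: "0 \<le> m" using m[of 0] by simp
  let ?k = "\<lambda>s. exp (p * of_real s) * of_real (f s) :: complex"
  define \<tau> where "\<tau> = min t T"
  have \<tau>: "0 \<le> \<tau>" "\<tau> \<le> t" "\<tau> \<le> T" using t T by (auto simp: \<tau>_def)
  have eq: "integral {0..t} ?k = integral {0..\<tau>} ?k"
  proof (cases "t \<le> T")
    case False
    have "integral {0..\<tau>} ?k + integral {\<tau>..t} ?k = integral {0..t} ?k"
      by (rule Henstock_Kurzweil_Integration.integral_combine[OF \<tau>(1,2)])
        (rule integrable_continuous_real[OF continuous_duhamel_integrand[OF f]])
    moreover have "integral {\<tau>..t} ?k = integral {\<tau>..t} (\<lambda>_. 0)"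
      by (rule integral_cong) (use supp False in \<open>auto simp: \<tau>_def\<close>)
    ultimately show ?thesis by simp
  qed (simp add: \<tau>_def min_def)
  have "norm (integral {0..\<tau>} ?k) \<le> exp (Re p * \<tau>) * m * (\<tau> - 0)"
  proof (rule integral_bound[OF \<tau>(1) continuous_duhamel_integrand[OF f]])
    fix s assume "s \<in> {0..\<tau>}"
    then show "norm (?k s) \<le> exp (Re p * \<tau>) * m"
      unfolding norm_mult norm_of_real using r
      by (intro mult_mono m) (auto intro!: mult_left_mono)
  qed
  also have "\<dots> \<le> exp (Re p * \<tau>) * m * T"
    by (intro mult_left_mono) (use \<tau> m0 in auto)
  finally have "norm (exp (- p * of_real t) * integral {0..t} ?k) \<le> exp (- Re p * t) * (exp (Re p * \<tau>) * m * T)"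
    unfolding eq norm_mult by (intro mult_mono) auto
  also have "\<dots> = exp (- Re p * (t - \<tau>)) * (m * T)"
    by (simp add: algebra_simps flip: exp_add)
  also have "\<dots> \<le> exp (- r * (t - \<tau>)) * (m * T)"
    by (rule mult_right_mono) (use r \<tau> m0 T in \<open>auto intro!: mult_right_mono\<close>)
  also have "\<dots> \<le> exp (- r * (t - T)) * (m * T)"
    by (rule mult_right_mono) (use r \<tau> m0 T in auto)
  also have "\<dots> = exp (- r * t) * (T * exp (r * T) * m)"
    by (simp add: algebra_simps flip: exp_add)
  finally have "norm (exp (- p * of_real t) * integral {0..t} ?k) \<le> exp (- r * t) * (T * exp (r * T) * m)" .
  moreover have "norm (exp (- p * of_real t) * of_real y0) \<le> exp (- r * t) * \<bar>y0\<bar>"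
    unfolding norm_mult norm_of_real by (rule mult_right_mono[OF norm_exp_le]) (use r t in auto)
  ultimately show ?thesis
    unfolding duhamel_def distrib_left by (intro order_trans[OF norm_triangle_ineq]) simp
qed

text \<open>
  The two components of the planar system \<open>y' = - \<lambda> y - \<lambda> z + f\<close>, \<open>z' = y - \<delta> z\<close> with
  \<open>y(0) = y0\<close> and \<open>z(0) = 0\<close>, diagonalized: \<open>- p\<close> and \<open>- q\<close> are the eigenvalues of its matrix.
\<close>

definition mode_y :: "real \<Rightarrow> complex \<Rightarrow> complex \<Rightarrow> real \<Rightarrow> (real \<Rightarrow> real) \<Rightarrow> real \<Rightarrow> real" where
  "mode_y \<delta> p q y0 f t =
     Re (((p - of_real \<delta>) * duhamel p y0 f t - (q - of_real \<delta>) * duhamel q y0 f t) / (p - q))"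

definition mode_z :: "complex \<Rightarrow> complex \<Rightarrow> real \<Rightarrow> (real \<Rightarrow> real) \<Rightarrow> real \<Rightarrow> real" where
  "mode_z p q y0 f t = Re ((duhamel q y0 f t - duhamel p y0 f t) / (p - q))"

text \<open>
  In the derivative of \<open>y\<^sup>2 + \<lambda> z\<^sup>2\<close> the mixed terms cancel, and \<open>- 2 \<lambda> y\<^sup>2 - 2 \<lambda> \<delta> z\<^sup>2\<close> remains.
\<close>

lemma mode_energy_zero:
  fixes y z :: "real \<Rightarrow> real"
  assumes "lam > 0" "\<delta> > 0" "a \<le> t"
    and cont: "continuous_on {a..} y" "continuous_on {a..} z"
    and der: "\<And>t. t > a \<Longrightarrow> (y has_real_derivative - lam * (y t + z t)) (at t)"
      "\<And>t. t > a \<Longrightarrow> (z has_real_derivative y t - \<delta> * z t) (at t)"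
    and init: "y a = 0" "z a = 0"
  shows "y t = 0" "z t = 0"
proof -
  let ?E = "\<lambda>t. (y t)\<^sup>2 + lam * (z t)\<^sup>2"
  have "?E t \<le> ?E a"
  proof (rule DERIV_nonpos_imp_decreasing_open[OF \<open>a \<le> t\<close>])
    fix x assume x: "a < x" "x < t"
    have d1: "(?E has_real_derivative
        2 * y x * (- lam * (y x + z x)) + lam * (2 * z x * (y x - \<delta> * z x))) (at x)"
      by (auto intro!: derivative_eq_intros der x simp: power2_eq_square)
    have d2: "2 * y x * (- lam * (y x + z x)) + lam * (2 * z x * (y x - \<delta> * z x))
        = - (2 * lam * (y x)\<^sup>2 + 2 * lam * \<delta> * (z x)\<^sup>2)"
      by (simp add: power2_eq_square algebra_simps)
    have d3: "0 \<le> 2 * lam * (y x)\<^sup>2 + 2 * lam * \<delta> * (z x)\<^sup>2"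
      using assms(1,2) by (intro add_nonneg_nonneg mult_nonneg_nonneg) auto
    show "\<exists>d. (?E has_real_derivative d) (at x) \<and> d \<le> 0"
      by (rule exI, rule conjI[OF d1]) (use d2 d3 in linarith)
  qed (auto intro!: continuous_intros continuous_on_subset[OF cont(1)] continuous_on_subset[OF cont(2)])
  then have E: "(y t)\<^sup>2 + lam * (z t)\<^sup>2 \<le> 0" using init by simp
  moreover have "0 \<le> (y t)\<^sup>2" "0 \<le> lam * (z t)\<^sup>2" using assms(1) by simp_all
  ultimately have "(y t)\<^sup>2 = 0" "lam * (z t)\<^sup>2 = 0" by linarith+
  then show "y t = 0" "z t = 0" using assms(1) by simp_all
qed

locale mode =
  fixes \<delta> lam :: real and p q :: complex
  assumes lam: "lam > 0" and delta: "\<delta> > 0" and pq: "p \<noteq> q"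
    and sum_pq: "p + q = of_real (lam + \<delta>)" and prod_pq: "p * q = of_real (lam * (1 + \<delta>))"
begin

lemma mode_root: "p * (p - of_real \<delta>) = of_real lam * (p - of_real \<delta> - 1)"
  "q * (q - of_real \<delta>) = of_real lam * (q - of_real \<delta> - 1)"
proof -
  have q: "q = of_real (lam + \<delta>) - p" and p: "p = of_real (lam + \<delta>) - q"
    using sum_pq by (simp_all add: algebra_simps)
  show "p * (p - of_real \<delta>) = of_real lam * (p - of_real \<delta> - 1)"
    using prod_pq[unfolded q] by (simp add: algebra_simps)
  show "q * (q - of_real \<delta>) = of_real lam * (q - of_real \<delta> - 1)"
    using prod_pq unfolding arg_cong[OF p, of "\<lambda>x. x * q"] by (simp add: algebra_simps)
qed

text \<open>
  Stated for arbitrary solutions of the two scalar equations, so that it covers forced solutions as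
  well as the pure exponentials of the response kernels.
\<close>

lemma mode_complex_deriv:
  fixes P Q :: "real \<Rightarrow> complex"
  assumes P: "(P has_vector_derivative of_real f - p * P t) F"
    and Q: "(Q has_vector_derivative of_real f - q * Q t) F"
  defines "y \<equiv> \<lambda>t. ((p - of_real \<delta>) * P t - (q - of_real \<delta>) * Q t) / (p - q)"
    and "z \<equiv> \<lambda>t. (Q t - P t) / (p - q)"
  shows "(y has_vector_derivative - of_real lam * (y t + z t) + of_real f) F"
    "(z has_vector_derivative y t - of_real \<delta> * z t) F"
proof -
  have pq': "p - q \<noteq> 0" using pq by simp
  have yt: "(p - q) * y t = (p - of_real \<delta>) * P t - (q - of_real \<delta>) * Q t"
    and zt: "(p - q) * z t = Q t - P t"
    using pq' by (simp_all add: y_def z_def)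
  have 1: "(y has_vector_derivative ((p - of_real \<delta>) * (of_real f - p * P t)
      - (q - of_real \<delta>) * (of_real f - q * Q t)) / (p - q)) F"
    unfolding y_def divide_inverse
    by (intro has_vector_derivative_mult_left has_vector_derivative_diff has_vector_derivative_mult_right P Q)
  have "(p - of_real \<delta>) * (of_real f - p * P t) - (q - of_real \<delta>) * (of_real f - q * Q t)
      = (p - q) * of_real f - (p * (p - of_real \<delta>)) * P t + (q * (q - of_real \<delta>)) * Q t"
    by (simp add: algebra_simps)
  also have "\<dots> = (p - q) * (- of_real lam * (y t + z t) + of_real f)"
    unfolding mode_root distrib_left mult.left_commute[of "p - q"] mult_minus_left mult_minus_right yt zt
    by (simp add: algebra_simps)
  finally show "(y has_vector_derivative - of_real lam * (y t + z t) + of_real f) F"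
    using 1 pq' by simp
  have 2: "(z has_vector_derivative ((of_real f - q * Q t) - (of_real f - p * P t)) / (p - q)) F"
    unfolding z_def divide_inverse
    by (intro has_vector_derivative_mult_left has_vector_derivative_diff P Q)
  have "(of_real f - q * Q t) - (of_real f - p * P t) = (p - q) * (y t - of_real \<delta> * z t)"
    unfolding right_diff_distrib mult.left_commute[of "p - q"] yt zt by (simp add: algebra_simps)
  then have "((of_real f - q * Q t) - (of_real f - p * P t)) / (p - q) = y t - of_real \<delta> * z t"
    using pq' by simp
  then show "(z has_vector_derivative y t - of_real \<delta> * z t) F" using 2 by simp
qed

lemma mode_deriv:
  assumes f: "continuous_on {0..} f" and t: "t \<ge> 0"
  shows "(mode_y \<delta> p q y0 f has_real_derivative
      - lam * (mode_y \<delta> p q y0 f t + mode_z p q y0 f t) + f t) (at t within {0..})"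
    "(mode_z p q y0 f has_real_derivative
      mode_y \<delta> p q y0 f t - \<delta> * mode_z p q y0 f t) (at t within {0..})"
  using mode_complex_deriv[OF duhamel_deriv[OF f t, of p y0] duhamel_deriv[OF f t, of q y0],
      THEN bounded_linear.has_vector_derivative[OF bounded_linear_Re]]
  unfolding mode_y_def[abs_def] mode_z_def[abs_def] has_real_derivative_iff_has_vector_derivative
  by (simp_all del: Re_divide_of_real times_divide_eq_right)

lemma mode_init: "mode_y \<delta> p q y0 f 0 = y0" "mode_z p q y0 f 0 = 0"
proof -
  have "(p - of_real \<delta>) * of_real y0 - (q - of_real \<delta>) * of_real y0 = (p - q) * of_real y0"
    by (simp add: algebra_simps)
  then show "mode_y \<delta> p q y0 f 0 = y0"
    using pq by (simp add: mode_y_def)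
qed (simp add: mode_z_def)

lemma mode_cont:
  assumes "continuous_on {0..} f"
  shows "continuous_on {0..} (mode_y \<delta> p q y0 f)" "continuous_on {0..} (mode_z p q y0 f)"
  unfolding continuous_on_eq_continuous_within
  using mode_deriv[OF assms, THEN DERIV_continuous] by auto

end

text \<open>
  The characteristic equation \<open>p (p - \<delta>) = \<lambda> (p - \<delta> - 1)\<close> is linear in \<open>\<lambda>\<close>, and the factor of \<open>\<lambda>\<close>
  does not vanish: otherwise \<open>p = 1 + \<delta>\<close> and the left-hand side would be \<open>1 + \<delta>\<close>.  So an exponent
  belongs to one eigenvalue only.
\<close>

lemma mode_lam_unique:
  assumes "mode \<delta> l1 p q1" "mode \<delta> l2 p q2 \<or> mode \<delta> l2 q2 p"
  shows "l1 = l2"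
proof -
  have r1: "p * (p - of_real \<delta>) = of_real l1 * (p - of_real \<delta> - 1)"
    using mode.mode_root(1)[OF assms(1)] .
  have r2: "p * (p - of_real \<delta>) = of_real l2 * (p - of_real \<delta> - 1)"
    using assms(2) mode.mode_root(1)[of \<delta> l2 p q2] mode.mode_root(2)[of \<delta> l2 q2 p] by blast
  have "p - of_real \<delta> - 1 \<noteq> 0"
  proof
    assume z: "p - of_real \<delta> - 1 = 0"
    then have "p = of_real (1 + \<delta>)" by (simp add: algebra_simps)
    then have "of_real ((1 + \<delta>) * 1) = (0::complex)" using r1 by (simp add: z)
    then have "1 + \<delta> = 0" by (simp only: of_real_eq_0_iff mult_1_right)
    then show False using mode.delta[OF assms(1)] by simp
  qed
  then show ?thesis using r1 r2 by (metis mult_right_cancel of_real_eq_iff)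
qed

section \<open>The exponents of the modes and uniform bounds\<close>

text \<open>
  The coefficients with which the two exponentials enter \<open>mode_y\<close> and \<open>mode_z\<close>.  The bounds with the
  factor \<open>lam\<close> say that the slow exponential enters \<open>mode_y\<close>, and both enter \<open>mode_z\<close>, with a
  coefficient of order \<open>1 / lam\<close>.
\<close>

definition coefficient_bound :: "real \<Rightarrow> real \<Rightarrow> complex \<Rightarrow> complex \<Rightarrow> real \<Rightarrow> bool" where
  "coefficient_bound \<delta> lam p q K \<longleftrightarrow>
     norm (p - of_real \<delta>) / norm (p - q) \<le> K \<and> norm (q - of_real \<delta>) / norm (p - q) \<le> K \<and>
     lam * (norm (q - of_real \<delta>) / norm (p - q)) \<le> K \<and> lam * (1 / norm (p - q)) \<le> K"

lemma norm_comb_le: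
  fixes a b c X Y :: complex
  assumes "norm a / norm c \<le> K" "norm b / norm c \<le> L" "norm X \<le> x" "norm Y \<le> y"
  shows "norm ((a * X - b * Y) / c) \<le> K * x + L * y"
proof -
  have 0: "0 \<le> K" "0 \<le> L"
    using assms(1,2) by (meson divide_nonneg_nonneg norm_ge_zero order_trans)+
  have "norm ((a * X - b * Y) / c) \<le> norm (a * X / c) + norm (b * Y / c)"
    by (metis diff_divide_distrib norm_triangle_ineq4)
  also have "\<dots> = norm a / norm c * norm X + norm b / norm c * norm Y"
    by (simp add: norm_mult norm_divide)
  also have "\<dots> \<le> K * x + L * y"
    using assms 0 by (intro add_mono mult_mono) auto
  finally show ?thesis .
qed

context mode
begin

context
  fixes f :: "real \<Rightarrow> real" and m K y0 t :: real
  assumes f: "continuous_on {0..} f" and m: "\<And>s. s \<ge> 0 \<Longrightarrow> \<bar>f s\<bar> \<le> m" and t: "t \<ge> 0"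
    and p: "lam / 2 \<le> Re p" and q: "0 \<le> Re q"
    and bound: "coefficient_bound \<delta> lam p q K"
begin

lemmas K = bound[unfolded coefficient_bound_def, THEN conjunct1]
  bound[unfolded coefficient_bound_def, THEN conjunct2, THEN conjunct1]
  bound[unfolded coefficient_bound_def, THEN conjunct2, THEN conjunct2, THEN conjunct1]
  bound[unfolded coefficient_bound_def, THEN conjunct2, THEN conjunct2, THEN conjunct2]

lemma mode_p_nonneg: "0 \<le> Re p" using p lam by linarith

lemma mode_y_bounded: "\<bar>mode_y \<delta> p q y0 f t\<bar> \<le> 2 * K * (\<bar>y0\<bar> + t * m)"
proof -
  have "\<bar>mode_y \<delta> p q y0 f t\<bar> \<le> K * (\<bar>y0\<bar> + t * m) + K * (\<bar>y0\<bar> + t * m)"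
    unfolding mode_y_def
    by (rule order_trans[OF abs_Re_le_cmod norm_comb_le[OF K(1,2)]])
      (rule norm_duhamel_bounded[OF f m _ t], use mode_p_nonneg q in auto)+
  then show ?thesis by (simp add: algebra_simps)
qed

text \<open>
  The initial datum is smoothed by the fast exponential alone; the slow one carries a factor
  \<open>1 / lam\<close> that cancels the eigenvalue.
\<close>

lemma mode_y_smoothing:
  "lam * \<bar>mode_y \<delta> p q y0 f t\<bar> \<le> K * (lam * exp (- (lam / 2) * t) * \<bar>y0\<bar> + \<bar>y0\<bar> + (2 + t) * m)"
proof -
  have P: "norm (duhamel p y0 f t) \<le> exp (- (lam / 2) * t) * \<bar>y0\<bar> + m / (lam / 2)"
    by (rule norm_duhamel_dissipative[OF f m _ p t]) (use lam in auto)
  have Q: "norm (duhamel q y0 f t) \<le> \<bar>y0\<bar> + t * m"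
    by (rule norm_duhamel_bounded[OF f m q t])
  have Kq: "norm (q - of_real \<delta>) / norm (p - q) \<le> K / lam"
    using K(3) lam by (simp add: field_simps)
  have "\<bar>mode_y \<delta> p q y0 f t\<bar> \<le> K * (exp (- (lam / 2) * t) * \<bar>y0\<bar> + m / (lam / 2)) + K / lam * (\<bar>y0\<bar> + t * m)"
    unfolding mode_y_def
    by (rule order_trans[OF abs_Re_le_cmod norm_comb_le[OF K(1) Kq P Q]])
  then have "lam * \<bar>mode_y \<delta> p q y0 f t\<bar>
      \<le> lam * (K * (exp (- (lam / 2) * t) * \<bar>y0\<bar> + m / (lam / 2)) + K / lam * (\<bar>y0\<bar> + t * m))"
    using lam by (intro mult_left_mono) auto
  also have "\<dots> = K * (lam * exp (- (lam / 2) * t) * \<bar>y0\<bar> + \<bar>y0\<bar> + (2 + t) * m)"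
    using lam by (simp add: field_simps)
  finally show ?thesis .
qed

lemma mode_z_bounded: "lam * \<bar>mode_z p q y0 f t\<bar> \<le> 2 * K * (\<bar>y0\<bar> + t * m)"
proof -
  have K1: "norm (1::complex) / norm (p - q) \<le> K / lam"
    using K(4) lam by (simp add: field_simps)
  have "\<bar>mode_z p q y0 f t\<bar> \<le> K / lam * (\<bar>y0\<bar> + t * m) + K / lam * (\<bar>y0\<bar> + t * m)"
    unfolding mode_z_def
    by (rule order_trans[OF abs_Re_le_cmod norm_comb_le[OF K1 K1, unfolded mult_1]])
      (rule norm_duhamel_bounded[OF f m _ t], use mode_p_nonneg q in auto)+
  then have "lam * \<bar>mode_z p q y0 f t\<bar> \<le> lam * (K / lam * (\<bar>y0\<bar> + t * m) + K / lam * (\<bar>y0\<bar> + t * m))"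
    using lam by (intro mult_left_mono) auto
  also have "\<dots> = 2 * K * (\<bar>y0\<bar> + t * m)" using lam by (simp add: field_simps)
  finally show ?thesis .
qed

lemma mode_y_decay:
  assumes supp: "\<And>s. s \<ge> T \<Longrightarrow> f s = 0" and T: "T \<ge> 0"
    and r: "0 < r" "r \<le> Re p" "r \<le> Re q"
  shows "\<bar>mode_y \<delta> p q y0 f t\<bar> \<le> 2 * K * (exp (- r * t) * (\<bar>y0\<bar> + T * exp (r * T) * m))"
proof -
  let ?b = "exp (- r * t) * (\<bar>y0\<bar> + T * exp (r * T) * m)"
  have "\<bar>mode_y \<delta> p q y0 f t\<bar> \<le> K * ?b + K * ?b"
    unfolding mode_y_def
    by (rule order_trans[OF abs_Re_le_cmod norm_comb_le[OF K(1,2)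
          norm_duhamel_decay[OF f m supp T r(1,2) t] norm_duhamel_decay[OF f m supp T r(1,3) t]]])
  then show ?thesis by simp
qed

end

end

lemma mu_diff: "mu_plus \<delta> lam j - mu_minus \<delta> lam j = csqrt (of_real ((lam j - \<delta>)\<^sup>2 - 4 * lam j))"
  by (simp add: mu_plus_def mu_minus_def field_simps)

text \<open>
  The discriminant \<open>(\<lambda> - \<delta>)\<^sup>2 - 4 \<lambda>\<close> vanishes exactly when \<open>\<delta>\<close> is \<open>\<lambda> + 2 \<surd>\<lambda>\<close> or \<open>\<lambda> - 2 \<surd>\<lambda>\<close>.
\<close>

lemma mu_mode:
  assumes lam: "lam j > 0" and \<delta>: "\<delta> > 0"
    and nd: "\<delta> \<noteq> lam j + 2 * sqrt (lam j)" "\<delta> \<noteq> lam j - 2 * sqrt (lam j)"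
  shows "mode \<delta> (lam j) (mu_plus \<delta> lam j) (mu_minus \<delta> lam j)"
proof
  let ?d = "(lam j - \<delta>)\<^sup>2 - 4 * lam j"
  have "?d \<noteq> 0"
  proof
    assume "?d = 0"
    then have "(lam j - \<delta>)\<^sup>2 = (2 * sqrt (lam j))\<^sup>2" using lam by (simp add: power_mult_distrib)
    then have "lam j - \<delta> = 2 * sqrt (lam j) \<or> lam j - \<delta> = - (2 * sqrt (lam j))"
      by (simp only: power2_eq_iff)
    then show False using nd by auto
  qed
  then have "csqrt (of_real ?d) \<noteq> 0" by (metis csqrt_eq_0 of_real_eq_0_iff)
  then show "mu_plus \<delta> lam j \<noteq> mu_minus \<delta> lam j"
    using mu_diff[of \<delta> lam j] by auto
  have "mu_plus \<delta> lam j * mu_minus \<delta> lam j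
      = ((of_real (lam j + \<delta>))\<^sup>2 - (csqrt (of_real ?d))\<^sup>2) / 4"
    unfolding mu_plus_def mu_minus_def by (simp add: power2_eq_square algebra_simps)
  also have "\<dots> = of_real (((lam j + \<delta>)\<^sup>2 - ?d) / 4)"
    unfolding power2_csqrt by simp
  also have "((lam j + \<delta>)\<^sup>2 - ?d) / 4 = lam j * (1 + \<delta>)"
    by (simp add: power2_eq_square algebra_simps)
  finally show "mu_plus \<delta> lam j * mu_minus \<delta> lam j = of_real (lam j * (1 + \<delta>))" .
qed (use assms in \<open>auto simp: mu_plus_def mu_minus_def field_simps\<close>)

lemma Re_csqrt_nonneg: "0 \<le> Re (csqrt z)"
  using csqrt_principal[of z] by auto

lemma Re_mu_plus_ge:
  assumes "\<delta> > 0"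
  shows "lam j / 2 \<le> Re (mu_plus \<delta> lam j)"
  using assms Re_csqrt_nonneg[of "of_real ((lam j - \<delta>)\<^sup>2 - 4 * lam j)"]
  unfolding mu_plus_def by (simp del: csqrt.simps)

lemma Re_mu_minus_nonneg:
  assumes lam: "lam j > 0" and \<delta>: "\<delta> > 0"
  shows "0 \<le> Re (mu_minus \<delta> lam j)"
proof -
  let ?d = "(lam j - \<delta>)\<^sup>2 - 4 * lam j"
  have "Re (csqrt (of_real ?d)) \<le> lam j + \<delta>"
  proof (cases "0 \<le> ?d")
    case True
    have "?d \<le> (lam j + \<delta>)\<^sup>2"
      using lam \<delta> by (simp add: power2_eq_square algebra_simps)
    then have "sqrt ?d \<le> lam j + \<delta>"
      using lam \<delta> by (intro real_le_lsqrt) auto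
    then show ?thesis by (subst csqrt_of_real_nonneg) (use True in auto)
  next
    case False
    then show ?thesis using lam \<delta> by (subst csqrt_of_real_nonpos) auto
  qed
  then show ?thesis unfolding mu_minus_def by (simp del: csqrt.simps)
qed

lemma mu_eventually_real:
  assumes "filterlim lam at_top sequentially"
  shows "\<forall>\<^sub>F j in sequentially.
    mu_plus \<delta> lam j = of_real ((lam j + \<delta> + sqrt ((lam j - \<delta>)\<^sup>2 - 4 * lam j)) / 2) \<and>
    mu_minus \<delta> lam j = of_real ((lam j + \<delta> - sqrt ((lam j - \<delta>)\<^sup>2 - 4 * lam j)) / 2)"
proof -
  have "\<forall>\<^sub>F x in at_top. 0 \<le> (x - \<delta>)\<^sup>2 - 4 * x" by real_asymp
  then have "\<forall>\<^sub>F j in sequentially. 0 \<le> (lam j - \<delta>)\<^sup>2 - 4 * lam j"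
    using assms by (rule eventually_compose_filterlim)
  then show ?thesis
  proof eventually_elim
    case (elim j)
    show ?case
      unfolding mu_plus_def mu_minus_def csqrt_of_real_nonneg[of "of_real ((lam j - \<delta>)\<^sup>2 - 4 * lam j)", simplified Im_complex_of_real Re_complex_of_real, OF refl elim]
      by simp
  qed
qed

text \<open>
  Each quantity is eventually a function of the real number \<open>lam j\<close> with a finite limit as
  \<open>lam j\<close> tends to infinity, hence a bounded sequence.
\<close>

lemma mu_coefficient_bounds:
  assumes lam: "filterlim lam at_top sequentially" and \<delta>: "\<delta> > 0"
  obtains K where "K > 0" "\<And>j. coefficient_bound \<delta> (lam j) (mu_plus \<delta> lam j) (mu_minus \<delta> lam j) K"
proof -
  let ?p = "mu_plus \<delta> lam" and ?q = "mu_minus \<delta> lam"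
  define P where "P x = (x + \<delta> + sqrt ((x - \<delta>)\<^sup>2 - 4 * x)) / 2" for x
  define Q where "Q x = (x + \<delta> - sqrt ((x - \<delta>)\<^sup>2 - 4 * x)) / 2" for x
  have bounded: "\<exists>K>0. \<forall>j. s j \<le> K"
    if ev: "\<forall>\<^sub>F j in sequentially. s j = S (lam j)" and lim: "(S \<longlongrightarrow> L) at_top"
    for s :: "nat \<Rightarrow> real" and S L
  proof -
    have "(\<lambda>j. S (lam j)) \<longlonglongrightarrow> L" by (rule filterlim_compose[OF lim lam])
    then have "s \<longlonglongrightarrow> L" using ev by (simp add: tendsto_cong)
    then have "Bseq s" by (intro convergent_imp_Bseq convergentI)
    then obtain K where "K > 0" "\<And>j. norm (s j) \<le> K" by (auto elim: BseqE)
    then show ?thesis by (metis abs_le_D1 real_norm_def)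
  qed
  have ev: "\<forall>\<^sub>F j in sequentially. ?p j = of_real (P (lam j)) \<and> ?q j = of_real (Q (lam j))"
    using mu_eventually_real[OF lam, of \<delta>] by (simp only: P_def Q_def)
  have n: "norm (of_real a - of_real b :: complex) = \<bar>a - b\<bar>" for a b
    by (metis norm_of_real of_real_diff)
  have PQ: "P x - Q x = sqrt ((x - \<delta>)\<^sup>2 - 4 * x)" for x
    by (simp add: P_def Q_def field_simps)
  have Q1: "((\<lambda>x. \<bar>Q x - \<delta>\<bar>) \<longlongrightarrow> \<bar>1\<bar>) at_top"
    unfolding Q_def by (intro tendsto_rabs) (real_asymp, simp add: field_simps)
  have r0: "((\<lambda>x. 1 / \<bar>sqrt ((x - \<delta>)\<^sup>2 - 4 * x)\<bar>) \<longlongrightarrow> 0) at_top"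
    by real_asymp
  have r1: "((\<lambda>x. x * (1 / \<bar>sqrt ((x - \<delta>)\<^sup>2 - 4 * x)\<bar>)) \<longlongrightarrow> 1) at_top"
    by real_asymp
  obtain K1 where K1: "K1 > 0" "\<And>j. norm (?p j - of_real \<delta>) / norm (?p j - ?q j) \<le> K1"
  proof -
    have "((\<lambda>x. \<bar>P x - \<delta>\<bar> / \<bar>P x - Q x\<bar>) \<longlongrightarrow> 1) at_top"
      unfolding P_def Q_def by real_asymp
    then have "\<exists>K>0. \<forall>j. norm (?p j - of_real \<delta>) / norm (?p j - ?q j) \<le> K"
    proof (rule bounded[rotated])
      show "\<forall>\<^sub>F j in sequentially. norm (?p j - of_real \<delta>) / norm (?p j - ?q j) = \<bar>P (lam j) - \<delta>\<bar> / \<bar>P (lam j) - Q (lam j)\<bar>"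
        using ev by eventually_elim (simp add: n)
    qed
    then show ?thesis using that by blast
  qed
  obtain K2 where K2: "K2 > 0" "\<And>j. norm (?q j - of_real \<delta>) / norm (?p j - ?q j) \<le> K2"
  proof -
    have "((\<lambda>x. \<bar>Q x - \<delta>\<bar> / \<bar>P x - Q x\<bar>) \<longlongrightarrow> 0) at_top"
      using tendsto_mult[OF Q1 r0] by (simp add: PQ)
    then have "\<exists>K>0. \<forall>j. norm (?q j - of_real \<delta>) / norm (?p j - ?q j) \<le> K"
    proof (rule bounded[rotated])
      show "\<forall>\<^sub>F j in sequentially. norm (?q j - of_real \<delta>) / norm (?p j - ?q j) = \<bar>Q (lam j) - \<delta>\<bar> / \<bar>P (lam j) - Q (lam j)\<bar>"
        using ev by eventually_elim (simp add: n)
    qed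
    then show ?thesis using that by blast
  qed
  obtain K3 where K3: "K3 > 0" "\<And>j. lam j * (norm (?q j - of_real \<delta>) / norm (?p j - ?q j)) \<le> K3"
  proof -
    have "((\<lambda>x. x * (\<bar>Q x - \<delta>\<bar> / \<bar>P x - Q x\<bar>)) \<longlongrightarrow> 1) at_top"
      using tendsto_mult[OF Q1 r1] by (simp add: PQ mult.commute)
    then have "\<exists>K>0. \<forall>j. lam j * (norm (?q j - of_real \<delta>) / norm (?p j - ?q j)) \<le> K"
    proof (rule bounded[rotated])
      show "\<forall>\<^sub>F j in sequentially. lam j * (norm (?q j - of_real \<delta>) / norm (?p j - ?q j)) = lam j * (\<bar>Q (lam j) - \<delta>\<bar> / \<bar>P (lam j) - Q (lam j)\<bar>)"
        using ev by eventually_elim (simp add: n)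
    qed
    then show ?thesis using that by blast
  qed
  obtain K4 where K4: "K4 > 0" "\<And>j. lam j * (1 / norm (?p j - ?q j)) \<le> K4"
  proof -
    have "((\<lambda>x. x * (1 / \<bar>P x - Q x\<bar>)) \<longlongrightarrow> 1) at_top"
      using r1 by (simp only: PQ)
    then have "\<exists>K>0. \<forall>j. lam j * (1 / norm (?p j - ?q j)) \<le> K"
    proof (rule bounded[rotated])
      show "\<forall>\<^sub>F j in sequentially. lam j * (1 / norm (?p j - ?q j)) = lam j * (1 / \<bar>P (lam j) - Q (lam j)\<bar>)"
        using ev by eventually_elim (simp add: n)
    qed
    then show ?thesis using that by blast
  qed
  let ?K = "K1 + K2 + K3 + K4"
  show ?thesis
  proof (rule that[of ?K])
    show "?K > 0" using K1 K2 K3 K4 by linarith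
    show "coefficient_bound \<delta> (lam j) (?p j) (?q j) ?K" for j
      unfolding coefficient_bound_def
      using K1(1) K2(1) K3(1) K4(1) K1(2)[of j] K2(2)[of j] K3(2)[of j] K4(2)[of j]
      by (intro conjI) linarith+
  qed
qed

text \<open>
  The two sets whose suprema define \<open>num_modes\<close> are bounded, since \<open>Re (mu_plus \<delta> lam j)\<close> tends to
  infinity and \<open>Re (mu_minus \<delta> lam j)\<close> to \<open>1 + \<delta>\<close>; otherwise a supremum of naturals would say nothing.
\<close>

lemma num_modes_fast:
  assumes lam: "filterlim lam at_top sequentially" and \<delta>: "\<delta> > 0" and \<gamma>: "\<gamma> < 1 + \<delta>"
    and j: "num_modes \<delta> lam \<gamma> \<le> j"
  shows "\<gamma> < Re (mu_plus \<delta> lam j)" "\<gamma> < Re (mu_minus \<delta> lam j)"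
proof -
  have le: "Suc i \<le> Sup {Suc j |j. Re (s j) \<le> \<gamma>}"
    if ev: "\<forall>\<^sub>F j in sequentially. \<gamma> < Re (s j)" and "Re (s i) \<le> \<gamma>" for s :: "nat \<Rightarrow> complex" and i
  proof (rule cSup_upper)
    obtain n where n: "\<And>j. j \<ge> n \<Longrightarrow> \<gamma> < Re (s j)"
      using ev by (auto simp: eventually_sequentially)
    show "bdd_above {Suc j |j. Re (s j) \<le> \<gamma>}"
    proof (rule bdd_aboveI)
      fix x assume "x \<in> {Suc j |j. Re (s j) \<le> \<gamma>}"
      then obtain j where "x = Suc j" "Re (s j) \<le> \<gamma>" by auto
      then show "x \<le> n" using n[of j] by (cases "n \<le> j") auto
    qed
  qed (use that in auto)
  have "\<forall>\<^sub>F j in sequentially. 2 * \<gamma> < lam j"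
    using lam by (simp add: filterlim_at_top_dense)
  then have ev1: "\<forall>\<^sub>F j in sequentially. \<gamma> < Re (mu_plus \<delta> lam j)"
  proof eventually_elim
    case (elim j)
    then show ?case using Re_mu_plus_ge[OF \<delta>, of lam j] by linarith
  qed
  have "((\<lambda>x. (x + \<delta> - sqrt ((x - \<delta>)\<^sup>2 - 4 * x)) / 2) \<longlongrightarrow> 1 + \<delta>) at_top"
    by (real_asymp, simp add: field_simps)
  then have "(\<lambda>j. (lam j + \<delta> - sqrt ((lam j - \<delta>)\<^sup>2 - 4 * lam j)) / 2) \<longlonglongrightarrow> 1 + \<delta>"
    by (rule filterlim_compose[OF _ lam])
  then have "\<forall>\<^sub>F j in sequentially. \<gamma> < (lam j + \<delta> - sqrt ((lam j - \<delta>)\<^sup>2 - 4 * lam j)) / 2"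
    using \<gamma> by (rule order_tendstoD)
  then have ev2: "\<forall>\<^sub>F j in sequentially. \<gamma> < Re (mu_minus \<delta> lam j)"
    using mu_eventually_real[OF lam, of \<delta>] by eventually_elim (simp only: Re_complex_of_real)
  show "\<gamma> < Re (mu_plus \<delta> lam j)"
    using le[OF ev1, of j] j unfolding num_modes_def by (force simp: not_less)
  show "\<gamma> < Re (mu_minus \<delta> lam j)"
    using le[OF ev2, of j] j unfolding num_modes_def by (force simp: not_less)
qed

section \<open>Solutions of the equation with memory\<close>

lemma continuous_on_halflineI:
  fixes g :: "real \<Rightarrow> 'a::topological_space"
  assumes "\<And>b. continuous_on {0..b} g"
  shows "continuous_on {0..} g"
  unfolding continuous_on_eq_continuous_within
proof
  fix t :: real assume t: "t \<in> {0..}"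
  then have "continuous (at t within {0..t+1}) g"
    using assms[of "t + 1"] by (simp add: continuous_on_eq_continuous_within)
  then show "continuous (at t within {0..}) g" using t by (simp add: at_within_halfline)
qed

lemma continuous_on_open_halflineI:
  fixes g :: "real \<Rightarrow> 'a::topological_space"
  assumes "\<And>a b. 0 < a \<Longrightarrow> continuous_on {a..b} g"
  shows "continuous_on {0<..} g"
  unfolding continuous_on_eq_continuous_within
proof
  fix t :: real assume t: "t \<in> {0<..}"
  then have "continuous (at t within {t/2..t+1}) g"
    using assms[of "t/2" "t+1"] by (simp add: continuous_on_eq_continuous_within)
  then have "continuous (at t) g" using t by (simp add: at_within_Icc_at)
  then show "continuous (at t within {0<..}) g" by (rule continuous_at_imp_continuous_within)
qed

text \<open>
  The real counterpart of \<open>memory_solution\<close>.  Real and imaginary part of a complexified solution are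
  solutions of this equation.
\<close>

definition real_memory_solution ::
  "'h::{real_inner,banach} set \<Rightarrow> ('h \<Rightarrow> 'h) \<Rightarrow> real \<Rightarrow> (real \<Rightarrow> 'h) \<Rightarrow> 'h \<Rightarrow> (real \<Rightarrow> 'h) \<Rightarrow> bool" where
  "real_memory_solution D A \<delta> f y0 y \<longleftrightarrow>
     continuous_on {0..} y \<and> y 0 = y0 \<and>
     (\<exists>y'. continuous_on {0<..} y' \<and>
        (\<forall>t>0. y t \<in> D \<and> (y has_vector_derivative y' t) (at t) \<and>
           (\<lambda>s. mem_kernel \<delta> (t - s) *\<^sub>R A (y s)) integrable_on {0..t} \<and>
           y' t + A (y t) + integral {0..t} (\<lambda>s. mem_kernel \<delta> (t - s) *\<^sub>R A (y s)) = f t))"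

lemma x_exp_le: "x * exp (- x) \<le> 1" for x :: real
proof -
  have "x \<le> exp x" using exp_ge_add_one_self[of x] by linarith
  then have "x * exp (- x) \<le> exp x * exp (- x)" by (intro mult_right_mono) auto
  then show ?thesis by (simp flip: exp_add)
qed

abbreviation "mu_mode_y \<delta> lam j \<equiv> mode_y \<delta> (mu_plus \<delta> lam j) (mu_minus \<delta> lam j)"
abbreviation "mu_mode_z \<delta> lam j \<equiv> mode_z (mu_plus \<delta> lam j) (mu_minus \<delta> lam j)"

locale memory_system = onb \<phi> for \<phi> :: "nat \<Rightarrow> 'h::{real_inner,banach}" +
  fixes D :: "'h set" and A :: "'h \<Rightarrow> 'h" and \<delta> :: real and lam :: "nat \<Rightarrow> real"
  assumes selfadjoint: "selfadjoint_operator D A"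
    and phi_D: "\<phi> j \<in> D" and eig: "A (\<phi> j) = lam j *\<^sub>R \<phi> j"
    and lam_inf: "filterlim lam at_top sequentially"
    and modes: "mode \<delta> (lam j) (mu_plus \<delta> lam j) (mu_minus \<delta> lam j)"
begin

lemma lam_pos: "lam j > 0" using modes mode.lam by blast
lemma delta_pos: "\<delta> > 0" using modes mode.delta by blast

abbreviation "Y y0 f j \<equiv>
  mu_mode_y \<delta> lam j (inner y0 (\<phi> j)) (\<lambda>s. inner (f s) (\<phi> j))"
abbreviation "Z y0 f j \<equiv>
  mu_mode_z \<delta> lam j (inner y0 (\<phi> j)) (\<lambda>s. inner (f s) (\<phi> j))"

lemma coef_A: "x \<in> D \<Longrightarrow> inner (A x) (\<phi> j) = lam j * inner x (\<phi> j)"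
  using selfadjoint phi_D[of j] eig[of j] unfolding selfadjoint_operator_def
  by (metis inner_scaleR_right)

text \<open>
  Self-adjointness makes the domain maximal: the series is in the domain of the adjoint, with the
  obvious image, because the inner product with \<open>A x\<close> can be computed coefficientwise.
\<close>

lemma synth_in_domain:
  assumes a: "ell2 a" and la: "ell2 (\<lambda>j. lam j * a j)"
  shows "synth a \<in> D" "A (synth a) = synth (\<lambda>j. lam j * a j)"
proof -
  have "inner (A x) (synth a) = inner x (synth (\<lambda>j. lam j * a j))" if "x \<in> D" for x
  proof -
    have "(\<lambda>j. inner x (\<phi> j) * (lam j * a j)) sums inner (A x) (synth a)"
      using inner_synth_sums[OF a, of "A x"] by (simp add: coef_A that mult_ac)
    then show ?thesis using inner_synth_sums[OF la, of x] by (rule sums_unique2)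
  qed
  then have "synth a \<in> D \<and> synth (\<lambda>j. lam j * a j) = A (synth a)"
    using selfadjoint unfolding selfadjoint_operator_def by blast
  then show "synth a \<in> D" "A (synth a) = synth (\<lambda>j. lam j * a j)" by auto
qed

text \<open>
  The value \<open>A (y 0)\<close> has no meaning when \<open>y 0\<close> lies outside the domain; it is removed from the
  integral as a set of measure zero.
\<close>

lemma memory_coef:
  assumes y: "continuous_on {0..} y" and D: "\<And>s. s > 0 \<Longrightarrow> y s \<in> D"
    and int: "(\<lambda>s. mem_kernel \<delta> (t - s) *\<^sub>R A (y s)) integrable_on {0..t}"
  shows "inner (integral {0..t} (\<lambda>s. mem_kernel \<delta> (t - s) *\<^sub>R A (y s))) (\<phi> j)
    = lam j * (exp (- \<delta> * t) * integral {0..t} (\<lambda>s. exp (\<delta> * s) * inner (y s) (\<phi> j)))"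
proof -
  have "inner (integral {0..t} (\<lambda>s. mem_kernel \<delta> (t - s) *\<^sub>R A (y s))) (\<phi> j)
      = integral {0..t} (\<lambda>s. inner (mem_kernel \<delta> (t - s) *\<^sub>R A (y s)) (\<phi> j))"
    using integral_linear[OF int bounded_linear_inner_left[of "\<phi> j"]] by (simp add: o_def)
  also have "\<dots> = integral {0..t} (\<lambda>s. (lam j * exp (- \<delta> * t)) * (exp (\<delta> * s) * inner (y s) (\<phi> j)))"
    by (rule integral_spike[of "{0}"])
      (auto simp: mem_kernel_def coef_A D algebra_simps simp flip: exp_add)
  finally show ?thesis by (simp only: integral_mult_right mult.assoc)
qed

text \<open>
  Each coefficient of the difference of two solutions, together with its memory, solves the planar
  system without forcing and with zero datum, so its energy is zero.  The energy is continuous up to \<open>t = 0\<close>,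
  although the equation holds for \<open>t > 0\<close> only.
\<close>

lemma real_memory_solution_unique:
  assumes y: "real_memory_solution D A \<delta> f y0 y" and z: "real_memory_solution D A \<delta> f y0 z"
    and t: "t \<ge> 0"
  shows "y t = z t"
proof (rule coef_eqI)
  fix j
  obtain y' where y': "\<And>t. t > 0 \<Longrightarrow> y t \<in> D \<and> (y has_vector_derivative y' t) (at t) \<and>
           (\<lambda>s. mem_kernel \<delta> (t - s) *\<^sub>R A (y s)) integrable_on {0..t} \<and>
           y' t + A (y t) + integral {0..t} (\<lambda>s. mem_kernel \<delta> (t - s) *\<^sub>R A (y s)) = f t"
    and yc: "continuous_on {0..} y" and y0: "y 0 = y0"
    using y unfolding real_memory_solution_def by auto
  obtain z' where z': "\<And>t. t > 0 \<Longrightarrow> z t \<in> D \<and> (z has_vector_derivative z' t) (at t) \<and>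
           (\<lambda>s. mem_kernel \<delta> (t - s) *\<^sub>R A (z s)) integrable_on {0..t} \<and>
           z' t + A (z t) + integral {0..t} (\<lambda>s. mem_kernel \<delta> (t - s) *\<^sub>R A (z s)) = f t"
    and zc: "continuous_on {0..} z" and z0: "z 0 = y0"
    using z unfolding real_memory_solution_def by auto
  define u where "u s = inner (y s) (\<phi> j) - inner (z s) (\<phi> j)" for s
  have uc: "continuous_on {0..} u"
    unfolding u_def by (intro continuous_intros yc zc)
  have kc: "continuous_on {0..b} (\<lambda>s. exp (\<delta> * s) * inner (x s) (\<phi> j))"
    if "continuous_on {0..} x" for b :: real and x
    by (intro continuous_intros continuous_on_subset[OF that]) auto
  have kuc: "continuous_on {0..b} (\<lambda>s. exp (\<delta> * s) * u s)" for b
    by (intro continuous_intros continuous_on_subset[OF uc]) auto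
  define w where "w s = exp (- \<delta> * s) * integral {0..s} (\<lambda>r. exp (\<delta> * r) * u r)" for s
  have wd: "(w has_real_derivative u s - \<delta> * w s) (at s within {0..})" if s: "s \<ge> 0" for s
  proof -
    have "((\<lambda>s. integral {0..s} (\<lambda>r. exp (\<delta> * r) * u r)) has_real_derivative exp (\<delta> * s) * u s)
        (at s within {0..s+1})"
      by (rule integral_has_real_derivative[OF kuc]) (use s in auto)
    then have "((\<lambda>s. integral {0..s} (\<lambda>r. exp (\<delta> * r) * u r)) has_real_derivative exp (\<delta> * s) * u s)
        (at s within {0..})" by (simp add: at_within_halfline s)
    then have "(w has_real_derivative (- \<delta> * exp (- \<delta> * s)) * integral {0..s} (\<lambda>r. exp (\<delta> * r) * u r)
        + (exp (\<delta> * s) * u s) * exp (- \<delta> * s)) (at s within {0..})"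
      unfolding w_def by (intro DERIV_mult) (auto intro!: derivative_eq_intros)
    moreover have "exp (\<delta> * s) * exp (- \<delta> * s) = 1" by (simp flip: exp_add)
    then have k: "(exp (\<delta> * s) * u s) * exp (- \<delta> * s) = u s"
      by (metis mult.commute mult.left_commute mult.right_neutral)
    have "(- \<delta> * exp (- \<delta> * s)) * integral {0..s} (\<lambda>r. exp (\<delta> * r) * u r)
        + (exp (\<delta> * s) * u s) * exp (- \<delta> * s) = u s - \<delta> * w s"
      unfolding k w_def by simp
    ultimately show ?thesis by simp
  qed
  have "u t = 0"
  proof (rule mode_energy_zero(1)[OF lam_pos[of j] delta_pos t uc])
    show "continuous_on {0..} w"
      unfolding continuous_on_eq_continuous_within using wd[THEN DERIV_continuous] by auto
    fix s :: real assume s: "s > 0"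
    show "(w has_real_derivative u s - \<delta> * w s) (at s)"
      using DERIV_subset[OF wd[of s], of "{0<..}"] s at_within_open[of s "{0<..}"]
      by (simp add: Ioi_le_Ico)
    have du: "(u has_real_derivative inner (y' s) (\<phi> j) - inner (z' s) (\<phi> j)) (at s)"
      unfolding u_def has_real_derivative_iff_has_vector_derivative
      by (intro has_vector_derivative_diff bounded_linear.has_vector_derivative[OF bounded_linear_inner_left])
        (use y'[OF s] z'[OF s] in auto)
    have co: "inner (x' s) (\<phi> j) = inner (f s) (\<phi> j) - lam j * inner (x s) (\<phi> j)
        - lam j * (exp (- \<delta> * s) * integral {0..s} (\<lambda>r. exp (\<delta> * r) * inner (x r) (\<phi> j)))"
      if "\<And>t. t > 0 \<Longrightarrow> x t \<in> D \<and> (x has_vector_derivative x' t) (at t) \<and>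
           (\<lambda>s. mem_kernel \<delta> (t - s) *\<^sub>R A (x s)) integrable_on {0..t} \<and>
           x' t + A (x t) + integral {0..t} (\<lambda>s. mem_kernel \<delta> (t - s) *\<^sub>R A (x s)) = f t"
        and xc: "continuous_on {0..} x" for x x'
    proof -
      have "x' s = f s - A (x s) - integral {0..s} (\<lambda>r. mem_kernel \<delta> (s - r) *\<^sub>R A (x r))"
        using that(1)[OF s] by (auto simp: algebra_simps)
      then show ?thesis
        using memory_coef[OF xc, of s j] that(1) s by (simp add: inner_diff_left coef_A)
    qed
    have "integral {0..s} (\<lambda>r. exp (\<delta> * r) * inner (y r) (\<phi> j))
        - integral {0..s} (\<lambda>r. exp (\<delta> * r) * inner (z r) (\<phi> j))
        = integral {0..s} (\<lambda>r. exp (\<delta> * r) * inner (y r) (\<phi> j) - exp (\<delta> * r) * inner (z r) (\<phi> j))"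
      by (rule integral_diff[symmetric]) (intro integrable_continuous_real kc yc zc)+
    also have "\<dots> = integral {0..s} (\<lambda>r. exp (\<delta> * r) * u r)"
      by (simp add: u_def right_diff_distrib)
    finally have ws: "w s = exp (- \<delta> * s) * integral {0..s} (\<lambda>r. exp (\<delta> * r) * inner (y r) (\<phi> j))
        - exp (- \<delta> * s) * integral {0..s} (\<lambda>r. exp (\<delta> * r) * inner (z r) (\<phi> j))"
      unfolding w_def right_diff_distrib[symmetric] by simp
    have cy: "inner (y' s) (\<phi> j) = inner (f s) (\<phi> j) - lam j * inner (y s) (\<phi> j)
        - lam j * (exp (- \<delta> * s) * integral {0..s} (\<lambda>r. exp (\<delta> * r) * inner (y r) (\<phi> j)))"
      by (rule co[OF _ yc]) (use y' in blast)
    have cz: "inner (z' s) (\<phi> j) = inner (f s) (\<phi> j) - lam j * inner (z s) (\<phi> j)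
        - lam j * (exp (- \<delta> * s) * integral {0..s} (\<lambda>r. exp (\<delta> * r) * inner (z r) (\<phi> j)))"
      by (rule co[OF _ zc]) (use z' in blast)
    have "inner (y' s) (\<phi> j) - inner (z' s) (\<phi> j) = - lam j * (u s + w s)"
      unfolding ws cy cz u_def
      by (simp add: right_diff_distrib distrib_left)
    then show "(u has_real_derivative - lam j * (u s + w s)) (at s)" using du by simp
  qed (auto simp: u_def w_def y0 z0)
  then show "inner (y t) (\<phi> j) = inner (z t) (\<phi> j)" by (simp add: u_def)
qed

context
  fixes f :: "real \<Rightarrow> 'h" and m :: "nat \<Rightarrow> real" and y0 :: 'h
  assumes f: "continuous_on {0..} f" and m: "ell2 m"
    and fm: "\<And>j s. s \<ge> 0 \<Longrightarrow> \<bar>inner (f s) (\<phi> j)\<bar> \<le> m j"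
begin

text \<open>
  For a fixed forcing and datum: \<open>c\<close> are the coefficients of the solution, \<open>e\<close> those of its memory
  integral and \<open>a\<close> the moduli of those of the datum.
\<close>

abbreviation "c \<equiv> Y y0 f"
abbreviation "e \<equiv> Z y0 f"
abbreviation "a j \<equiv> \<bar>inner y0 (\<phi> j)\<bar>"

lemma continuous_coef_f: "continuous_on {0..} (\<lambda>s. inner (f s) (\<phi> j))"
  by (intro continuous_intros f)

lemma m_nonneg: "0 \<le> m j"
  using fm[of 0 j] by simp

lemma a_ell2: "ell2 a"
  by (rule ell2_abs[OF ell2_coef])

lemma mode_solution_bounds:
  obtains K where "K > 0"
    "\<And>j t. t \<ge> 0 \<Longrightarrow> \<bar>c j t\<bar> \<le> K * (a j + t * m j)"
    "\<And>j t. t \<ge> 0 \<Longrightarrow> lam j * \<bar>c j t\<bar> \<le> K * (lam j * exp (- (lam j / 2) * t) * a j + a j + (2 + t) * m j)"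
    "\<And>j t. t \<ge> 0 \<Longrightarrow> lam j * \<bar>e j t\<bar> \<le> K * (a j + t * m j)"
proof -
  obtain K where K: "K > 0"
    "\<And>j. coefficient_bound \<delta> (lam j) (mu_plus \<delta> lam j) (mu_minus \<delta> lam j) K"
    using mu_coefficient_bounds[OF lam_inf delta_pos] by blast
  note * = modes continuous_coef_f fm _ Re_mu_plus_ge[OF delta_pos] Re_mu_minus_nonneg[OF lam_pos delta_pos] K(2)
  show ?thesis
  proof (rule that[of "2 * K"])
    fix j and t :: real assume t: "t \<ge> 0"
    show "\<bar>c j t\<bar> \<le> 2 * K * (a j + t * m j)"
      by (rule mode.mode_y_bounded[OF *]) (use t in auto)
    show "lam j * \<bar>e j t\<bar> \<le> 2 * K * (a j + t * m j)"
      by (rule mode.mode_z_bounded[OF *]) (use t in auto)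
    let ?r = "lam j * exp (- (lam j / 2) * t) * a j + a j + (2 + t) * m j"
    have "lam j * \<bar>c j t\<bar> \<le> K * ?r"
      by (rule mode.mode_y_smoothing[OF *]) (use t in auto)
    also have "0 \<le> ?r"
      using lam_pos[of j] m_nonneg[of j] t by (intro add_nonneg_nonneg mult_nonneg_nonneg) auto
    then have "K * ?r \<le> 2 * K * ?r" using K(1) by (intro mult_right_mono) auto
    finally show "lam j * \<bar>c j t\<bar> \<le> 2 * K * ?r" .
  qed (use K in auto)
qed

lemma dominated_f: "dominated {0..} (\<lambda>j t. inner (f t) (\<phi> j))"
  by (rule dominatedI[OF m fm]) simp

lemma dominated_c: "dominated {0..b} c"
  and dominated_lam_e: "dominated {0..b} (\<lambda>j t. lam j * e j t)"
proof -
  obtain K where K: "K > 0"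
    "\<And>j t. t \<ge> 0 \<Longrightarrow> \<bar>c j t\<bar> \<le> K * (a j + t * m j)"
    "\<And>j t. t \<ge> 0 \<Longrightarrow> lam j * \<bar>c j t\<bar> \<le> K * (lam j * exp (- (lam j / 2) * t) * a j + a j + (2 + t) * m j)"
    "\<And>j t. t \<ge> 0 \<Longrightarrow> lam j * \<bar>e j t\<bar> \<le> K * (a j + t * m j)"
    using mode_solution_bounds by blast
  define M where "M j = K * (a j + \<bar>b\<bar> * m j)" for j
  have M: "ell2 M" unfolding M_def by (intro ell2_scale ell2_add m a_ell2)
  have le: "K * (a j + t * m j) \<le> M j" if "t \<in> {0..b}" for j t
    unfolding M_def using that K(1) m_nonneg[of j] by (intro mult_left_mono add_left_mono mult_right_mono) auto
  show "dominated {0..b} c"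
  proof (rule dominatedI[OF M])
    fix j t assume t: "t \<in> {0..b}"
    show "\<bar>c j t\<bar> \<le> M j" using K(2)[of t j] le[OF t, of j] t by auto
  qed
  show "dominated {0..b} (\<lambda>j t. lam j * e j t)"
  proof (rule dominatedI[OF M])
    fix j t assume t: "t \<in> {0..b}"
    show "\<bar>lam j * e j t\<bar> \<le> M j" using K(4)[of t j] le[OF t, of j] t lam_pos[of j] by (auto simp: abs_mult)
  qed
qed

text \<open>
  The majorant \<open>n\<close> absorbs the singular term of the datum; the two following lemmas supply it away
  from \<open>t = 0\<close> and for a datum in the domain.
\<close>

lemma dominated_lam_c:
  assumes s: "0 \<le> s" and bound: "\<And>t j. t \<in> {s..b} \<Longrightarrow> lam j * exp (- (lam j / 2) * t) * a j \<le> n j"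
    and n: "ell2 n"
  shows "dominated {s..b} (\<lambda>j t. lam j * c j t)"
proof -
  obtain K where K: "K > 0"
    "\<And>j t. t \<ge> 0 \<Longrightarrow> \<bar>c j t\<bar> \<le> K * (a j + t * m j)"
    "\<And>j t. t \<ge> 0 \<Longrightarrow> lam j * \<bar>c j t\<bar> \<le> K * (lam j * exp (- (lam j / 2) * t) * a j + a j + (2 + t) * m j)"
    "\<And>j t. t \<ge> 0 \<Longrightarrow> lam j * \<bar>e j t\<bar> \<le> K * (a j + t * m j)"
    using mode_solution_bounds by blast
  define M where "M j = K * (n j + a j + (2 + \<bar>b\<bar>) * m j)" for j
  have M: "ell2 M" unfolding M_def by (intro ell2_scale ell2_add n m a_ell2)
  show ?thesis
  proof (rule dominatedI[OF M])
    fix j t assume t: "t \<in> {s..b}"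
    have "(2 + t) * m j \<le> (2 + \<bar>b\<bar>) * m j" using t s m_nonneg[of j] by (intro mult_right_mono) auto
    then have "K * (lam j * exp (- (lam j / 2) * t) * a j + a j + (2 + t) * m j) \<le> M j"
      unfolding M_def using K(1) bound[OF t, of j] by (intro mult_left_mono add_mono) auto
    then show "\<bar>lam j * c j t\<bar> \<le> M j" using K(3)[of t j] t s lam_pos[of j] by (auto simp: abs_mult)
  qed
qed

text \<open>
  By \<open>x * exp (- x) \<le> 1\<close> with \<open>x = lam j * t / 2\<close>.
\<close>

lemma dominated_lam_c_positive:
  assumes s: "0 < s"
  shows "dominated {s..b} (\<lambda>j t. lam j * c j t)"
proof (rule dominated_lam_c)
  fix t j assume t: "t \<in> {s..b}"
  have "lam j * exp (- (lam j / 2) * t) = 2 / t * ((lam j / 2 * t) * exp (- (lam j / 2 * t)))"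
    using s t by (simp add: field_simps)
  also have "\<dots> \<le> 2 / t * 1"
    using s t by (intro mult_left_mono x_exp_le) auto
  also have "\<dots> \<le> 2 / s" using s t by (simp add: frac_le)
  finally show "lam j * exp (- (lam j / 2) * t) * a j \<le> 2 / s * a j" by (rule mult_right_mono) simp
next
  show "ell2 (\<lambda>j. 2 / s * a j)" by (rule ell2_scale[OF a_ell2])
qed (use s in simp)

lemma dominated_lam_c_domain:
  assumes y0: "y0 \<in> D"
  shows "dominated {0..b} (\<lambda>j t. lam j * c j t)"
proof (rule dominated_lam_c[OF order_refl _ ell2_abs[OF ell2_coef[of "A y0"]]])
  fix t j assume "t \<in> {0..b}"
  then have "lam j * exp (- (lam j / 2) * t) * a j \<le> lam j * 1 * a j"
    using lam_pos[of j] by (intro mult_right_mono mult_left_mono) auto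
  then show "lam j * exp (- (lam j / 2) * t) * a j \<le> \<bar>inner (A y0) (\<phi> j)\<bar>"
    using lam_pos[of j] by (simp add: coef_A[OF y0] abs_mult)
qed

abbreviation "c' j t \<equiv> - lam j * (c j t + e j t) + inner (f t) (\<phi> j)"

lemma dominated_c':
  assumes s: "0 \<le> s" and lc: "dominated {s..b} (\<lambda>j t. lam j * c j t)"
  shows "dominated {s..b} c'"
proof -
  have "dominated {s..b} (\<lambda>j t. (- 1) * (lam j * c j t) + (- 1) * (lam j * e j t) + inner (f t) (\<phi> j))"
    by (intro dominated_add dominated_scale lc dominated_subset[OF dominated_lam_e[of b]]
        dominated_subset[OF dominated_f]) (use s in auto)
  then show ?thesis by (simp add: algebra_simps)
qed

lemma mode_deriv_Icc:
  assumes "0 \<le> s" "t \<in> {s..b}"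
  shows "(c j has_real_derivative c' j t) (at t within {s..b})"
    "(e j has_real_derivative c j t - \<delta> * e j t) (at t within {s..b})"
  using mode.mode_deriv[OF modes[of j] continuous_coef_f[of j], where ?t=t and ?y0.0="inner y0 (\<phi> j)"] assms
  by (auto intro: DERIV_subset)

lemma mode_cont_Icc:
  assumes "0 \<le> s"
  shows "continuous_on {s..b} (c j)" "continuous_on {s..b} (e j)" "continuous_on {s..b} (c' j)"
proof -
  show "continuous_on {s..b} (c j)" "continuous_on {s..b} (e j)"
    using mode.mode_cont[OF modes[of j] continuous_coef_f[of j], where ?y0.0="inner y0 (\<phi> j)"] assms
    by (auto intro: continuous_on_subset)
  then show "continuous_on {s..b} (c' j)"
    using assms by (intro continuous_intros continuous_on_subset[OF f]) auto
qed

lemma c_ell2: "t \<ge> 0 \<Longrightarrow> ell2 (\<lambda>j. c j t)"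
  by (rule dominated_ell2[OF dominated_c[of t]]) simp

lemma e_ell2: "t \<ge> 0 \<Longrightarrow> ell2 (\<lambda>j. lam j * e j t)"
  by (rule dominated_ell2[OF dominated_lam_e[of t]]) simp

lemma lc_ell2: "t > 0 \<Longrightarrow> ell2 (\<lambda>j. lam j * c j t)"
  by (rule dominated_ell2[OF dominated_lam_c_positive[of t t]]) auto

lemma c'_ell2: "t > 0 \<Longrightarrow> ell2 (\<lambda>j. c' j t)"
  by (rule dominated_ell2[OF dominated_c'[OF _ dominated_lam_c_positive[of t t]]]) auto

text \<open>
  The series \<open>sol_mem\<close> is the operator applied to the memory integral of \<open>sol\<close>, and \<open>sol'\<close> is the
  termwise derivative.
\<close>

definition "sol t = synth (\<lambda>j. c j t)"
definition "sol_mem t = synth (\<lambda>j. lam j * e j t)"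
definition "sol' t = synth (\<lambda>j. - lam j * (c j t + e j t) + inner (f t) (\<phi> j))"

lemma A_sol:
  assumes "t > 0"
  shows "sol t \<in> D" "A (sol t) = synth (\<lambda>j. lam j * c j t)"
  unfolding sol_def using assms by (intro synth_in_domain c_ell2 lc_ell2; simp)+

lemma sol_continuous: "continuous_on {0..} sol"
  unfolding sol_def[abs_def]
  by (intro continuous_on_halflineI synth_continuous dominated_c mode_cont_Icc order_refl)

lemma sol_mem_continuous: "continuous_on {0..} sol_mem"
  unfolding sol_mem_def[abs_def]
  by (intro continuous_on_halflineI synth_continuous dominated_lam_e continuous_intros mode_cont_Icc order_refl)

lemma sol'_continuous: "continuous_on {0<..} sol'"
  unfolding sol'_def[abs_def]
  by (intro continuous_on_open_halflineI synth_continuous dominated_c' dominated_lam_c_positive mode_cont_Icc less_imp_le)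

lemma sol_deriv_Icc:
  assumes s: "0 \<le> s" and lc: "dominated {s..b} (\<lambda>j t. lam j * c j t)"
    and t: "t \<in> {s..b}"
  shows "(sol has_vector_derivative sol' t) (at t within {s..b})"
  unfolding sol_def[abs_def] sol'_def
  by (rule synth_has_vector_derivative[OF mode_deriv_Icc(1)[OF s] mode_cont_Icc(3)[OF s] dominated_c'[OF s lc] c_ell2 t])
    (use s in auto)

lemma sol_deriv:
  assumes t: "t > 0"
  shows "(sol has_vector_derivative sol' t) (at t)"
proof -
  have "(sol has_vector_derivative sol' t) (at t within {t/2..t+1})"
    by (rule sol_deriv_Icc[OF _ dominated_lam_c_positive]) (use t in auto)
  then show ?thesis using t by (simp add: at_within_Icc_at)
qed

text \<open>
  Coefficientwise this is \<open>e' = c - \<delta> e\<close>, multiplied by the eigenvalue.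
\<close>

lemma sol_mem_deriv:
  assumes t: "t > 0"
  shows "(sol_mem has_vector_derivative A (sol t) - \<delta> *\<^sub>R sol_mem t) (at t)"
proof -
  have "((\<lambda>t. synth (\<lambda>j. lam j * e j t)) has_vector_derivative
      synth (\<lambda>j. lam j * (c j t - \<delta> * e j t))) (at t within {t/2..t+1})"
  proof (rule synth_has_vector_derivative)
    show "((\<lambda>t. lam j * e j t) has_real_derivative lam j * (c j x - \<delta> * e j x)) (at x within {t/2..t+1})"
      if "x \<in> {t/2..t+1}" for j x
      by (intro DERIV_cmult mode_deriv_Icc that) (use t in auto)
    show "continuous_on {t/2..t+1} (\<lambda>x. lam j * (c j x - \<delta> * e j x))" for j
      by (intro continuous_intros mode_cont_Icc) (use t in auto)
    have "dominated {t/2..t+1} (\<lambda>j t. lam j * c j t + (- \<delta>) * (lam j * e j t))"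
      by (intro dominated_add dominated_scale dominated_lam_c_positive dominated_subset[OF dominated_lam_e[of "t+1"]])
        (use t in auto)
    then show "dominated {t/2..t+1} (\<lambda>j x. lam j * (c j x - \<delta> * e j x))"
      by (simp add: algebra_simps)
    show "ell2 (\<lambda>j. lam j * e j x)" if "x \<in> {t/2..t+1}" for x
      by (rule e_ell2) (use that t in auto)
  qed (use t in auto)
  moreover have "synth (\<lambda>j. lam j * (c j t - \<delta> * e j t)) = A (sol t) - \<delta> *\<^sub>R sol_mem t"
  proof (rule coef_eqI)
    fix j
    have eq: "(\<lambda>j. lam j * (c j t - \<delta> * e j t)) = (\<lambda>j. lam j * c j t + (- \<delta>) * (lam j * e j t))"
      by (simp add: algebra_simps)
    have el: "ell2 (\<lambda>j. lam j * (c j t - \<delta> * e j t))"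
      unfolding eq by (intro ell2_add ell2_scale lc_ell2 e_ell2) (use t in auto)
    show "inner (synth (\<lambda>j. lam j * (c j t - \<delta> * e j t))) (\<phi> j) = inner (A (sol t) - \<delta> *\<^sub>R sol_mem t) (\<phi> j)"
      unfolding A_sol(2)[OF t] sol_mem_def inner_diff_left inner_scaleR_left coef_synth[OF el]
        coef_synth[OF lc_ell2[OF t]] coef_synth[OF e_ell2[OF less_imp_le[OF t]]]
      by (simp add: algebra_simps)
  qed
  ultimately show ?thesis
    unfolding sol_mem_def[abs_def] using t by (simp add: at_within_Icc_at)
qed

lemma sol_mem_0: "sol_mem 0 = 0"
  unfolding sol_mem_def by (rule coef_eqI) (simp add: coef_synth e_ell2 mode.mode_init[OF modes] ell2_def)

text \<open>
  The product of the kernel and \<open>sol_mem\<close> is a primitive of the integrand on the open interval and is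
  continuous up to its end points; this is how the integral that may be improper at \<open>0\<close> is evaluated.
\<close>

lemma memory_has_integral:
  assumes t: "t \<ge> 0"
  shows "((\<lambda>s. mem_kernel \<delta> (t - s) *\<^sub>R A (sol s)) has_integral sol_mem t) {0..t}"
proof -
  let ?G = "\<lambda>s. mem_kernel \<delta> (t - s) *\<^sub>R sol_mem s"
  have "((\<lambda>s. mem_kernel \<delta> (t - s) *\<^sub>R A (sol s)) has_integral ?G t - ?G 0) {0..t}"
  proof (rule fundamental_theorem_of_calculus_interior[OF t])
    show "continuous_on {0..t} ?G"
      unfolding mem_kernel_def
      by (intro continuous_intros continuous_on_subset[OF sol_mem_continuous]) auto
    fix s assume s: "s \<in> {0<..<t}"
    have k: "((\<lambda>s. mem_kernel \<delta> (t - s)) has_real_derivative \<delta> * mem_kernel \<delta> (t - s)) (at s)"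
      unfolding mem_kernel_def by (auto intro!: derivative_eq_intros)
    have "(?G has_vector_derivative mem_kernel \<delta> (t - s) *\<^sub>R (A (sol s) - \<delta> *\<^sub>R sol_mem s)
        + (\<delta> * mem_kernel \<delta> (t - s)) *\<^sub>R sol_mem s) (at s)"
      by (rule has_vector_derivative_scaleR[OF k sol_mem_deriv]) (use s in auto)
    then show "(?G has_vector_derivative mem_kernel \<delta> (t - s) *\<^sub>R A (sol s)) (at s)"
      by (simp add: algebra_simps)
  qed
  then show ?thesis by (simp add: sol_mem_0 mem_kernel_def)
qed

lemma sol_equation:
  assumes t: "t > 0"
  shows "sol' t + A (sol t) + sol_mem t = f t"
proof (rule coef_eqI)
  fix j
  show "inner (sol' t + A (sol t) + sol_mem t) (\<phi> j) = inner (f t) (\<phi> j)"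
    unfolding sol'_def A_sol(2)[OF t] sol_mem_def inner_add_left coef_synth[OF c'_ell2[OF t]]
      coef_synth[OF lc_ell2[OF t]] coef_synth[OF e_ell2[OF less_imp_le[OF t]]]
    by (simp add: algebra_simps)
qed

lemma sol_0: "sol 0 = y0"
  by (simp add: sol_def mode.mode_init[OF modes] synth_coef)

lemma sol_is_solution: "real_memory_solution D A \<delta> f y0 sol"
  unfolding real_memory_solution_def
  by (intro conjI exI[of _ sol'] allI impI sol_continuous sol_0 sol'_continuous A_sol sol_deriv)
    (use memory_has_integral in \<open>auto simp: has_integral_integrable_integral sol_equation\<close>)

lemma sol_C1:
  assumes y0: "y0 \<in> D"
  shows "C1_on_halfline sol"
proof -
  have cont: "continuous_on {0..} sol'"
    unfolding sol'_def[abs_def]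
    by (intro continuous_on_halflineI synth_continuous dominated_c' dominated_lam_c_domain[OF y0] mode_cont_Icc order_refl)
  have "(sol has_vector_derivative sol' t) (at t within {0..})" if t: "t \<ge> 0" for t
  proof -
    have "(sol has_vector_derivative sol' t) (at t within {0..t+1})"
      by (rule sol_deriv_Icc[OF _ dominated_lam_c_domain[OF y0]]) (use t in auto)
    then show ?thesis using t by (simp add: at_within_halfline)
  qed
  then show ?thesis unfolding C1_on_halfline_def using cont by blast
qed

end

text \<open>
  Fast modes decay by their exponents.  Slow modes are bounded up to time \<open>T\<close>, where
  \<open>exp (- \<gamma> * t)\<close> is at least \<open>exp (- \<gamma> * T)\<close>, and vanish afterwards by uniqueness for the planar
  system started at \<open>T\<close>.
\<close>

lemma controlled_decay:
  assumes "0 < \<gamma>" "0 \<le> T" and fast: "\<And>j. N \<le> j \<Longrightarrow> \<gamma> < Re (mu_plus \<delta> lam j) \<and> \<gamma> < Re (mu_minus \<delta> lam j)"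
  obtains C where "C > 0" "\<And>f m y0 t. continuous_on {0..} f \<Longrightarrow> ell2 m \<Longrightarrow>
      (\<And>j s. s \<ge> 0 \<Longrightarrow> \<bar>inner (f s) (\<phi> j)\<bar> \<le> m j) \<Longrightarrow> (\<And>s. s \<ge> T \<Longrightarrow> f s = 0) \<Longrightarrow>
      (\<And>j. j < N \<Longrightarrow> Y y0 f j T = 0 \<and> Z y0 f j T = 0) \<Longrightarrow> t \<ge> 0 \<Longrightarrow>
      norm (sol f y0 t) \<le> C * exp (- \<gamma> * t) * sqrt ((norm y0)\<^sup>2 + (\<Sum>j. (m j)\<^sup>2))"
proof -
  obtain K where K: "K > 0"
    "\<And>j. coefficient_bound \<delta> (lam j) (mu_plus \<delta> lam j) (mu_minus \<delta> lam j) K"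
    using mu_coefficient_bounds[OF lam_inf delta_pos] by blast
  \<comment> \<open>Large enough for the fast modes, where \<open>T * exp (\<gamma> * T)\<close> comes from the forcing, and for all modes up to time \<open>T\<close>.\<close>
  define C where "C = 2 * K * exp (\<gamma> * T) * (1 + T)"
  have C: "C > 0" using K(1) assms(2) by (simp add: C_def add_pos_nonneg)
  show ?thesis
  proof (rule that[of "2 * C"])
    fix f :: "real \<Rightarrow> 'h" and m y0 and t :: real
    assume f: "continuous_on {0..} f" and m: "ell2 m"
      and fm: "\<And>j s. s \<ge> 0 \<Longrightarrow> \<bar>inner (f s) (\<phi> j)\<bar> \<le> m j"
      and supp: "\<And>s. s \<ge> T \<Longrightarrow> f s = 0"
      and null: "\<And>j. j < N \<Longrightarrow> Y y0 f j T = 0 \<and> Z y0 f j T = 0" and t: "t \<ge> 0"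
    let ?a = "\<lambda>j. \<bar>inner y0 (\<phi> j)\<bar>"
    have fj: "continuous_on {0..} (\<lambda>s. inner (f s) (\<phi> j))" for j by (intro continuous_intros f)
    have m0: "0 \<le> m j" for j using fm[of 0 j] by simp
    note * = modes fj fm t Re_mu_plus_ge[OF delta_pos] Re_mu_minus_nonneg[OF lam_pos delta_pos] K(2)
    have le: "x * (?a j + y * m j) \<le> C * exp (- \<gamma> * t) * (?a j + m j)"
      if "x * y \<le> C * exp (- \<gamma> * t)" "x \<le> C * exp (- \<gamma> * t)" for j x y
    proof -
      have "x * ?a j + x * y * m j \<le> C * exp (- \<gamma> * t) * ?a j + C * exp (- \<gamma> * t) * m j"
        using that m0[of j] by (intro add_mono mult_right_mono) auto
      then show ?thesis by (simp add: algebra_simps)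
    qed
    have mode_le: "\<bar>Y y0 f j t\<bar> \<le> C * exp (- \<gamma> * t) * (?a j + m j)" for j
    proof -
      consider "N \<le> j" | "t \<le> T" | "j < N" "T \<le> t" by linarith
      then show ?thesis
      proof cases
        case 1
        have "\<bar>Y y0 f j t\<bar> \<le> 2 * K * (exp (- \<gamma> * t) * (?a j + T * exp (\<gamma> * T) * m j))"
          by (rule mode.mode_y_decay[OF * _ assms(2,1)]) (use fast[OF 1] supp in auto)
        also have "\<dots> = 2 * K * exp (- \<gamma> * t) * (?a j + (T * exp (\<gamma> * T)) * m j)" by simp
        also have "\<dots> \<le> C * exp (- \<gamma> * t) * (?a j + m j)"
        proof (rule le)
          have "2 * K * exp (- \<gamma> * t) * (T * exp (\<gamma> * T)) = (2 * K * exp (\<gamma> * T) * T) * exp (- \<gamma> * t)" by simp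
          also have "\<dots> \<le> C * exp (- \<gamma> * t)"
            unfolding C_def using K(1) by (intro mult_right_mono mult_left_mono) auto
          finally show "2 * K * exp (- \<gamma> * t) * (T * exp (\<gamma> * T)) \<le> C * exp (- \<gamma> * t)" .
          have "1 * 1 \<le> exp (\<gamma> * T) * (1 + T)" using assms by (intro mult_mono) auto
          then have "2 * K * 1 \<le> 2 * K * (exp (\<gamma> * T) * (1 + T))" using K(1) by (intro mult_left_mono) auto
          then have "2 * K \<le> C" by (simp add: C_def)
          then show "2 * K * exp (- \<gamma> * t) \<le> C * exp (- \<gamma> * t)" by (rule mult_right_mono) simp
        qed
        finally show ?thesis .
      next
        case 2
        have CK: "C * exp (- \<gamma> * t) = 2 * K * (1 + T) * (exp (\<gamma> * T) * exp (- \<gamma> * t))"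
          by (simp add: C_def)
        have g: "1 \<le> exp (\<gamma> * T) * exp (- \<gamma> * t)"
          using 2 assms by (simp flip: exp_add right_diff_distrib)
        have "\<bar>Y y0 f j t\<bar> \<le> 2 * K * (?a j + t * m j)" by (rule mode.mode_y_bounded[OF *])
        also have "\<dots> \<le> C * exp (- \<gamma> * t) * (?a j + m j)"
        proof (rule le)
          have "2 * K * t * 1 \<le> 2 * K * (1 + T) * (exp (\<gamma> * T) * exp (- \<gamma> * t))"
            using 2 t K(1) g by (intro mult_mono) auto
          then show "2 * K * t \<le> C * exp (- \<gamma> * t)" unfolding CK by simp
          have "2 * K * 1 * 1 \<le> 2 * K * (1 + T) * (exp (\<gamma> * T) * exp (- \<gamma> * t))"
            using 2 t K(1) g by (intro mult_mono) auto
          then show "2 * K \<le> C * exp (- \<gamma> * t)" unfolding CK by simp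
        qed
        finally show ?thesis .
      next
        case 3
        have sub: "{T..} \<subseteq> {0..}" using assms by auto
        have at: "at s within {0..} = at s" if "s > T" for s
          by (rule at_within_interior) (use that assms in \<open>auto simp: interior_Ici[of "- 1"]\<close>)
        have "Y y0 f j t = 0"
        proof (rule mode_energy_zero(1)[OF lam_pos[of j] delta_pos 3(2)])
          fix s assume s: "s > T"
          show "(Y y0 f j has_real_derivative - lam j * (Y y0 f j s + Z y0 f j s)) (at s)"
            using mode.mode_deriv(1)[OF modes[of j] fj[of j], where ?t=s and ?y0.0="inner y0 (\<phi> j)"] s assms supp[of s] at[OF s] by auto
          show "(Z y0 f j has_real_derivative Y y0 f j s - \<delta> * Z y0 f j s) (at s)"
            using mode.mode_deriv(2)[OF modes[of j] fj[of j], where ?t=s and ?y0.0="inner y0 (\<phi> j)"] s assms at[OF s] by auto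
        qed (use null[OF 3(1)] mode.mode_cont[OF modes[of j] fj[of j], where ?y0.0="inner y0 (\<phi> j)"] sub in
              \<open>auto intro: continuous_on_subset\<close>)
        then show ?thesis using C m0[of j] by (simp add: add_nonneg_nonneg)
      qed
    qed
    have sa: "summable (\<lambda>j. (inner y0 (\<phi> j))\<^sup>2)" using ell2_coef[of y0] by (simp add: ell2_def)
    have sm: "summable (\<lambda>j. (m j)\<^sup>2)" using m by (simp add: ell2_def)
    let ?r = "C * exp (- \<gamma> * t)"
    have el: "ell2 (\<lambda>j. ?a j + m j)" by (intro ell2_add ell2_abs ell2_coef m)
    have solt: "sol f y0 t = synth (\<lambda>j. Y y0 f j t)"
      by (rule sol_def[OF f m fm])
    have "(norm (sol f y0 t))\<^sup>2 \<le> (\<Sum>j. (?r * (?a j + m j))\<^sup>2)"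
      unfolding solt by (rule norm_synth_le[OF ell2_scale[OF el] mode_le])
    also have "\<dots> = ?r\<^sup>2 * (\<Sum>j. (?a j + m j)\<^sup>2)"
      unfolding power_mult_distrib by (rule suminf_mult) (use el in \<open>simp add: ell2_def\<close>)
    also have "(\<Sum>j. (?a j + m j)\<^sup>2) \<le> (\<Sum>j. 2 * (inner y0 (\<phi> j))\<^sup>2 + 2 * (m j)\<^sup>2)"
    proof (rule suminf_le)
      show "(?a j + m j)\<^sup>2 \<le> 2 * (inner y0 (\<phi> j))\<^sup>2 + 2 * (m j)\<^sup>2" for j
        using sum_squares_bound[of "?a j" "m j"] by (simp add: power2_sum)
    qed (use el sa sm in \<open>auto simp: ell2_def intro!: summable_add summable_mult\<close>)
    also have "\<dots> = 2 * (norm y0)\<^sup>2 + 2 * (\<Sum>j. (m j)\<^sup>2)"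
      unfolding parseval using sa sm
      by (subst suminf_add[symmetric]) (auto intro!: summable_mult simp: suminf_mult)
    finally have "(norm (sol f y0 t))\<^sup>2 \<le> ?r\<^sup>2 * (2 * (norm y0)\<^sup>2 + 2 * (\<Sum>j. (m j)\<^sup>2))"
      by (simp add: mult_left_mono)
    also have "\<dots> \<le> (2 * ?r)\<^sup>2 * ((norm y0)\<^sup>2 + (\<Sum>j. (m j)\<^sup>2))"
    proof -
      have "0 \<le> ?r\<^sup>2 * ((norm y0)\<^sup>2 + (\<Sum>j. (m j)\<^sup>2))"
        by (intro mult_nonneg_nonneg add_nonneg_nonneg suminf_nonneg sm) auto
      then show ?thesis by (simp add: power_mult_distrib algebra_simps)
    qed
    finally have "norm (sol f y0 t) \<le> sqrt ((2 * ?r)\<^sup>2 * ((norm y0)\<^sup>2 + (\<Sum>j. (m j)\<^sup>2)))"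
      by (rule real_le_rsqrt)
    also have "\<dots> = 2 * ?r * sqrt ((norm y0)\<^sup>2 + (\<Sum>j. (m j)\<^sup>2))"
      using C by (simp add: real_sqrt_mult)
    finally show "norm (sol f y0 t) \<le> 2 * C * exp (- \<gamma> * t) * sqrt ((norm y0)\<^sup>2 + (\<Sum>j. (m j)\<^sup>2))"
      by (simp add: mult.assoc)
  qed (use C in simp)
qed

end

section \<open>Eigenvalue blocks and the rank condition\<close>

lemma finite_downset:
  fixes S :: "nat set"
  assumes "finite S" and "\<And>x y. x \<in> S \<Longrightarrow> y < x \<Longrightarrow> y \<in> S"
  shows "S = {..<card S}"
proof (rule card_subset_eq)
  show "S \<subseteq> {..<card S}"
  proof
    fix x assume "x \<in> S"
    then have "{..x} \<subseteq> S" using assms(2) by (auto simp: le_less)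
    then have "card {..x} \<le> card S" by (rule card_mono[OF assms(1)])
    then show "x \<in> {..<card S}" by simp
  qed
qed simp_all

text \<open>
  Removal of adjacent duplicates comes with a monotone map \<open>f\<close> from positions to distinct values.
  As equal eigenvalues are adjacent, \<open>f\<close> takes equal values exactly at equal eigenvalues; its
  level sets are therefore consecutive intervals of lengths \<open>eig_mult lam N i\<close>.
\<close>

lemma eigenvalue_block:
  assumes grouped: "\<forall>i j k. i \<le> j \<and> j \<le> k \<and> lam i = lam k \<longrightarrow> lam j = lam i" and j0: "j0 < N"
  obtains k where "k < num_distinct lam N"
    "{j. j < N \<and> lam j = lam j0} = {(\<Sum>i<k. eig_mult lam N i)..<(\<Sum>i<k. eig_mult lam N i) + eig_mult lam N k}"
proof -
  let ?xs = "map lam [0..<N]"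
  let ?ys = "distinct_vals lam N"
  obtain f where f: "mono f" "f ` {0..<N} = {0..<length ?ys}"
    "\<And>i. i < N \<Longrightarrow> lam i = ?ys ! f i"
    "\<And>i. i + 1 < N \<Longrightarrow> lam i = lam (i + 1) \<longleftrightarrow> f i = f (i + 1)"
  proof -
    obtain f where "mono f \<and> f ` {0..<length ?xs} = {0..<length ?ys}
        \<and> (\<forall>i<length ?xs. ?xs ! i = ?ys ! f i)
        \<and> (\<forall>i. i + 1 < length ?xs \<longrightarrow> (?xs ! i = ?xs ! (i + 1)) = (f i = f (i + 1)))"
      using remdups_adj_altdef[of ?xs ?ys] unfolding distinct_vals_def by blast
    then show ?thesis by (intro that[of f]) auto
  qed
  have le: "f i = f j" if "i \<le> j" "j < N" "lam i = lam j" for i j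
    using that
  proof (induction j rule: dec_induct)
    case (step n)
    have "lam n = lam i" using grouped step by (metis le_Suc_eq le_less)
    then have "lam n = lam (n + 1)" "f i = f n" using step by auto
    then show ?case using f(4)[of n] step by simp
  qed simp
  have iff: "lam i = lam j \<longleftrightarrow> f i = f j" if "i < N" "j < N" for i j
    using le[of i j] le[of j i] f(3)[of i] f(3)[of j] that by (metis nat_le_linear)
  have block: "{j. j < N \<and> lam j = ?ys ! k} = {j. j < N \<and> f j = k}" if "k < length ?ys" for k
  proof -
    have "k \<in> f ` {0..<N}" using f(2) that by simp
    then obtain j1 where j1: "j1 < N" "f j1 = k" by auto
    then have "?ys ! k = lam j1" using f(3) by simp
    then show ?thesis using iff[OF _ j1(1)] j1(2) by auto
  qed
  have below: "{j. j < N \<and> f j < k} = {..<\<Sum>i<k. eig_mult lam N i}" if "k \<le> length ?ys" for k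
  proof -
    have "card {j. j < N \<and> f j < k} = card (\<Union>i\<in>{..<k}. {j. j < N \<and> f j = i})"
      by (rule arg_cong[of _ _ card]) auto
    also have "\<dots> = (\<Sum>i<k. card {j. j < N \<and> f j = i})"
      by (rule card_UN_disjoint) auto
    also have "\<dots> = (\<Sum>i<k. eig_mult lam N i)"
      unfolding eig_mult_def by (rule sum.cong) (use that block in auto)
    finally have c: "card {j. j < N \<and> f j < k} = (\<Sum>i<k. eig_mult lam N i)" .
    have "{j. j < N \<and> f j < k} = {..<card {j. j < N \<and> f j < k}}"
    proof (rule finite_downset)
      fix x y assume "x \<in> {j. j < N \<and> f j < k}" "y < x"
      then show "y \<in> {j. j < N \<and> f j < k}" using monoD[OF f(1), of y x] by auto
    qed simp
    then show ?thesis by (simp only: c)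
  qed
  have k: "f j0 < length ?ys" using f(2) j0 by force
  show ?thesis
  proof (rule that[of "f j0"])
    show "f j0 < num_distinct lam N" using k by (simp add: num_distinct_def)
    have "{j. j < N \<and> lam j = lam j0} = {j. j < N \<and> f j < Suc (f j0)} - {j. j < N \<and> f j < f j0}"
      using iff j0 by auto
    also have "\<dots> = {..<\<Sum>i<Suc (f j0). eig_mult lam N i} - {..<\<Sum>i<f j0. eig_mult lam N i}"
      using below[of "Suc (f j0)"] below[of "f j0"] k by simp
    finally show "{j. j < N \<and> lam j = lam j0} = {(\<Sum>i<f j0. eig_mult lam N i)..<
        (\<Sum>i<f j0. eig_mult lam N i) + eig_mult lam N (f j0)}" by auto
  qed
qed

text \<open>
  Full rank forces the columns to be distinct, which has to be known before the set of columns can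
  stand for the family of columns.
\<close>

lemma full_column_rank_injective:
  fixes X :: "complex mat"
  assumes X: "X \<in> carrier_mat nr nc" and rank: "mat_rank X = nc" and v: "v \<in> carrier_vec nc"
    and zero: "X *\<^sub>v v = 0\<^sub>v nr"
  shows "v = 0\<^sub>v nc"
proof -
  interpret vec_space "TYPE(complex)" nr .
  have r: "rank X = nc" using rank X by (simp add: mat_rank_def)
  have dist: "distinct (cols X)"
  proof -
    obtain S where S: "maximal S (\<lambda>T. T \<subseteq> set (cols X) \<and> lin_indpt T)"
      using maximal_exists[of "(\<lambda>T. T \<subseteq> set (cols X) \<and> lin_indpt T)" "card (set (cols X))" "{}"]
      by (meson List.finite_set card_mono empty_iff empty_subsetI finite_lin_indpt2 rev_finite_subset)
    then have "nc = card S" using rank_card_indpt[OF X S] r by simp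
    also have "\<dots> \<le> card (set (cols X))" using S by (simp add: card_mono maximal_def)
    finally have "length (cols X) \<le> card (set (cols X))" using X by simp
    then show ?thesis using card_length[of "cols X"] by (simp add: card_distinct)
  qed
  have li: "lin_indpt (set (cols X))" by (rule full_rank_lin_indpt[OF X r dist])
  define a where "a u = v $ (THE i. i < nc \<and> col X i = u)" for u
  have a: "a (col X i) = v $ i" if "i < nc" for i
  proof -
    have "(THE i'. i' < nc \<and> col X i' = col X i) = i"
    proof (rule the_equality)
      fix i' assume "i' < nc \<and> col X i' = col X i"
      then show "i' = i" using dist that X by (metis carrier_matD(2) cols_length cols_nth nth_eq_iff_index_eq)
    qed (use that in simp)
    then show ?thesis by (simp add: a_def)
  qed
  have "lincomb a (set (cols X)) = X *\<^sub>v vec nc (\<lambda>i. a (col X i))"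
    by (rule mat_mult_eq_lincomb[OF X dist, symmetric])
  also have "vec nc (\<lambda>i. a (col X i)) = v" using v a by (intro eq_vecI) auto
  finally have lc: "lincomb a (set (cols X)) = 0\<^sub>v nr" using zero by simp
  have "a u = 0" if "u \<in> set (cols X)" for u
    using li lc that unfolding lin_dep_def by (auto simp: class_ring_simps) 
  then show ?thesis using a v X
    by (intro eq_vecI) (auto simp: cols_def)
qed

lemma mat_mult_entry:
  fixes X :: "'a::comm_ring_1 mat"
  assumes "X \<in> carrier_mat nr n" "Y \<in> carrier_mat n nc" "i < nr" "j < nc"
  shows "(X * Y) $$ (i, j) = (\<Sum>k<n. X $$ (i, k) * Y $$ (k, j))"
  using assms by (auto simp: scalar_prod_def atLeast0LessThan intro!: sum.cong)

lemma P_mat_carrier: "P_mat \<delta> lam N \<in> carrier_mat (2 * N) (2 * N)"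
  by (auto simp: P_mat_def mat_diag_def)

lemma P_mat_left_mult:
  assumes X: "X \<in> carrier_mat 1 (2 * N)"
  shows "i < N \<Longrightarrow> (X * P_mat \<delta> lam N) $$ (0, i) = - of_real (lam i * (1 + \<delta>)) * X $$ (0, N + i)"
    and "i < N \<Longrightarrow> (X * P_mat \<delta> lam N) $$ (0, N + i) = X $$ (0, i) - of_real (lam i + \<delta>) * X $$ (0, N + i)"
proof -
  assume i: "i < N"
  have "(X * P_mat \<delta> lam N) $$ (0, i) = (\<Sum>k<2*N. X $$ (0, k) * P_mat \<delta> lam N $$ (k, i))"
    by (rule mat_mult_entry[OF X P_mat_carrier]) (use i in auto)
  also have "\<dots> = (\<Sum>k<2*N. if k = N + i then - of_real (lam i * (1 + \<delta>)) * X $$ (0, N + i) else 0)"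
    by (rule sum.cong) (use i in \<open>auto simp: P_mat_def mat_diag_def\<close>)
  finally show "(X * P_mat \<delta> lam N) $$ (0, i) = - of_real (lam i * (1 + \<delta>)) * X $$ (0, N + i)"
    using i by simp
  have "(X * P_mat \<delta> lam N) $$ (0, N + i) = (\<Sum>k<2*N. X $$ (0, k) * P_mat \<delta> lam N $$ (k, N + i))"
    by (rule mat_mult_entry[OF X P_mat_carrier]) (use i in auto)
  also have "\<dots> = (\<Sum>k<2*N. (if k = i then X $$ (0, i) else 0)
      + (if k = N + i then - of_real (lam i + \<delta>) * X $$ (0, N + i) else 0))"
    by (rule sum.cong) (use i in \<open>auto simp: P_mat_def mat_diag_def\<close>)
  finally show "(X * P_mat \<delta> lam N) $$ (0, N + i) = X $$ (0, i) - of_real (lam i + \<delta>) * X $$ (0, N + i)"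
    using i by (simp add: sum.distrib algebra_simps)
qed

text \<open>
  For \<open>d = - mu_plus \<delta> lam j0\<close> the row vector \<open>X = (c (d + \<lambda> + \<delta>), c)\<close>, supported in the block of
  \<open>lam j0\<close>, is a left eigenvector of \<open>P\<close>.  Its coordinates \<open>\<alpha>\<close> with respect to the rows of
  \<open>R\<close> form a left eigenvector of the diagonal matrix for \<open>d\<close>, so they live on the positions where the
  diagonal entry is \<open>d\<close>, which are those of the block.  As \<open>\<alpha> R Q = X Q\<close> is the given vanishing
  combination of the rows of \<open>Cm\<close>, the rank hypothesis yields \<open>\<alpha> = 0\<close>, hence \<open>X = 0\<close> and \<open>c = 0\<close>.
\<close>

lemma control_rows_independent:
  fixes c :: "nat \<Rightarrow> complex"
  assumes modes: "\<And>j. mode \<delta> (lam j) (mu_plus \<delta> lam j) (mu_minus \<delta> lam j)"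
    and cross: "\<And>j m. j \<noteq> m \<Longrightarrow> mu_plus \<delta> lam j \<noteq> mu_minus \<delta> lam m"
    and grouped: "\<forall>i j k. i \<le> j \<and> j \<le> k \<and> lam i = lam k \<longrightarrow> lam j = lam i"
    and sim: "similar_mat_wit (P_mat \<delta> lam N) (D_mat \<delta> lam N) Rinv R"
    and Cm: "Cm \<in> carrier_mat N M"
    and rank: "\<And>k. k < num_distinct lam N \<Longrightarrow> mat_rank (Qbar_plus R (0\<^sub>m N M @\<^sub>r Cm) lam N k) = eig_mult lam N k"
    and j0: "j0 < N"
    and zero: "\<And>i. i < M \<Longrightarrow> (\<Sum>j\<in>{j. j < N \<and> lam j = lam j0}. c j * Cm $$ (j, i)) = 0"
    and j: "j < N" "lam j = lam j0"
  shows "c j = 0"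
proof -
  let ?P = "P_mat \<delta> lam N" and ?D = "D_mat \<delta> lam N" and ?Q = "0\<^sub>m N M @\<^sub>r Cm"
  let ?B = "{j. j < N \<and> lam j = lam j0}"
  have dP: "dim_row ?P = 2 * N" using P_mat_carrier by blast
  have R: "R \<in> carrier_mat (2*N) (2*N)" and Rinv: "Rinv \<in> carrier_mat (2*N) (2*N)"
    and D: "?D \<in> carrier_mat (2*N) (2*N)"
    and inv: "R * Rinv = 1\<^sub>m (2*N)" "Rinv * R = 1\<^sub>m (2*N)" and P: "?P = Rinv * ?D * R"
    using sim unfolding similar_mat_wit_def Let_def dP by auto
  have Q: "?Q \<in> carrier_mat (2*N) M" using carrier_append_rows[OF zero_carrier_mat Cm, of N] by (simp add: mult_2)
  define d where "d = - mu_plus \<delta> lam j0"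
  \<comment> \<open>The left eigenvector, extended by zero outside the block.\<close>
  define x where "x i = (if i < N then if lam i = lam j0 then c i * (d + of_real (lam i + \<delta>)) else 0
      else if lam (i - N) = lam j0 then c (i - N) else 0)" for i
  define X where "X = mat 1 (2*N) (\<lambda>(_, i). x i)"
  have X: "X \<in> carrier_mat 1 (2*N)" by (simp add: X_def)
  interpret m0: mode \<delta> "lam j0" "mu_plus \<delta> lam j0" "mu_minus \<delta> lam j0" by (rule modes)
  have char: "d * (d + of_real (lam j0 + \<delta>)) = - of_real (lam j0 * (1 + \<delta>))"
    using m0.mode_root(1) by (simp add: d_def algebra_simps)
  have XP: "X * ?P = d \<cdot>\<^sub>m X"
  proof (rule eq_matI)
    fix i' i assume "i' < dim_row (d \<cdot>\<^sub>m X)" "i < dim_col (d \<cdot>\<^sub>m X)"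
    then have i': "i' = 0" and i: "i < 2*N" using X by auto
    show "(X * ?P) $$ (i', i) = (d \<cdot>\<^sub>m X) $$ (i', i)"
    proof (cases "i < N")
      case True
      have "d * (c i * (d + of_real (lam i + \<delta>))) = - of_real (lam i * (1 + \<delta>)) * c i" if "lam i = lam j0"
        using arg_cong[OF char, of "\<lambda>z. c i * z"] that by (simp add: mult_ac)
      then show ?thesis
        unfolding i' P_mat_left_mult(1)[OF X True] using True by (simp add: X_def x_def)
    next
      case False
      then obtain r where r: "i = N + r" "r < N" using i by (metis add_diff_inverse_nat add_less_cancel_left mult_2)
      show ?thesis
        unfolding i' r(1) P_mat_left_mult(2)[OF X r(2)] using r(2) by (simp add: X_def x_def algebra_simps)
    qed
  qed (use X P_mat_carrier[of \<delta> lam N] in auto)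
  define \<alpha> where "\<alpha> = X * Rinv"
  have \<alpha>: "\<alpha> \<in> carrier_mat 1 (2*N)" unfolding \<alpha>_def using X Rinv by simp
  have "?P * Rinv = Rinv * ?D * (R * Rinv)"
    unfolding P using R Rinv D by (simp add: assoc_mult_mat[of _ "2*N" "2*N" _ "2*N" _ "2*N"])
  also have "\<dots> = Rinv * ?D" unfolding inv using Rinv D by simp
  finally have PR: "?P * Rinv = Rinv * ?D" .
  have "\<alpha> * ?D = X * (?P * Rinv)"
    unfolding \<alpha>_def PR by (rule assoc_mult_mat[OF X Rinv D])
  also have "\<dots> = X * ?P * Rinv" by (rule assoc_mult_mat[OF X P_mat_carrier Rinv, symmetric])
  also have "\<dots> = d \<cdot>\<^sub>m \<alpha>" unfolding XP \<alpha>_def by (rule mult_smult_assoc_mat[OF X Rinv])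
  finally have \<alpha>D: "\<alpha> * ?D = d \<cdot>\<^sub>m \<alpha>" .
  have supp: "\<alpha> $$ (0, i) = 0" if i: "i < 2*N" "i \<notin> ?B" for i
  proof -
    have "(\<alpha> * ?D) $$ (0, i) = (\<Sum>k<2*N. \<alpha> $$ (0, k) * ?D $$ (k, i))"
      by (rule mat_mult_entry[OF \<alpha> D]) (use i in auto)
    also have "\<dots> = (\<Sum>k<2*N. if k = i then \<alpha> $$ (0, i) * ?D $$ (i, i) else 0)"
      by (rule sum.cong) (use i in \<open>auto simp: D_mat_def mat_diag_def\<close>)
    finally have "\<alpha> $$ (0, i) * ?D $$ (i, i) = d * \<alpha> $$ (0, i)"
      using i \<alpha> unfolding \<alpha>D by auto
    moreover have "?D $$ (i, i) \<noteq> d"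
    proof (cases "i < N")
      case True
      have "mu_plus \<delta> lam i \<noteq> mu_plus \<delta> lam j0"
        using mode_lam_unique[OF modes[of i], of "lam j0" "mu_minus \<delta> lam j0"] modes[of j0] i True by auto
      then show ?thesis using True by (simp add: D_mat_def mat_diag_def d_def)
    next
      case False
      then have "i - N < N" using i by simp
      have "mu_minus \<delta> lam (i - N) \<noteq> mu_plus \<delta> lam j0"
        using cross[of j0 "i - N"] m0.pq by metis
      then show ?thesis using False i by (simp add: D_mat_def mat_diag_def d_def)
    qed
    ultimately show ?thesis by (simp add: mult.commute)
  qed
  have \<alpha>R: "\<alpha> * R = X"
    unfolding \<alpha>_def assoc_mult_mat[OF X Rinv R] inv using X by simp
  have RQ: "R * ?Q \<in> carrier_mat (2*N) M" using R Q by simp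
  have \<alpha>Q: "(\<Sum>k\<in>?B. \<alpha> $$ (0, k) * (R * ?Q) $$ (k, i)) = 0" if i: "i < M" for i
  proof -
    have "(\<Sum>k\<in>?B. \<alpha> $$ (0, k) * (R * ?Q) $$ (k, i)) = (\<Sum>k<2*N. \<alpha> $$ (0, k) * (R * ?Q) $$ (k, i))"
      by (rule sum.mono_neutral_left) (auto simp: supp)
    also have "\<dots> = (\<alpha> * (R * ?Q)) $$ (0, i)"
      by (rule mat_mult_entry[OF \<alpha> RQ, symmetric]) (use i in auto)
    also have "\<alpha> * (R * ?Q) = X * ?Q"
      unfolding \<alpha>R[symmetric] by (rule assoc_mult_mat[OF \<alpha> R Q, symmetric])
    also have "(X * ?Q) $$ (0, i) = (\<Sum>k<2*N. X $$ (0, k) * ?Q $$ (k, i))"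
      by (rule mat_mult_entry[OF X Q]) (use i in auto)
    also have "\<dots> = (\<Sum>k\<in>(\<lambda>k. N + k) ` ?B. X $$ (0, k) * ?Q $$ (k, i))"
    proof (rule sum.mono_neutral_right)
      show "\<forall>k\<in>{..<2*N} - (\<lambda>k. N + k) ` ?B. X $$ (0, k) * ?Q $$ (k, i) = 0"
      proof
        fix k assume k: "k \<in> {..<2*N} - (\<lambda>k. N + k) ` ?B"
        show "X $$ (0, k) * ?Q $$ (k, i) = 0"
        proof (cases "k < N")
          case True
          then show ?thesis using Cm i by (simp add: append_rows_def)
        next
          case False
          then have "k = N + (k - N)" "k - N < N" using k by auto
          then have "lam (k - N) \<noteq> lam j0" using k by blast
          then show ?thesis using False k by (simp add: X_def x_def)
        qed
      qed
    qed auto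
    also have "\<dots> = (\<Sum>k\<in>?B. c k * Cm $$ (k, i))"
      by (subst sum.reindex) (use Cm i in \<open>auto simp: append_rows_def X_def x_def intro!: sum.cong\<close>)
    finally show ?thesis using zero[OF i] by simp
  qed
  obtain k where k: "k < num_distinct lam N"
    and B: "?B = {(\<Sum>i<k. eig_mult lam N i)..<(\<Sum>i<k. eig_mult lam N i) + eig_mult lam N k}"
    using eigenvalue_block[OF grouped j0] by blast
  define s where "s = (\<Sum>i<k. eig_mult lam N i)"
  define m where "m = eig_mult lam N k"
  have Bs: "?B = {s..<s+m}" using B by (simp add: s_def m_def)
  let ?Z = "Qbar_plus R ?Q lam N k"
  have Zdef: "?Z = mat M m (\<lambda>(i, r). mat_adjoint (R * ?Q) $$ (i, s + r))"
    using carrier_matD[OF RQ] carrier_matD[OF Q] by (simp add: Qbar_plus_def col_block_def s_def m_def mat_adjoint_def)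
  then have Z: "?Z \<in> carrier_mat M m" by simp
  have Ze: "?Z $$ (i, r) = cnj ((R * ?Q) $$ (s + r, i))" if "i < M" "r < m" for i r
  proof -
    have "s + r \<in> ?B" using that by (simp add: Bs)
    then have "s + r < N" by simp
    then show ?thesis using that RQ R Q unfolding Zdef mat_adjoint_def
      by (simp add: mat_of_rows_index)
  qed
  define v where "v = vec m (\<lambda>r. cnj (\<alpha> $$ (0, s + r)))"
  have v: "v \<in> carrier_vec m" by (simp add: v_def)
  have "?Z *\<^sub>v v = 0\<^sub>v M"
  proof (rule eq_vecI)
    fix i assume "i < dim_vec (0\<^sub>v M :: complex vec)"
    then have i: "i < M" by simp
    have "(?Z *\<^sub>v v) $ i = (\<Sum>r<m. ?Z $$ (i, r) * v $ r)"
      using i Z v by (auto simp: scalar_prod_def atLeast0LessThan intro!: sum.cong)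
    also have "\<dots> = (\<Sum>r<m. cnj (\<alpha> $$ (0, s + r) * (R * ?Q) $$ (s + r, i)))"
      by (rule sum.cong) (use Ze[OF i] in \<open>auto simp: v_def\<close>)
    also have "\<dots> = cnj (\<Sum>r<m. \<alpha> $$ (0, s + r) * (R * ?Q) $$ (s + r, i))" by simp
    also have "(\<Sum>r<m. \<alpha> $$ (0, s + r) * (R * ?Q) $$ (s + r, i)) = (\<Sum>k\<in>?B. \<alpha> $$ (0, k) * (R * ?Q) $$ (k, i))"
      unfolding Bs by (rule sum.reindex_bij_witness[of _ "\<lambda>k. k - s" "\<lambda>r. s + r"]) auto
    finally show "(?Z *\<^sub>v v) $ i = 0\<^sub>v M $ i" using \<alpha>Q[OF i] i by simp
  qed (use Z in simp)
  then have v0: "v = 0\<^sub>v m"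
    by (intro full_column_rank_injective[OF Z _ v]) (use rank[OF k] m_def in auto)
  have "\<alpha> $$ (0, i) = 0" if i: "i < 2*N" for i
  proof (cases "i \<in> ?B")
    case True
    then have r: "i - s < m" "s + (i - s) = i" unfolding Bs by auto
    then have "cnj (\<alpha> $$ (0, i)) = v $ (i - s)" by (simp add: v_def)
    then show ?thesis using r by (simp add: v0)
  qed (use supp i in auto)
  then have "(\<alpha> * R) $$ (0, N + j) = 0"
    using j by (subst mat_mult_entry[OF \<alpha> R]) auto
  then show ?thesis unfolding \<alpha>R using j by (simp add: X_def x_def)
qed

section \<open>Exponentials, dual bases and smooth pulses\<close>

text \<open>
  Multiplication by \<open>exp (- \<nu>0 * t)\<close> and differentiation remove the exponent \<open>\<nu>0\<close> and multiply the other
  coefficients by the nonzero numbers \<open>\<nu> - \<nu>0\<close>.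
\<close>

lemma exponentials_independent_set:
  fixes c :: "complex \<Rightarrow> complex"
  assumes "finite S" "a < b"
    and "\<And>t. t \<in> {a<..<b} \<Longrightarrow> (\<Sum>\<nu>\<in>S. c \<nu> * exp (\<nu> * of_real t)) = 0"
  shows "\<forall>\<nu>\<in>S. c \<nu> = 0"
  using assms(1,3)
proof (induction S arbitrary: c rule: finite_induct)
  case (insert \<nu>0 S)
  let ?h = "\<lambda>t::real. c \<nu>0 + (\<Sum>\<nu>\<in>S. c \<nu> * exp ((\<nu> - \<nu>0) * of_real t))"
  have e: "exp (- \<nu>0 * of_real t) * exp (\<nu> * of_real t) = exp ((\<nu> - \<nu>0) * of_real t)" for \<nu> :: complex and t
    by (simp add: algebra_simps flip: exp_add)
  have h0: "?h t = 0" if "t \<in> {a<..<b}" for t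
  proof -
    have "?h t = exp (- \<nu>0 * of_real t) * (\<Sum>\<nu>\<in>insert \<nu>0 S. c \<nu> * exp (\<nu> * of_real t))"
      using insert.hyps by (simp add: distrib_left sum_distrib_left mult.left_commute[of "exp (- (_ * _))"]
          e[unfolded mult_minus_left] del: mult_minus_left)
    then show ?thesis using insert.prems[OF that] by simp
  qed
  have d0: "(\<Sum>\<nu>\<in>S. c \<nu> * (\<nu> - \<nu>0) * exp (\<nu> * of_real t)) = 0" if t: "t \<in> {a<..<b}" for t
  proof -
    have "(?h has_vector_derivative (\<Sum>\<nu>\<in>S. c \<nu> * ((\<nu> - \<nu>0) * exp ((\<nu> - \<nu>0) * of_real t)))) (at t)"
    proof -
      have "((\<lambda>z. c \<nu>0 + (\<Sum>\<nu>\<in>S. c \<nu> * exp ((\<nu> - \<nu>0) * z))) has_field_derivative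
          (\<Sum>\<nu>\<in>S. c \<nu> * ((\<nu> - \<nu>0) * exp ((\<nu> - \<nu>0) * of_real t)))) (at (of_real t))"
        by (auto intro!: derivative_eq_intros sum.cong)
      then show ?thesis by (rule has_vector_derivative_real_field)
    qed
    moreover have "(?h has_vector_derivative 0) (at t)"
      by (rule has_vector_derivative_transform_within_open[OF has_vector_derivative_const[of 0] open_greaterThanLessThan t])
        (simp only: h0)
    ultimately have z: "(\<Sum>\<nu>\<in>S. c \<nu> * ((\<nu> - \<nu>0) * exp ((\<nu> - \<nu>0) * of_real t))) = 0"
      by (rule vector_derivative_unique_at)
    have "exp (\<nu>0 * of_real t) * exp ((\<nu> - \<nu>0) * of_real t) = exp (\<nu> * of_real t)" for \<nu> :: complex
      by (simp add: algebra_simps flip: exp_add)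
    then have "(\<Sum>\<nu>\<in>S. c \<nu> * (\<nu> - \<nu>0) * exp (\<nu> * of_real t))
        = exp (\<nu>0 * of_real t) * (\<Sum>\<nu>\<in>S. c \<nu> * ((\<nu> - \<nu>0) * exp ((\<nu> - \<nu>0) * of_real t)))"
      by (simp only: sum_distrib_left mult.left_commute[of "exp (\<nu>0 * of_real t)"] mult.assoc)
    then show ?thesis using z by simp
  qed
  have S: "\<forall>\<nu>\<in>S. c \<nu> = 0"
    using insert.IH[of "\<lambda>\<nu>. c \<nu> * (\<nu> - \<nu>0)"] d0 insert.hyps by auto
  moreover have "(a + b) / 2 \<in> {a<..<b}" using assms(2) by auto
  then have "c \<nu>0 = 0" using h0[of "(a + b) / 2"] S by simp
  ultimately show ?case by simp
qed simp

lemma exponentials_independent: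
  fixes c \<mu> :: "'i \<Rightarrow> complex"
  assumes I: "finite I" and ab: "a < b"
    and zero: "\<And>t. t \<in> {a<..<b} \<Longrightarrow> (\<Sum>i\<in>I. c i * exp (\<mu> i * of_real t)) = 0"
    and i: "i \<in> I"
  shows "(\<Sum>k\<in>{k \<in> I. \<mu> k = \<mu> i}. c k) = 0"
proof -
  have "(\<Sum>\<nu>\<in>\<mu> ` I. (\<Sum>k\<in>{k \<in> I. \<mu> k = \<nu>}. c k) * exp (\<nu> * of_real t)) = 0" if "t \<in> {a<..<b}" for t
  proof -
    have "(\<Sum>i\<in>I. c i * exp (\<mu> i * of_real t)) = (\<Sum>\<nu>\<in>\<mu> ` I. \<Sum>k\<in>{k \<in> I. \<mu> k = \<nu>}. c k * exp (\<mu> k * of_real t))"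
      by (rule sum.image_gen[OF I])
    also have "\<dots> = (\<Sum>\<nu>\<in>\<mu> ` I. (\<Sum>k\<in>{k \<in> I. \<mu> k = \<nu>}. c k) * exp (\<nu> * of_real t))"
      unfolding sum_distrib_right by (intro sum.cong refl) auto
    finally show ?thesis using zero[OF that] by simp
  qed
  from exponentials_independent_set[OF finite_imageI[OF I] ab this] show ?thesis using i by blast
qed

text \<open>
  The vectors form a set \<open>V\<close> with an operation \<open>comb r u s v\<close> in the role of \<open>r u + s v\<close>; for
  pulses this is the pointwise combination.  In the induction step the new functional
  minus its projection on the old ones is nonzero at some \<open>v\<close>; subtracting from \<open>v\<close> its components along
  the old dual basis leaves a vector that only the new functional sees.
\<close>

lemma dual_basis:
  fixes L :: "'i \<Rightarrow> 'v \<Rightarrow> real" and comb :: "real \<Rightarrow> 'v \<Rightarrow> real \<Rightarrow> 'v \<Rightarrow> 'v"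
  assumes closed: "\<And>r u s v. u \<in> V \<Longrightarrow> v \<in> V \<Longrightarrow> comb r u s v \<in> V"
    and linear: "\<And>i r u s v. u \<in> V \<Longrightarrow> v \<in> V \<Longrightarrow> L i (comb r u s v) = r * L i u + s * L i v"
    and I: "finite I"
    and indep: "\<And>x. (\<forall>v\<in>V. (\<Sum>i\<in>I. x i * L i v) = 0) \<Longrightarrow> \<forall>i\<in>I. x i = 0"
  shows "\<exists>w. \<forall>i\<in>I. w i \<in> V \<and> (\<forall>j\<in>I. L j (w i) = (if i = j then 1 else 0))"
  using I indep
proof (induction I rule: finite_induct)
  case (insert k I)
  have "\<forall>i\<in>I. x i = 0" if "\<forall>v\<in>V. (\<Sum>i\<in>I. x i * L i v) = 0" for x
  proof -
    have "(\<Sum>i\<in>insert k I. (x(k := 0)) i * L i v) = (\<Sum>i\<in>I. x i * L i v)" for v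
      using insert.hyps by (auto intro!: sum.cong)
    then have "\<forall>i\<in>insert k I. (x(k := 0)) i = 0"
      using that by (intro insert.prems) simp
    then show ?thesis using insert.hyps by (metis fun_upd_apply insertCI)
  qed
  then obtain w where w: "\<And>i. i \<in> I \<Longrightarrow> w i \<in> V"
    "\<And>i j. i \<in> I \<Longrightarrow> j \<in> I \<Longrightarrow> L j (w i) = (if i = j then 1 else 0)"
    using insert.IH by blast
  have "\<exists>v\<in>V. L k v - (\<Sum>i\<in>I. L k (w i) * L i v) \<noteq> 0"
  proof (rule ccontr)
    assume *: "\<not> ?thesis"
    \<comment> \<open>Otherwise the new functional would be its own projection on the old ones.\<close>
    let ?x = "\<lambda>i. if i = k then 1 else - L k (w i)"
    have "(\<Sum>i\<in>insert k I. ?x i * L i v) = L k v - (\<Sum>i\<in>I. L k (w i) * L i v)" for v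
    proof -
      have "(\<Sum>i\<in>I. ?x i * L i v) = (\<Sum>i\<in>I. - (L k (w i) * L i v))"
        using insert.hyps by (intro sum.cong) auto
      then show ?thesis using insert.hyps by (simp add: sum_negf)
    qed
    then have "\<forall>v\<in>V. (\<Sum>i\<in>insert k I. ?x i * L i v) = 0" using * by simp
    then have "\<forall>i\<in>insert k I. ?x i = 0" by (rule insert.prems)
    then show False by simp
  qed
  then obtain v where v: "v \<in> V" and mv: "L k v - (\<Sum>i\<in>I. L k (w i) * L i v) \<noteq> 0" by blast
  have "\<exists>u\<in>V. \<forall>j. L j u = L j v + (\<Sum>i\<in>F. x i * L j (w i))" if "F \<subseteq> I" for F and x :: "'i \<Rightarrow> real"
  proof -
    have "finite F" using that insert.hyps finite_subset by blast
    then show ?thesis using that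
    proof (induction F rule: finite_induct)
      case (insert i F)
      then obtain u where u: "u \<in> V" "\<And>j. L j u = L j v + (\<Sum>i\<in>F. x i * L j (w i))" by auto
      have wi: "w i \<in> V" using insert.prems w by auto
      show ?case
        by (rule bexI[of _ "comb 1 u (x i) (w i)"]) (use insert.hyps u wi in \<open>simp_all add: linear closed\<close>)
    qed (use v in auto)
  qed
  from this[OF order_refl, of "\<lambda>i. - L i v"] obtain u where u: "u \<in> V"
    and lu: "\<And>j. L j u = L j v + (\<Sum>i\<in>I. - L i v * L j (w i))" by blast
  have uI: "L j u = 0" if "j \<in> I" for j
  proof -
    have "(\<Sum>i\<in>I. - L i v * L j (w i)) = (\<Sum>i\<in>I. if i = j then - L i v else 0)"
      by (rule sum.cong) (use that w(2) in auto)
    then show ?thesis using lu[of j] that insert.hyps by simp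
  qed
  have uk: "L k u \<noteq> 0" using mv lu[of k] by (simp add: sum_negf mult.commute)
  \<comment> \<open>The coefficient \<open>0\<close> turns the binary operation into scaling.\<close>
  define z where "z = comb (1 / L k u) u 0 u"
  have z: "z \<in> V" "L k z = 1" "\<And>j. j \<in> I \<Longrightarrow> L j z = 0"
    using u uk uI by (simp_all add: z_def closed linear)
  define w' where "w' i = (if i = k then z else comb 1 (w i) (- L k (w i)) z)" for i
  show ?case
  proof (intro exI[of _ w'] ballI conjI)
    fix i assume i: "i \<in> insert k I"
    show "w' i \<in> V" using i z w by (auto simp: w'_def closed)
    fix j assume j: "j \<in> insert k I"
    show "L j (w' i) = (if i = j then 1 else 0)"
      using i j z w insert.hyps by (auto simp: w'_def linear)
  qed
qed simp

text \<open>
  The derivatives are explicit arguments, so that bounds for linear combinations can be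
  read off from bounds for the summands.
\<close>

definition C2_function :: "(real \<Rightarrow> real) \<Rightarrow> (real \<Rightarrow> real) \<Rightarrow> (real \<Rightarrow> real) \<Rightarrow> bool" where
  "C2_function p p' p'' \<longleftrightarrow> (\<forall>t. (p has_real_derivative p' t) (at t) \<and> (p' has_real_derivative p'' t) (at t)) \<and>
     continuous_on UNIV p''"

definition C2_pulse :: "real \<Rightarrow> (real \<Rightarrow> real) \<Rightarrow> (real \<Rightarrow> real) \<Rightarrow> (real \<Rightarrow> real) \<Rightarrow> bool" where
  "C2_pulse T p p' p'' \<longleftrightarrow> C2_function p p' p'' \<and> (\<forall>t. t \<notin> {0<..<T} \<longrightarrow> p t = 0 \<and> p' t = 0 \<and> p'' t = 0)"

text \<open>
  Only the first \<open>M\<close> pulses act on the system, hence the range of the bound.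
\<close>

definition pulse_family ::
  "real \<Rightarrow> nat \<Rightarrow> real \<Rightarrow> (nat \<Rightarrow> real \<Rightarrow> real) \<Rightarrow> (nat \<Rightarrow> real \<Rightarrow> real) \<Rightarrow> (nat \<Rightarrow> real \<Rightarrow> real) \<Rightarrow> bool" where
  "pulse_family T M K v v' v'' \<longleftrightarrow> (\<forall>i. C2_pulse T (v i) (v' i) (v'' i)) \<and>
     (\<forall>i<M. \<forall>t. \<bar>v i t\<bar> + \<bar>v' i t\<bar> + \<bar>v'' i t\<bar> \<le> K)"

lemma pulse_familyD:
  assumes "pulse_family T M K v v' v''"
  shows "C2_pulse T (v i) (v' i) (v'' i)" "i < M \<Longrightarrow> \<bar>v i t\<bar> + \<bar>v' i t\<bar> + \<bar>v'' i t\<bar> \<le> K"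
  using assms by (auto simp: pulse_family_def)

lemma C2_function_cont:
  assumes "C2_function p p' p''"
  shows "continuous_on S p" "continuous_on S p'" "continuous_on S p''"
proof -
  have "continuous_on UNIV p" "continuous_on UNIV p'" "continuous_on UNIV p''"
    using assms DERIV_isCont unfolding C2_function_def continuous_on_eq_continuous_within by blast+
  then show "continuous_on S p" "continuous_on S p'" "continuous_on S p''"
    using continuous_on_subset by blast+
qed

lemma C2_function_comb:
  assumes "C2_function p p' p''" "C2_function q q' q''"
  shows "C2_function (\<lambda>t. r * p t + s * q t) (\<lambda>t. r * p' t + s * q' t) (\<lambda>t. r * p'' t + s * q'' t)"
  using assms unfolding C2_function_def
  by (auto intro!: derivative_eq_intros continuous_intros)

lemma C2_function_sum:
  assumes "\<And>i. i \<in> I \<Longrightarrow> C2_function (p i) (p' i) (p'' i)"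
  shows "C2_function (\<lambda>t. \<Sum>i\<in>I. x i * p i t) (\<lambda>t. \<Sum>i\<in>I. x i * p' i t) (\<lambda>t. \<Sum>i\<in>I. x i * p'' i t)"
  using assms unfolding C2_function_def
  by (auto intro!: derivative_eq_intros continuous_intros simp: mult.commute)

lemma C2_pulse_comb:
  assumes "C2_pulse T p p' p''" "C2_pulse T q q' q''"
  shows "C2_pulse T (\<lambda>t. r * p t + s * q t) (\<lambda>t. r * p' t + s * q' t) (\<lambda>t. r * p'' t + s * q'' t)"
  using assms C2_function_comb unfolding C2_pulse_def by simp

lemma C2_pulse_sum:
  assumes "\<And>i. i \<in> I \<Longrightarrow> C2_pulse T (p i) (p' i) (p'' i)"
  shows "C2_pulse T (\<lambda>t. \<Sum>i\<in>I. x i * p i t) (\<lambda>t. \<Sum>i\<in>I. x i * p' i t) (\<lambda>t. \<Sum>i\<in>I. x i * p'' i t)"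
  using assms C2_function_sum[of I p p' p''] unfolding C2_pulse_def by (simp add: sum.neutral)

lemma C2_pulse_mult:
  assumes "C2_pulse T p p' p''" "C2_function q q' q''"
  shows "C2_pulse T (\<lambda>t. p t * q t) (\<lambda>t. p' t * q t + p t * q' t)
    (\<lambda>t. p'' t * q t + 2 * p' t * q' t + p t * q'' t)"
proof -
  have p: "C2_function p p' p''" using assms by (simp add: C2_pulse_def)
  note c = C2_function_cont[OF p] C2_function_cont[OF assms(2)]
  have d: "(p has_real_derivative p' t) (at t)" "(p' has_real_derivative p'' t) (at t)"
    "(q has_real_derivative q' t) (at t)" "(q' has_real_derivative q'' t) (at t)" for t
    using p assms(2) by (auto simp: C2_function_def)
  have "C2_function (\<lambda>t. p t * q t) (\<lambda>t. p' t * q t + p t * q' t)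
    (\<lambda>t. p'' t * q t + 2 * p' t * q' t + p t * q'' t)"
    unfolding C2_function_def
    by (intro conjI allI continuous_intros c) (auto intro!: derivative_eq_intros d simp: algebra_simps)
  then show ?thesis using assms by (simp add: C2_pulse_def)
qed

lemma C2_pulse_bounded:
  assumes "C2_pulse T p p' p''"
  shows "\<exists>K\<ge>0. \<forall>t. \<bar>p t\<bar> + \<bar>p' t\<bar> + \<bar>p'' t\<bar> \<le> K"
proof -
  have c: "C2_function p p' p''" using assms by (simp add: C2_pulse_def)
  have "continuous_on {0..T} (\<lambda>t. \<bar>p t\<bar> + \<bar>p' t\<bar> + \<bar>p'' t\<bar>)"
    by (intro continuous_intros C2_function_cont[OF c])
  then have "bounded ((\<lambda>t. \<bar>p t\<bar> + \<bar>p' t\<bar> + \<bar>p'' t\<bar>) ` {0..T})"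
    by (intro compact_imp_bounded compact_continuous_image) auto
  then obtain K where K: "\<And>t. t \<in> {0..T} \<Longrightarrow> \<bar>p t\<bar> + \<bar>p' t\<bar> + \<bar>p'' t\<bar> \<le> K"
    unfolding bounded_iff by force
  show ?thesis
  proof (intro exI[of _ "max 0 K"] conjI allI)
    fix t
    show "\<bar>p t\<bar> + \<bar>p' t\<bar> + \<bar>p'' t\<bar> \<le> max 0 K"
      using K[of t] assms by (cases "t \<in> {0..T}") (auto simp: C2_pulse_def)
  qed simp
qed

lemma ramp_power_deriv:
  fixes x :: real
  shows "((\<lambda>x. (max 0 x) ^ Suc (Suc n)) has_real_derivative of_nat (Suc (Suc n)) * (max 0 x) ^ Suc n) (at x)"
proof -
  consider "x > 0" | "x < 0" | "x = 0" by linarith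
  then show ?thesis
  proof cases
    case 1
    have "((\<lambda>x. x ^ Suc (Suc n)) has_real_derivative of_nat (Suc (Suc n)) * x ^ Suc n) (at x)"
      using DERIV_pow[of "Suc (Suc n)" x] by simp
    then have "((\<lambda>x. (max 0 x) ^ Suc (Suc n)) has_real_derivative of_nat (Suc (Suc n)) * x ^ Suc n) (at x)"
      by (rule has_field_derivative_transform_within_open[of _ _ _ "{0<..}"]) (use 1 in \<open>auto simp: max_def\<close>)
    then show ?thesis using 1 by (simp add: max_def)
  next
    case 2
    have "((\<lambda>x. (max 0 x) ^ Suc (Suc n)) has_real_derivative 0) (at x)"
      by (rule has_field_derivative_transform_within_open[OF DERIV_const[of 0], of "{..<0}"])
        (use 2 in \<open>auto simp: max_def\<close>)
    then show ?thesis using 2 by (simp add: max_def)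
  next
    case 3
    have "((\<lambda>h::real. ((max 0 h) ^ Suc (Suc n)) / h) \<longlongrightarrow> 0) (at 0)"
    proof (rule Lim_null_comparison)
      have "norm ((max 0 h) ^ Suc (Suc n) / h) \<le> \<bar>h\<bar> ^ Suc n" if "h \<noteq> 0" for h :: real
      proof (cases "h > 0")
        case True
        then show ?thesis by simp
      next
        case False
        then have "norm ((max 0 h) ^ Suc (Suc n) / h) = 0" by simp
        moreover have "0 \<le> \<bar>h\<bar> ^ Suc n" by (rule zero_le_power) simp
        ultimately show ?thesis by (simp only:)
      qed
      then show "\<forall>\<^sub>F h in at 0. norm ((max 0 h) ^ Suc (Suc n) / h) \<le> \<bar>h::real\<bar> ^ Suc n"
        unfolding eventually_at by (intro exI[of _ 1]) auto
      have "((\<lambda>h. \<bar>h\<bar> ^ Suc n) \<longlongrightarrow> \<bar>0::real\<bar> ^ Suc n) (at 0)"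
        by (intro tendsto_intros)
      then show "((\<lambda>h. \<bar>h::real\<bar> ^ Suc n) \<longlongrightarrow> 0) (at 0)" by simp
    qed
    then show ?thesis using 3 by (simp add: DERIV_def)
  qed
qed

text \<open>
  The cube of the positive part of \<open>t (T - t)\<close>; the third power makes the function
  twice continuously differentiable at \<open>0\<close> and \<open>T\<close>.
\<close>

lemma C2_bump:
  assumes "T > 0"
  obtains \<eta> \<eta>' \<eta>'' where "C2_pulse T \<eta> \<eta>' \<eta>''" "\<And>t. t \<in> {0<..<T} \<Longrightarrow> \<eta> t > 0"
proof -
  define g where "g t = max 0 (t * (T - t))" for t
  have d: "((\<lambda>t. g t ^ Suc (Suc n)) has_real_derivative of_nat (Suc (Suc n)) * g t ^ Suc n * (T - 2 * t)) (at t)" for n t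
    unfolding g_def
    by (rule DERIV_chain2[OF ramp_power_deriv]) (auto intro!: derivative_eq_intros)
  have d3: "((\<lambda>t. g t ^ 3) has_real_derivative 3 * g t ^ 2 * (T - 2 * t)) (at t)"
    and d2: "((\<lambda>t. g t ^ 2) has_real_derivative 2 * g t * (T - 2 * t)) (at t)" for t
    using d[of 1 t] d[of 0 t] by (simp_all add: numeral_eq_Suc)
  have dd: "((\<lambda>t. 3 * g t ^ 2 * (T - 2 * t)) has_real_derivative
      3 * (2 * g t * (T - 2 * t)) * (T - 2 * t) + - 2 * (3 * g t ^ 2)) (at t)" for t
    by (rule DERIV_mult[OF DERIV_cmult[OF d2]]) (auto intro!: derivative_eq_intros)
  have out: "g t = 0" if "t \<notin> {0<..<T}" for t
    using that assms by (auto simp: g_def max_def mult_le_0_iff zero_le_mult_iff not_less intro: antisym)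
  have gc: "continuous_on UNIV g" unfolding g_def by (intro continuous_intros)
  have "C2_pulse T (\<lambda>t. g t ^ 3) (\<lambda>t. 3 * g t ^ 2 * (T - 2 * t))
      (\<lambda>t. 3 * (2 * g t * (T - 2 * t)) * (T - 2 * t) + - 2 * (3 * g t ^ 2))"
    unfolding C2_pulse_def C2_function_def
    by (intro conjI allI d3 dd continuous_intros gc) (auto simp: out)
  moreover have "g t ^ 3 > 0" if "t \<in> {0<..<T}" for t
    using that by (simp add: g_def max_def)
  ultimately show ?thesis by (rule that)
qed

section \<open>Kernels of the modes\<close>

text \<open>
  The responses of the two components to the datum \<open>y0 = 1\<close> without forcing, before
  the real part is taken.
\<close>

definition kernel_y :: "real \<Rightarrow> complex \<Rightarrow> complex \<Rightarrow> real \<Rightarrow> complex" where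
  "kernel_y \<delta> p q t =
     ((p - of_real \<delta>) * exp (- p * of_real t) - (q - of_real \<delta>) * exp (- q * of_real t)) / (p - q)"

definition kernel_z :: "complex \<Rightarrow> complex \<Rightarrow> real \<Rightarrow> complex" where
  "kernel_z p q t = (exp (- q * of_real t) - exp (- p * of_real t)) / (p - q)"

lemma Re_integral_kernel:
  fixes k :: "real \<Rightarrow> complex"
  assumes "continuous_on {0..T} k"
  shows "Re (integral {0..T} k) = integral {0..T} (\<lambda>s. Re (k s))"
  using integral_linear[OF integrable_continuous_real[OF assms] bounded_linear_Re] by (simp add: o_def)

lemma exp_deriv_real: "((\<lambda>u. exp (- p * of_real u) :: complex) has_vector_derivative (0 - p * exp (- p * of_real t))) (at t)"
  by (rule has_vector_derivative_real_field) (auto intro!: derivative_eq_intros)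

context mode
begin

abbreviation "ky t \<equiv> Re (kernel_y \<delta> p q t)"
abbreviation "kz t \<equiv> Re (kernel_z p q t)"

lemma kernel_deriv_complex:
  "(kernel_y \<delta> p q has_vector_derivative - of_real lam * (kernel_y \<delta> p q t + kernel_z p q t)) (at t)"
  "(kernel_z p q has_vector_derivative kernel_y \<delta> p q t - of_real \<delta> * kernel_z p q t) (at t)"
  using mode_complex_deriv[of "\<lambda>t. exp (- p * of_real t)" 0 t "at t" "\<lambda>t. exp (- q * of_real t)"]
    exp_deriv_real[of p t] exp_deriv_real[of q t]
  unfolding kernel_y_def[abs_def] kernel_z_def[abs_def] by simp_all

lemma kernel_deriv:
  "(ky has_real_derivative - lam * (ky t + kz t)) (at t)"
  "(kz has_real_derivative ky t - \<delta> * kz t) (at t)"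
  using kernel_deriv_complex[of t, THEN bounded_linear.has_vector_derivative[OF bounded_linear_Re]]
  by (simp_all add: has_real_derivative_iff_has_vector_derivative)

lemma kernel_continuous: "continuous_on S (kernel_y \<delta> p q)" "continuous_on S (kernel_z p q)"
  by (rule continuous_at_imp_continuous_on, intro ballI, rule has_vector_derivative_continuous,
      rule kernel_deriv_complex)+

lemma kernel_0: "kernel_y \<delta> p q 0 = 1" "kernel_z p q 0 = 0"
  using pq by (simp_all add: kernel_y_def kernel_z_def)

text \<open>
  The imaginary parts solve the real planar system with zero datum.
\<close>

lemma kernel_real:
  assumes "t \<ge> 0"
  shows "of_real (ky t) = kernel_y \<delta> p q t" "of_real (kz t) = kernel_z p q t"
proof -
  have dy: "((\<lambda>t. Im (kernel_y \<delta> p q t)) has_real_derivative - lam * (Im (kernel_y \<delta> p q s) + Im (kernel_z p q s))) (at s)"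
    and dz: "((\<lambda>t. Im (kernel_z p q t)) has_real_derivative Im (kernel_y \<delta> p q s) - \<delta> * Im (kernel_z p q s)) (at s)" for s
    using kernel_deriv_complex[of s, THEN bounded_linear.has_vector_derivative[OF bounded_linear_Im]]
    by (simp_all add: has_real_derivative_iff_has_vector_derivative)
  have c: "continuous_on {0..} (\<lambda>t. Im (kernel_y \<delta> p q t))" "continuous_on {0..} (\<lambda>t. Im (kernel_z p q t))"
    by (intro continuous_intros kernel_continuous)+
  have i: "Im (kernel_y \<delta> p q 0) = 0" "Im (kernel_z p q 0) = 0" by (simp_all add: kernel_0)
  have "Im (kernel_y \<delta> p q t) = 0" "Im (kernel_z p q t) = 0"
    using mode_energy_zero[OF lam delta assms c dy dz i] by auto
  then show "of_real (ky t) = kernel_y \<delta> p q t" "of_real (kz t) = kernel_z p q t"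
    by (simp_all add: complex_eq_iff)
qed

text \<open>
  Duhamel's formula: datum and forcing act through the same kernels.
\<close>

lemma mode_kernel:
  assumes f: "continuous_on {0..} f"
  shows "mode_y \<delta> p q y0 f t = y0 * ky t + integral {0..t} (\<lambda>s. ky (t - s) * f s)"
    "mode_z p q y0 f t = y0 * kz t + integral {0..t} (\<lambda>s. kz (t - s) * f s)"
proof -
  define I where "I r = integral {0..t} (\<lambda>s. exp (- r * of_real (t - s)) * of_real (f s) :: complex)" for r
  have e: "(\<lambda>s. exp (- r * of_real (t - s)) * of_real (f s) :: complex) integrable_on {0..t}" for r
    by (rule integrable_continuous_real) (intro continuous_intros continuous_on_subset[OF f], auto)
  have comb: "(x * I p - y * I q) / (p - q) =
      integral {0..t} (\<lambda>s. (x * exp (- p * of_real (t - s)) - y * exp (- q * of_real (t - s))) / (p - q) * of_real (f s))" for x y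
  proof -
    have h: "((\<lambda>s. (x * (exp (- p * of_real (t - s)) * of_real (f s)) - y * (exp (- q * of_real (t - s)) * of_real (f s))) / (p - q))
        has_integral (x * I p - y * I q) / (p - q)) {0..t}"
      unfolding I_def
      by (intro has_integral_divide has_integral_diff has_integral_mult_right integrable_integral e)
    show ?thesis
      unfolding integral_unique[OF h, symmetric]
      by (rule integral_cong) (simp add: right_diff_distrib left_diff_distrib diff_divide_distrib mult.assoc)
  qed
  have ck: "continuous_on {0..t} (\<lambda>s. kernel_y \<delta> p q (t - s) * of_real (f s))"
    "continuous_on {0..t} (\<lambda>s. kernel_z p q (t - s) * of_real (f s))"
    by (intro continuous_intros continuous_on_compose2[OF kernel_continuous(1)[of UNIV]]
        continuous_on_compose2[OF kernel_continuous(2)[of UNIV]] continuous_on_subset[OF f]; auto)+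
  have d: "duhamel r y0 f t = of_real y0 * exp (- r * of_real t) + I r" for r
    unfolding duhamel_split[OF f] I_def ..
  have "((p - of_real \<delta>) * duhamel p y0 f t - (q - of_real \<delta>) * duhamel q y0 f t) / (p - q)
      = of_real y0 * kernel_y \<delta> p q t + ((p - of_real \<delta>) * I p - (q - of_real \<delta>) * I q) / (p - q)"
    unfolding d kernel_y_def by (simp add: algebra_simps add_divide_distrib diff_divide_distrib)
  also have "((p - of_real \<delta>) * I p - (q - of_real \<delta>) * I q) / (p - q)
      = integral {0..t} (\<lambda>s. kernel_y \<delta> p q (t - s) * of_real (f s))"
    unfolding comb kernel_y_def ..
  finally show "mode_y \<delta> p q y0 f t = y0 * ky t + integral {0..t} (\<lambda>s. ky (t - s) * f s)"
    unfolding mode_y_def using Re_integral_kernel[OF ck(1)] by simp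
  have "(duhamel q y0 f t - duhamel p y0 f t) / (p - q)
      = of_real y0 * kernel_z p q t + ((- 1) * I p - (- 1) * I q) / (p - q)"
    unfolding d kernel_z_def by (simp add: algebra_simps add_divide_distrib diff_divide_distrib)
  also have "((- 1) * I p - (- 1) * I q) / (p - q) = integral {0..t} (\<lambda>s. kernel_z p q (t - s) * of_real (f s))"
    unfolding comb kernel_z_def by simp
  finally show "mode_z p q y0 f t = y0 * kz t + integral {0..t} (\<lambda>s. kz (t - s) * f s)"
    unfolding mode_z_def using Re_integral_kernel[OF ck(2)] by simp
qed

text \<open>
  The space of combinations \<open>x * ky (T - s) + z * kz (T - s)\<close> is closed under differentiation in \<open>s\<close>: the
  coefficients are mapped to \<open>lam * x - z\<close> and \<open>lam * x + \<delta> * z\<close>.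
\<close>

lemma C2_kernel:
  obtains F' F'' where "C2_function (\<lambda>s. x * ky (T - s) + z * kz (T - s)) F' F''"
proof -
  have d: "((\<lambda>s. x * ky (T - s) + z * kz (T - s)) has_real_derivative
      (lam * x - z) * ky (T - t) + (lam * x + \<delta> * z) * kz (T - t)) (at t)" for x z t
  proof -
    have "((\<lambda>s. ky (T - s)) has_real_derivative - lam * (ky (T - t) + kz (T - t)) * (- 1)) (at t)"
      "((\<lambda>s. kz (T - s)) has_real_derivative (ky (T - t) - \<delta> * kz (T - t)) * (- 1)) (at t)"
      by (rule DERIV_chain2[OF kernel_deriv(1)] DERIV_chain2[OF kernel_deriv(2)]; auto intro!: derivative_eq_intros)+
    from DERIV_add[OF DERIV_cmult[OF this(1), of x] DERIV_cmult[OF this(2), of z]]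
    show ?thesis by (simp add: algebra_simps)
  qed
  have c: "continuous_on UNIV (\<lambda>s. x * ky (T - s) + z * kz (T - s))" for x z
    by (rule continuous_at_imp_continuous_on, intro ballI, rule DERIV_isCont, rule d)
  show ?thesis
    by (rule that, unfold C2_function_def, intro conjI allI, rule d, rule d, rule c)
qed

end

section \<open>Null control of the slow modes\<close>

lemma sum_bool_pairs:
  fixes f :: "nat \<times> bool \<Rightarrow> 'a::comm_monoid_add"
  shows "(\<Sum>a\<in>{..<N} \<times> UNIV. f a) = (\<Sum>j<N. f (j, True) + f (j, False))"
proof -
  have "(\<Sum>a\<in>{..<N} \<times> UNIV. f a) = (\<Sum>j<N. \<Sum>b\<in>UNIV. f (j, b))"
    unfolding sum.cartesian_product by (rule sum.cong) auto
  then show ?thesis by (simp add: UNIV_bool add.commute)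
qed

context
  fixes \<delta> :: real and lam :: "nat \<Rightarrow> real" and N M :: nat and G :: "nat \<Rightarrow> nat \<Rightarrow> real" and T :: real
  assumes modes: "\<And>j. mode \<delta> (lam j) (mu_plus \<delta> lam j) (mu_minus \<delta> lam j)"
    and cross: "\<And>j m. j \<noteq> m \<Longrightarrow> mu_plus \<delta> lam j \<noteq> mu_minus \<delta> lam m"
    and rows: "\<And>j. j < N \<Longrightarrow> \<forall>c.
      (\<forall>i<M. (\<Sum>k\<in>{k. k < N \<and> lam k = lam j}. c k * complex_of_real (G k i)) = 0) \<longrightarrow> c j = 0"
    and T: "T > 0"
begin

text \<open>
  The index \<open>(j, True)\<close> stands for the component \<open>y\<close> of mode \<open>j\<close> and \<open>(j, False)\<close> for its component \<open>z\<close>;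
  \<open>steer\<close> is the contribution of a control to this component at time \<open>T\<close>.
\<close>

definition slow_kernel :: "nat \<times> bool \<Rightarrow> real \<Rightarrow> real" where
  "slow_kernel a t = (if snd a then Re (kernel_y \<delta> (mu_plus \<delta> lam (fst a)) (mu_minus \<delta> lam (fst a)) t)
     else Re (kernel_z (mu_plus \<delta> lam (fst a)) (mu_minus \<delta> lam (fst a)) t))"

definition steer :: "nat \<times> bool \<Rightarrow> (nat \<Rightarrow> real \<Rightarrow> real) \<Rightarrow> real" where
  "steer a u = integral {0..T} (\<lambda>s. slow_kernel a (T - s) * (\<Sum>i<M. G (fst a) i * u i s))"

lemma slow_kernel_continuous: "continuous_on S (\<lambda>s. slow_kernel a (T - s))"
proof -
  have "continuous_on UNIV (slow_kernel a)"
    unfolding slow_kernel_def[abs_def]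
    by (cases "snd a") (auto intro!: continuous_intros mode.kernel_continuous[OF modes])
  then show ?thesis by (rule continuous_on_compose2) (auto intro!: continuous_intros)
qed

lemma steer_integrable:
  assumes "\<And>i. continuous_on {0..T} (u i)"
  shows "(\<lambda>s. slow_kernel a (T - s) * (\<Sum>i<M. G (fst a) i * u i s)) integrable_on {0..T}"
  by (intro integrable_continuous_real continuous_intros slow_kernel_continuous assms)

lemma steer_comb:
  assumes "\<And>i. continuous_on {0..T} (u i)" "\<And>i. continuous_on {0..T} (v i)"
  shows "steer a (\<lambda>i t. r * u i t + s * v i t) = r * steer a u + s * steer a v"
proof -
  have "steer a (\<lambda>i t. r * u i t + s * v i t)
      = integral {0..T} (\<lambda>t. r * (slow_kernel a (T - t) * (\<Sum>i<M. G (fst a) i * u i t))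
        + s * (slow_kernel a (T - t) * (\<Sum>i<M. G (fst a) i * v i t)))"
    unfolding steer_def
    by (rule integral_cong) (simp add: distrib_left sum.distrib sum_distrib_left mult_ac)
  also have "\<dots> = r * steer a u + s * steer a v"
    unfolding steer_def by (subst integral_add) (auto intro!: integrable_on_mult_right steer_integrable assms)
  finally show ?thesis .
qed

text \<open>
  Written with complex exponentials, the hypothesis says for each exponent that a combination of
  the rows of \<open>G\<close> over one eigenvalue vanishes, so \<open>x (j, True) * (p - \<delta>) = x (j, False)\<close> and the same
  with \<open>q\<close> in place of \<open>p\<close>.  As \<open>p\<close> and \<open>q\<close> differ, both numbers are zero.
\<close>

lemma adjoint_vanishes:
  assumes zero: "\<And>i t. i < M \<Longrightarrow> t \<in> {0<..<T} \<Longrightarrow>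
      (\<Sum>j<N. G j i * (x (j, True) * slow_kernel (j, True) t + x (j, False) * slow_kernel (j, False) t)) = 0"
    and j: "j < N"
  shows "x (j, True) = 0 \<and> x (j, False) = 0"
proof -
  let ?p = "mu_plus \<delta> lam" and ?q = "mu_minus \<delta> lam"
  define \<mu> where "\<mu> a = (if snd a then - ?p (fst a) else - ?q (fst a))" for a :: "nat \<times> bool"
  define c where "c a = (if snd a
      then (of_real (x (fst a, True)) * (?p (fst a) - of_real \<delta>) - of_real (x (fst a, False))) / (?p (fst a) - ?q (fst a))
      else (of_real (x (fst a, False)) - of_real (x (fst a, True)) * (?q (fst a) - of_real \<delta>)) / (?p (fst a) - ?q (fst a)))"
    for a :: "nat \<times> bool"
  let ?I = "{..<N} \<times> (UNIV :: bool set)"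
  have exps: "(\<Sum>a\<in>?I. (of_real (G (fst a) i) * c a) * exp (\<mu> a * of_real t)) = 0"
    if i: "i < M" and t: "t \<in> {0<..<T}" for i t
  proof -
    have mj: "of_real (x (j, True) * slow_kernel (j, True) t + x (j, False) * slow_kernel (j, False) t)
        = c (j, True) * exp (\<mu> (j, True) * of_real t) + c (j, False) * exp (\<mu> (j, False) * of_real t)" for j
    proof -
      have "of_real (x (j, True) * slow_kernel (j, True) t + x (j, False) * slow_kernel (j, False) t)
          = of_real (x (j, True)) * kernel_y \<delta> (?p j) (?q j) t + of_real (x (j, False)) * kernel_z (?p j) (?q j) t"
        using mode.kernel_real[OF modes, of t j] t by (simp add: slow_kernel_def)
      also have "\<dots> = c (j, True) * exp (\<mu> (j, True) * of_real t) + c (j, False) * exp (\<mu> (j, False) * of_real t)"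
        unfolding kernel_y_def kernel_z_def c_def \<mu>_def fst_conv snd_conv if_True if_False
        by (simp add: add_divide_distrib[symmetric]) (simp add: algebra_simps)
      finally show ?thesis .
    qed
    have "(\<Sum>a\<in>?I. (of_real (G (fst a) i) * c a) * exp (\<mu> a * of_real t))
        = (\<Sum>j<N. of_real (G j i) * of_real (x (j, True) * slow_kernel (j, True) t + x (j, False) * slow_kernel (j, False) t))"
      unfolding sum_bool_pairs mj by (simp add: distrib_left mult.assoc)
    also have "\<dots> = of_real (\<Sum>j<N. G j i * (x (j, True) * slow_kernel (j, True) t + x (j, False) * slow_kernel (j, False) t))"
      by simp
    finally show ?thesis using zero[OF i t] by simp
  qed
  have group: "{k \<in> ?I. \<mu> k = \<mu> (j, b)} = (\<lambda>k. (k, b)) ` {k. k < N \<and> lam k = lam j}" for b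
  proof -
    have pp: "?p k = ?p j \<longleftrightarrow> lam k = lam j" for k
    proof
      assume eq: "?p k = ?p j"
      show "lam k = lam j" using mode_lam_unique[OF modes[of k], of "lam j" "?q j"] modes[of j] eq by auto
    qed (simp add: mu_plus_def)
    have qq: "?q k = ?q j \<longleftrightarrow> lam k = lam j" for k
    proof
      assume eq: "?q k = ?q j"
      have swap: "mode \<delta> (lam k) (?q k) (?p k)" using modes[of k]
        by (auto simp: mode_def add.commute mult.commute)
      show "lam k = lam j" using mode_lam_unique[OF swap, of "lam j" "?p j"] modes[of j] eq by auto
    qed (simp add: mu_minus_def)
    have pq: "?p k \<noteq> ?q m" for k m
      using cross[of k m] mode.pq[OF modes[of k]] by (cases "k = m") auto
    show ?thesis using pp qq pq pq[symmetric] by (cases b) (force simp: \<mu>_def image_iff)+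
  qed
  have cj: "c (j, b) = 0" for b
  proof (rule rows[OF j, rule_format])
    fix i assume i: "i < M"
    have "(\<Sum>k\<in>{k \<in> ?I. \<mu> k = \<mu> (j, b)}. of_real (G (fst k) i) * c k) = 0"
      by (rule exponentials_independent[OF _ T exps[OF i]]) (use j in auto)
    then show "(\<Sum>k\<in>{k. k < N \<and> lam k = lam j}. c (k, b) * of_real (G k i)) = 0"
      unfolding group by (subst (asm) sum.reindex) (auto simp: inj_on_def mult.commute)
  qed
  have pq: "?p j - ?q j \<noteq> 0" using mode.pq[OF modes[of j]] by simp
  have 1: "of_real (x (j, True)) * (?p j - of_real \<delta>) = of_real (x (j, False))"
    "of_real (x (j, False)) = of_real (x (j, True)) * (?q j - of_real \<delta>)"
    using cj[of True] cj[of False] pq by (simp_all add: c_def)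
  then have "of_real (x (j, True)) * (?p j - ?q j) = 0"
    by (simp add: algebra_simps)
  then have "x (j, True) = 0" using pq by simp
  then show ?thesis using 1 by simp
qed

text \<open>
  The combination of the functionals is the pairing of the control with certain smooth functions \<open>F i\<close>.
  Testing it with \<open>\<eta> * F i\<close> for a bump \<open>\<eta>\<close> that is positive inside \<open>(0, T)\<close> gives \<open>F i = 0\<close> there.
\<close>

lemma steering_independent:
  assumes zero: "\<And>u. (\<forall>i. \<exists>p' p''. C2_pulse T (u i) p' p'') \<Longrightarrow> (\<Sum>a\<in>{..<N} \<times> UNIV. x a * steer a u) = 0"
    and j: "j < N"
  shows "x (j, True) = 0 \<and> x (j, False) = 0"
proof (rule adjoint_vanishes[OF _ j])
  let ?I = "{..<N} \<times> (UNIV :: bool set)"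
  define F where "F i s = (\<Sum>j<N. G j i * (x (j, True) * slow_kernel (j, True) (T - s) + x (j, False) * slow_kernel (j, False) (T - s)))" for i s
  have "\<exists>F' F''. C2_function (\<lambda>s. x (j, True) * slow_kernel (j, True) (T - s) + x (j, False) * slow_kernel (j, False) (T - s)) F' F''" for j
    unfolding slow_kernel_def fst_conv snd_conv if_True if_False
    by (rule mode.C2_kernel[OF modes[of j]]) blast
  then obtain f' f'' where f: "\<And>j. C2_function (\<lambda>s. x (j, True) * slow_kernel (j, True) (T - s) + x (j, False) * slow_kernel (j, False) (T - s)) (f' j) (f'' j)"
    by metis
  have F: "\<exists>F' F''. C2_function (F i) F' F''" for i
    using C2_function_sum[of "{..<N}" _ f' f'' "\<lambda>j. G j i", OF f] unfolding F_def[abs_def] by blast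
  obtain \<eta> \<eta>' \<eta>'' where \<eta>: "C2_pulse T \<eta> \<eta>' \<eta>''" and pos: "\<And>t. t \<in> {0<..<T} \<Longrightarrow> \<eta> t > 0"
    using C2_bump[OF T] by blast
  define u where "u i s = \<eta> s * F i s" for i s
  have u: "\<exists>p' p''. C2_pulse T (u i) p' p''" for i
    using C2_pulse_mult[OF \<eta>] F[of i] unfolding u_def[abs_def] by blast
  have Fc: "continuous_on S (F i)" for S i using F[of i] C2_function_cont by blast
  have \<eta>c: "continuous_on S \<eta>" for S using \<eta> C2_function_cont by (auto simp: C2_pulse_def)
  have uc: "continuous_on S (u i)" for S i unfolding u_def[abs_def] by (intro continuous_intros Fc \<eta>c)
  have "0 = (\<Sum>a\<in>?I. x a * steer a u)" using zero u by simp
  also have "\<dots> = integral {0..T} (\<lambda>s. \<Sum>a\<in>?I. x a * (slow_kernel a (T - s) * (\<Sum>i<M. G (fst a) i * u i s)))"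
    unfolding steer_def
    by (subst integral_sum) (auto intro!: integrable_on_mult_right steer_integrable uc)
  also have "\<dots> = integral {0..T} (\<lambda>s. \<Sum>i<M. \<eta> s * (F i s)\<^sup>2)"
  proof (rule integral_cong)
    fix s
    have "(\<Sum>a\<in>?I. x a * (slow_kernel a (T - s) * (\<Sum>i<M. G (fst a) i * u i s)))
        = (\<Sum>j<N. (x (j, True) * slow_kernel (j, True) (T - s) + x (j, False) * slow_kernel (j, False) (T - s)) * (\<Sum>i<M. G j i * u i s))"
      unfolding sum_bool_pairs by (simp add: algebra_simps)
    also have "\<dots> = (\<Sum>i<M. F i s * u i s)"
      unfolding F_def sum_distrib_left sum_distrib_right by (subst sum.swap) (simp add: mult_ac)
    also have "\<dots> = (\<Sum>i<M. \<eta> s * (F i s)\<^sup>2)"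
      by (simp add: u_def power2_eq_square mult_ac)
    finally show "(\<Sum>a\<in>?I. x a * (slow_kernel a (T - s) * (\<Sum>i<M. G (fst a) i * u i s))) = (\<Sum>i<M. \<eta> s * (F i s)\<^sup>2)" .
  qed
  finally have int0: "integral {0..T} (\<lambda>s. \<Sum>i<M. \<eta> s * (F i s)\<^sup>2) = 0" by simp
  have \<eta>0: "\<eta> s \<ge> 0" for s
    using pos[of s] \<eta> unfolding C2_pulse_def by (cases "s \<in> {0<..<T}") (auto intro: less_imp_le)
  have all0: "(\<Sum>i<M. \<eta> s * (F i s)\<^sup>2) = 0" if "s \<in> {0..T}" for s
  proof -
    have "\<forall>s\<in>{0..T}. (\<Sum>i<M. \<eta> s * (F i s)\<^sup>2) = 0"
      using int0 by (subst (asm) integral_eq_0_iff) (auto intro!: continuous_intros Fc \<eta>c sum_nonneg mult_nonneg_nonneg T \<eta>0)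
    then show ?thesis using that by blast
  qed
  fix i t assume i: "i < M" and t: "t \<in> {0<..<T}"
  then have s: "T - t \<in> {0<..<T}" by auto
  have "(\<Sum>i<M. \<eta> (T - t) * (F i (T - t))\<^sup>2) = 0" using all0[of "T - t"] s by simp
  then have "\<forall>i\<in>{..<M}. \<eta> (T - t) * (F i (T - t))\<^sup>2 = 0"
    by (subst (asm) sum_nonneg_eq_0_iff) (auto simp: \<eta>0)
  then have "\<eta> (T - t) * (F i (T - t))\<^sup>2 = 0" using i by blast
  then have "F i (T - t) = 0" using pos[OF s] by simp
  then show "(\<Sum>j<N. G j i * (x (j, True) * slow_kernel (j, True) t + x (j, False) * slow_kernel (j, False) t)) = 0"
    by (simp add: F_def)
qed

lemma steering_pulses:
  obtains W W' W'' where "\<And>a i. a \<in> {..<N} \<times> UNIV \<Longrightarrow> C2_pulse T (W a i) (W' a i) (W'' a i)"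
    "\<And>a b. a \<in> {..<N} \<times> UNIV \<Longrightarrow> b \<in> {..<N} \<times> UNIV \<Longrightarrow> steer b (W a) = (if a = b then 1 else 0)"
proof -
  let ?I = "{..<N} \<times> (UNIV :: bool set)"
  let ?V = "{u :: nat \<Rightarrow> real \<Rightarrow> real. \<forall>i. \<exists>p' p''. C2_pulse T (u i) p' p''}"
  have cont: "continuous_on {0..T} (u i)" if "u \<in> ?V" for u i
    using that C2_function_cont unfolding C2_pulse_def by blast
  have "\<exists>w. \<forall>a\<in>?I. w a \<in> ?V \<and> (\<forall>b\<in>?I. steer b (w a) = (if a = b then 1 else 0))"
  proof (rule dual_basis[where comb = "\<lambda>r u s v i t. r * u i t + s * v i t"])
    fix r s :: real and u v assume "u \<in> ?V" "v \<in> ?V"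
    then show "(\<lambda>i t. r * u i t + s * v i t) \<in> ?V" using C2_pulse_comb by blast
  next
    fix a and r s :: real and u v assume "u \<in> ?V" "v \<in> ?V"
    then show "steer a (\<lambda>i t. r * u i t + s * v i t) = r * steer a u + s * steer a v"
      using cont by (intro steer_comb) auto
  next
    fix x assume "\<forall>v\<in>?V. (\<Sum>a\<in>?I. x a * steer a v) = 0"
    then have "x (j, True) = 0 \<and> x (j, False) = 0" if "j < N" for j
      using that by (intro steering_independent) auto
    then show "\<forall>a\<in>?I. x a = 0" by (metis (full_types) SigmaE lessThan_iff)
  qed simp
  then obtain W where *: "\<forall>a\<in>?I. W a \<in> ?V \<and> (\<forall>b\<in>?I. steer b (W a) = (if a = b then 1 else 0))"
    by (elim exE)
  have W: "\<And>a. a \<in> ?I \<Longrightarrow> \<forall>i. \<exists>p' p''. C2_pulse T (W a i) p' p''"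
    using bspec[OF *] by simp
  have W2: "\<And>a b. a \<in> ?I \<Longrightarrow> b \<in> ?I \<Longrightarrow> steer b (W a) = (if a = b then 1 else 0)"
    using bspec[OF conjunct2[OF bspec[OF *]]] .
  define W' where "W' a i = (SOME p'. \<exists>p''. C2_pulse T (W a i) p' p'')" for a i
  define W'' where "W'' a i = (SOME p''. C2_pulse T (W a i) (W' a i) p'')" for a i
  have "C2_pulse T (W a i) (W' a i) (W'' a i)" if a: "a \<in> ?I" for a i
  proof -
    have "\<exists>p' p''. C2_pulse T (W a i) p' p''" using W[OF a] by blast
    then have "\<exists>p''. C2_pulse T (W a i) (W' a i) p''" unfolding W'_def by (rule someI_ex)
    then show ?thesis unfolding W''_def by (rule someI_ex)
  qed
  then show ?thesis using W2 by (rule that)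
qed

text \<open>
  The dual pulses are added up with the negatives of the free values at time \<open>T\<close> as coefficients.
\<close>

lemma null_control:
  shows "\<exists>K>0. \<forall>y. \<exists>v v' v''.
      pulse_family T M (K * (\<Sum>j<N. \<bar>y j\<bar>)) v v' v'' \<and>
      (\<forall>j<N. mu_mode_y \<delta> lam j (y j) (\<lambda>s. \<Sum>i<M. G j i * v i s) T = 0 \<and>
             mu_mode_z \<delta> lam j (y j) (\<lambda>s. \<Sum>i<M. G j i * v i s) T = 0)"
    (is "\<exists>K>0. \<forall>y. ?null K y")
proof -
  let ?I = "{..<N} \<times> (UNIV :: bool set)"
  obtain W W' W'' where W: "\<And>a i. a \<in> ?I \<Longrightarrow> C2_pulse T (W a i) (W' a i) (W'' a i)"
    and dual: "\<And>a b. a \<in> ?I \<Longrightarrow> b \<in> ?I \<Longrightarrow> steer b (W a) = (if a = b then 1 else 0)"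
    using steering_pulses by blast
  define k where "k a i = (if a \<in> ?I then SOME K. K \<ge> 0 \<and> (\<forall>t. \<bar>W a i t\<bar> + \<bar>W' a i t\<bar> + \<bar>W'' a i t\<bar> \<le> K) else 0)" for a i
  have kI: "0 \<le> k a i \<and> (\<forall>t. \<bar>W a i t\<bar> + \<bar>W' a i t\<bar> + \<bar>W'' a i t\<bar> \<le> k a i)" if a: "a \<in> ?I" for a i
  proof -
    have "\<exists>K. K \<ge> 0 \<and> (\<forall>t. \<bar>W a i t\<bar> + \<bar>W' a i t\<bar> + \<bar>W'' a i t\<bar> \<le> K)"
      by (rule C2_pulse_bounded[OF W[OF a]])
    from someI_ex[OF this] show ?thesis unfolding k_def using a by (simp only: if_True simp_thms)
  qed
  have k: "k a i \<ge> 0" "a \<in> ?I \<Longrightarrow> \<bar>W a i t\<bar> + \<bar>W' a i t\<bar> + \<bar>W'' a i t\<bar> \<le> k a i" for a i t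
    using kI[of a i] by (cases "a \<in> ?I"; simp add: k_def)+
  have Wc: "continuous_on S (W a i)" if "a \<in> ?I" for S a i
    using W[OF that] C2_function_cont unfolding C2_pulse_def by blast
  have steer_sum: "steer b (\<lambda>i t. \<Sum>a\<in>A. x a * W a i t) = (\<Sum>a\<in>A. x a * steer b (W a))"
    if "A \<subseteq> ?I" for b A x
  proof -
    have "finite A" using finite_subset[OF that] by simp
    then show ?thesis using that
    proof (induction A rule: finite_induct)
      case (insert a A)
      have "steer b (\<lambda>i t. 1 * (\<Sum>a\<in>A. x a * W a i t) + x a * W a i t)
          = 1 * steer b (\<lambda>i t. \<Sum>a\<in>A. x a * W a i t) + x a * steer b (W a)"
        using insert.prems by (intro steer_comb continuous_intros Wc) auto
      then show ?case using insert by (simp add: add.commute)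
    qed (simp add: steer_def)
  qed
  let ?g = "\<lambda>a. \<bar>slow_kernel a T\<bar>"
  define K where "K = 1 + (\<Sum>a\<in>?I. \<Sum>i<M. ?g a * k a i)"
  have K: "K > 0" unfolding K_def by (intro add_pos_nonneg sum_nonneg mult_nonneg_nonneg k) auto
  show ?thesis
  proof (intro exI[of _ K] conjI K allI)
    fix y :: "nat \<Rightarrow> real"
    define x where "x a = - (y (fst a) * slow_kernel a T)" for a
    define v where "v i t = (\<Sum>a\<in>?I. x a * W a i t)" for i t
    define v' where "v' i t = (\<Sum>a\<in>?I. x a * W' a i t)" for i t
    define v'' where "v'' i t = (\<Sum>a\<in>?I. x a * W'' a i t)" for i t
    have pulse: "C2_pulse T (v i) (v' i) (v'' i)" for i
      unfolding v_def[abs_def] v'_def[abs_def] v''_def[abs_def] by (intro C2_pulse_sum W)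
    have bound: "\<bar>v i t\<bar> + \<bar>v' i t\<bar> + \<bar>v'' i t\<bar> \<le> K * (\<Sum>j<N. \<bar>y j\<bar>)" if i: "i < M" for i t
    proof -
      have "\<bar>v i t\<bar> + \<bar>v' i t\<bar> + \<bar>v'' i t\<bar>
          \<le> (\<Sum>a\<in>?I. \<bar>x a * W a i t\<bar>) + (\<Sum>a\<in>?I. \<bar>x a * W' a i t\<bar>) + (\<Sum>a\<in>?I. \<bar>x a * W'' a i t\<bar>)"
        unfolding v_def v'_def v''_def by (intro add_mono sum_abs)
      also have "\<dots> = (\<Sum>a\<in>?I. \<bar>x a\<bar> * (\<bar>W a i t\<bar> + \<bar>W' a i t\<bar> + \<bar>W'' a i t\<bar>))"
        by (simp add: sum.distrib distrib_left abs_mult)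
      also have "\<dots> \<le> (\<Sum>a\<in>?I. (\<Sum>j<N. \<bar>y j\<bar>) * (?g a * k a i))"
      proof (rule sum_mono)
        fix a assume a: "a \<in> ?I"
        have "\<bar>y (fst a)\<bar> \<le> (\<Sum>j<N. \<bar>y j\<bar>)"
          by (rule member_le_sum) (use a in auto)
        then have "\<bar>x a\<bar> \<le> (\<Sum>j<N. \<bar>y j\<bar>) * ?g a"
          unfolding x_def by (simp add: abs_mult mult_right_mono)
        then have "\<bar>x a\<bar> * (\<bar>W a i t\<bar> + \<bar>W' a i t\<bar> + \<bar>W'' a i t\<bar>) \<le> (\<Sum>j<N. \<bar>y j\<bar>) * ?g a * k a i"
          by (intro mult_mono k(2)[OF a] mult_nonneg_nonneg sum_nonneg) auto
        then show "\<bar>x a\<bar> * (\<bar>W a i t\<bar> + \<bar>W' a i t\<bar> + \<bar>W'' a i t\<bar>) \<le> (\<Sum>j<N. \<bar>y j\<bar>) * (?g a * k a i)"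
          by (simp only: mult.assoc)
      qed
      also have "\<dots> = (\<Sum>j<N. \<bar>y j\<bar>) * (\<Sum>a\<in>?I. ?g a * k a i)" by (simp add: sum_distrib_left)
      also have "\<dots> \<le> (\<Sum>j<N. \<bar>y j\<bar>) * K"
      proof (rule mult_left_mono)
        have "?g a * k a i \<le> (\<Sum>i<M. ?g a * k a i)" for a
          by (rule member_le_sum) (use i k(1) in auto)
        then have "(\<Sum>a\<in>?I. ?g a * k a i) \<le> (\<Sum>a\<in>?I. \<Sum>i<M. ?g a * k a i)" by (rule sum_mono)
        then show "(\<Sum>a\<in>?I. ?g a * k a i) \<le> K" by (simp add: K_def)
      qed (simp add: sum_nonneg)
      finally show ?thesis by (simp add: mult.commute)
    qed
    have vc: "continuous_on S (v i)" for S i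
      using pulse C2_function_cont unfolding C2_pulse_def by blast
    have fc: "continuous_on {0..} (\<lambda>s. \<Sum>i<M. G j i * v i s)" for j
      by (intro continuous_intros vc)
    have st: "steer b v = - (y (fst b) * slow_kernel b T)" if b: "b \<in> ?I" for b
    proof -
      have "steer b v = (\<Sum>a\<in>?I. x a * steer b (W a))"
        unfolding v_def[abs_def] by (rule steer_sum) simp
      also have "\<dots> = (\<Sum>a\<in>?I. if a = b then x a else 0)"
        by (rule sum.cong) (use b dual in auto)
      also have "\<dots> = x b" using b by simp
      finally show ?thesis by (simp add: x_def)
    qed
    have null: "mu_mode_y \<delta> lam j (y j) (\<lambda>s. \<Sum>i<M. G j i * v i s) T = 0"
      "mu_mode_z \<delta> lam j (y j) (\<lambda>s. \<Sum>i<M. G j i * v i s) T = 0" if "j < N" for j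
      using st[of "(j, True)"] st[of "(j, False)"] that
      unfolding mode.mode_kernel[OF modes fc] steer_def by (simp_all add: slow_kernel_def)
    show "?null K y"
      unfolding pulse_family_def using pulse bound null by blast
  qed
qed

end

section \<open>Stabilizing pulses and the complexified equation\<close>

lemma bounded_linear_cembed: "bounded_linear cembed"
  unfolding cembed_def[abs_def] by (intro bounded_linear_intros)

lemma norm_cembed: "norm (cembed x) = norm x"
  by (simp add: cembed_def)

lemma memory_solution_cembed:
  assumes y: "real_memory_solution D A \<delta> f y0 y" and zero: "0 \<in> D" "A 0 = 0"
  shows "memory_solution D A \<delta> (\<lambda>t. cembed (f t)) (cembed y0) (\<lambda>t. cembed (y t))"
proof -
  obtain y' where y': "continuous_on {0<..} y'" "\<And>t. t > 0 \<Longrightarrow> y t \<in> D \<and> (y has_vector_derivative y' t) (at t) \<and>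
           (\<lambda>s. mem_kernel \<delta> (t - s) *\<^sub>R A (y s)) integrable_on {0..t} \<and>
           y' t + A (y t) + integral {0..t} (\<lambda>s. mem_kernel \<delta> (t - s) *\<^sub>R A (y s)) = f t"
    and yc: "continuous_on {0..} y" and y0: "y 0 = y0"
    using y unfolding real_memory_solution_def by auto
  have k: "mem_kernel \<delta> (t - s) *\<^sub>R complexify A (cembed (y s)) = cembed (mem_kernel \<delta> (t - s) *\<^sub>R A (y s))" for t s
    by (simp add: cembed_def zero)
  have int: "((\<lambda>s. mem_kernel \<delta> (t - s) *\<^sub>R complexify A (cembed (y s))) has_integral
      cembed (integral {0..t} (\<lambda>s. mem_kernel \<delta> (t - s) *\<^sub>R A (y s)))) {0..t}" if "t > 0" for t
  proof -
    have i: "(\<lambda>s. mem_kernel \<delta> (t - s) *\<^sub>R A (y s)) integrable_on {0..t}" using y'(2)[OF that] by simp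
    show ?thesis
      unfolding k using has_integral_linear[OF integrable_integral[OF i] bounded_linear_cembed] by (simp only: o_def)
  qed
  show ?thesis
    unfolding memory_solution_def
  proof (intro conjI exI[of _ "\<lambda>t. cembed (y' t)"] allI impI)
    show "continuous_on {0..} (\<lambda>t. cembed (y t))" "continuous_on {0<..} (\<lambda>t. cembed (y' t))"
      using yc y'(1) by (simp_all add: bounded_linear.continuous_on[OF bounded_linear_cembed])
    fix t :: real assume t: "t > 0"
    show "cembed (y t) \<in> D \<times> D" using y'(2)[OF t] zero by (simp add: cembed_def)
    show "((\<lambda>t. cembed (y t)) has_vector_derivative cembed (y' t)) (at t)"
      using y'(2)[OF t] by (intro bounded_linear.has_vector_derivative[OF bounded_linear_cembed]) simp
    show "(\<lambda>s. mem_kernel \<delta> (t - s) *\<^sub>R complexify A (cembed (y s))) integrable_on {0..t}"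
      using int[OF t] by (auto simp: integrable_on_def)
    show "cembed (y' t) + complexify A (cembed (y t)) +
        integral {0..t} (\<lambda>s. mem_kernel \<delta> (t - s) *\<^sub>R complexify A (cembed (y s))) = cembed (f t)"
      unfolding integral_unique[OF int[OF t]] using y'(2)[OF t] by (auto simp: cembed_def zero)
  qed (simp add: y0)
qed

text \<open>
  Both projections commute with the complexified operator and with the real kernel.
\<close>

lemma memory_solution_part:
  fixes \<pi> :: "'h::{real_inner,banach} \<times> 'h \<Rightarrow> 'h"
  assumes z: "memory_solution D A \<delta> F z0 z"
    and \<pi>: "\<pi> = fst \<or> \<pi> = snd"
  shows "real_memory_solution D A \<delta> (\<lambda>t. \<pi> (F t)) (\<pi> z0) (\<lambda>t. \<pi> (z t))"
proof -
  have bl: "bounded_linear \<pi>" using \<pi> bounded_linear_fst bounded_linear_snd by metis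
  have add: "\<pi> (a + b) = \<pi> a + \<pi> b" for a b using \<pi> by auto
  have A: "\<pi> (complexify A a) = A (\<pi> a)" and D: "a \<in> D \<times> D \<Longrightarrow> \<pi> a \<in> D" for a
    using \<pi> by (auto simp: map_prod_def split: prod.splits)
  have sc: "\<pi> (r *\<^sub>R a) = r *\<^sub>R \<pi> a" for r a using \<pi> by auto
  obtain z' where z': "continuous_on {0<..} z'" "\<And>t. t > 0 \<Longrightarrow> z t \<in> D \<times> D \<and> (z has_vector_derivative z' t) (at t) \<and>
           (\<lambda>s. mem_kernel \<delta> (t - s) *\<^sub>R complexify A (z s)) integrable_on {0..t} \<and>
           z' t + complexify A (z t) + integral {0..t} (\<lambda>s. mem_kernel \<delta> (t - s) *\<^sub>R complexify A (z s)) = F t"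
    and zc: "continuous_on {0..} z" and z0: "z 0 = z0"
    using z unfolding memory_solution_def by auto
  have int: "((\<lambda>s. mem_kernel \<delta> (t - s) *\<^sub>R A (\<pi> (z s))) has_integral
      \<pi> (integral {0..t} (\<lambda>s. mem_kernel \<delta> (t - s) *\<^sub>R complexify A (z s)))) {0..t}" if "t > 0" for t
  proof -
    have i: "(\<lambda>s. mem_kernel \<delta> (t - s) *\<^sub>R complexify A (z s)) integrable_on {0..t}" using z'(2)[OF that] by simp
    show ?thesis
      using has_integral_linear[OF integrable_integral[OF i] bl] by (simp only: o_def sc A)
  qed
  show ?thesis
    unfolding real_memory_solution_def
  proof (intro conjI exI[of _ "\<lambda>t. \<pi> (z' t)"] allI impI)
    show "continuous_on {0..} (\<lambda>t. \<pi> (z t))" "continuous_on {0<..} (\<lambda>t. \<pi> (z' t))"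
      using zc z'(1) by (simp_all add: bounded_linear.continuous_on[OF bl])
    fix t :: real assume t: "t > 0"
    show "\<pi> (z t) \<in> D" using z'(2)[OF t] by (intro D) simp
    show "((\<lambda>t. \<pi> (z t)) has_vector_derivative \<pi> (z' t)) (at t)"
      using z'(2)[OF t] by (intro bounded_linear.has_vector_derivative[OF bl]) simp
    show "(\<lambda>s. mem_kernel \<delta> (t - s) *\<^sub>R A (\<pi> (z s))) integrable_on {0..t}"
      using int[OF t] by (auto simp: integrable_on_def)
    have "\<pi> (z' t + complexify A (z t) + integral {0..t} (\<lambda>s. mem_kernel \<delta> (t - s) *\<^sub>R complexify A (z s))) = \<pi> (F t)"
      using z'(2)[OF t] by simp
    then show "\<pi> (z' t) + A (\<pi> (z t)) + integral {0..t} (\<lambda>s. mem_kernel \<delta> (t - s) *\<^sub>R A (\<pi> (z s))) = \<pi> (F t)"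
      unfolding integral_unique[OF int[OF t]] by (simp only: add A)
  qed (simp add: z0)
qed

lemma C1_cembed:
  assumes "C1_on_halfline y"
  shows "C1_on_halfline (\<lambda>t. cembed (y t))"
proof -
  obtain y' where y': "continuous_on {0..} y'"
    "\<And>t. t \<ge> 0 \<Longrightarrow> (y has_vector_derivative y' t) (at t within {0..})"
    using assms unfolding C1_on_halfline_def by auto
  show ?thesis
    unfolding C1_on_halfline_def
    by (intro exI[of _ "\<lambda>t. cembed (y' t)"] conjI allI impI y'(2)
        bounded_linear.continuous_on[OF bounded_linear_cembed y'(1)]
        bounded_linear.has_vector_derivative[OF bounded_linear_cembed])
qed

lemma complexify_modal_control:
  assumes B: "bounded_linear B"
  shows "complexify B (modal_control J M \<Phi> (\<lambda>i t. of_real (v i t)) t) = cembed (\<Sum>i<M. v i t *\<^sub>R B (J (\<Phi> i)))"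
proof -
  have "modal_control J M \<Phi> (\<lambda>i t. of_real (v i t)) t = cembed (\<Sum>i<M. v i t *\<^sub>R J (\<Phi> i))"
    unfolding modal_control_def cscale_def
    by (simp add: cembed_def prod_eq_iff fst_sum snd_sum)
  then show ?thesis
    using B by (simp add: cembed_def bounded_linear.linear linear_sum linear_scale linear_0)
qed

context memory_system
begin

lemma zero_in_domain: "0 \<in> D" "A 0 = 0"
proof -
  have z: "ell2 (\<lambda>j. 0)" by (simp add: ell2_def)
  have "synth (\<lambda>j. 0) = 0" by (simp add: synth_def)
  then show "0 \<in> D" "A 0 = 0" using synth_in_domain[OF z] z by simp_all
qed

text \<open>
  A complexified solution has a real part that solves the real equation with the same datum and an imaginary
  part that solves the homogeneous equation with zero datum, so it is the given real solution.
\<close>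

lemma stabilizedI:
  assumes B: "bounded_linear B"
    and y: "real_memory_solution D A \<delta> (\<lambda>t. \<Sum>i<M. v i t *\<^sub>R B (J (\<Phi> i))) y0 y"
    and C1: "y0 \<in> D \<Longrightarrow> C1_on_halfline y"
    and decay: "\<And>t. t \<ge> 0 \<Longrightarrow> norm (y t) \<le> C * exp (- \<gamma> * t) * norm y0"
  shows "stabilized D A \<delta> B \<gamma> C y0 (modal_control J M \<Phi> (\<lambda>i t. of_real (v i t)))"
  unfolding stabilized_def complexify_modal_control[OF B]
proof (intro exI[of _ "\<lambda>t. cembed (y t)"] conjI allI impI)
  show "memory_solution D A \<delta> (\<lambda>t. cembed (\<Sum>i<M. v i t *\<^sub>R B (J (\<Phi> i)))) (cembed y0) (\<lambda>t. cembed (y t))"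
    by (rule memory_solution_cembed[OF y zero_in_domain])
  fix z and t :: real
  assume z: "memory_solution D A \<delta> (\<lambda>t. cembed (\<Sum>i<M. v i t *\<^sub>R B (J (\<Phi> i)))) (cembed y0) z" and t: "0 \<le> t"
  have "real_memory_solution D A \<delta> (\<lambda>t. \<Sum>i<M. v i t *\<^sub>R B (J (\<Phi> i))) y0 (\<lambda>t. fst (z t))"
    using memory_solution_part[OF z, of fst] by (simp add: cembed_def)
  then have 1: "fst (z t) = y t" by (rule real_memory_solution_unique[OF _ y t])
  have "real_memory_solution D A \<delta> (\<lambda>t. 0) 0 (\<lambda>t. snd (z t))"
    using memory_solution_part[OF z, of snd] by (simp add: cembed_def)
  moreover have "real_memory_solution D A \<delta> (\<lambda>t. 0) 0 (\<lambda>t. 0)"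
    unfolding real_memory_solution_def by (auto simp: zero_in_domain intro!: exI[of _ "\<lambda>t. 0"])
  ultimately have 2: "snd (z t) = 0" by (rule real_memory_solution_unique[OF _ _ t])
  show "z t = cembed (y t)" using 1 2 by (simp add: cembed_def prod_eq_iff)
next
  show "y0 \<in> D \<Longrightarrow> C1_on_halfline (\<lambda>t. cembed (y t))" using C1 by (rule C1_cembed)
next
  fix t :: real assume "0 \<le> t"
  then show "norm (cembed (y t)) \<le> C * exp (- \<gamma> * t) * norm (cembed y0)"
    using decay by (simp add: norm_cembed)
qed

text \<open>
  The forcing has coefficients of modulus at most \<open>K1 * norm y0 * \<beta> j\<close>, where \<open>\<beta> j\<close> is the sum over the
  actuators of the moduli of their \<open>j\<close>-th coefficients; \<open>\<beta>\<close> is square summable, whence a majorant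
  proportional to the norm of the datum.
\<close>

lemma stabilizing_pulses:
  fixes b :: "nat \<Rightarrow> 'h"
  assumes \<gamma>: "0 < \<gamma>" and T: "0 < T"
    and fast: "\<And>j. N \<le> j \<Longrightarrow> \<gamma> < Re (mu_plus \<delta> lam j) \<and> \<gamma> < Re (mu_minus \<delta> lam j)"
    and cross: "\<And>j m. j \<noteq> m \<Longrightarrow> mu_plus \<delta> lam j \<noteq> mu_minus \<delta> lam m"
    and rows: "\<And>j. j < N \<Longrightarrow> \<forall>c.
      (\<forall>i<M. (\<Sum>k\<in>{k. k < N \<and> lam k = lam j}. c k * complex_of_real (inner (b i) (\<phi> k))) = 0) \<longrightarrow> c j = 0"
  shows "\<exists>C>0. \<forall>y0. \<exists>v v' v'' y.
      pulse_family T M (C * norm y0) v v' v'' \<and>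
      real_memory_solution D A \<delta> (\<lambda>t. \<Sum>i<M. v i t *\<^sub>R b i) y0 y \<and>
      (y0 \<in> D \<longrightarrow> C1_on_halfline y) \<and>
      (\<forall>t\<ge>0. norm (y t) \<le> C * exp (- \<gamma> * t) * norm y0)"
    (is "\<exists>C>0. \<forall>y0. ?stabilizing C y0")
proof -
  define G where "G j i = inner (b i) (\<phi> j)" for j i
  obtain K where K: "K > 0" "\<forall>y. \<exists>v v' v''.
      pulse_family T M (K * (\<Sum>j<N. \<bar>y j\<bar>)) v v' v'' \<and>
      (\<forall>j<N. mu_mode_y \<delta> lam j (y j) (\<lambda>s. \<Sum>i<M. G j i * v i s) T = 0 \<and>
             mu_mode_z \<delta> lam j (y j) (\<lambda>s. \<Sum>i<M. G j i * v i s) T = 0)"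
    using null_control[OF modes cross rows[folded G_def] T] by blast
  define \<beta> where "\<beta> j = (\<Sum>i<M. \<bar>G j i\<bar>)" for j
  have \<beta>: "ell2 \<beta>" unfolding \<beta>_def G_def by (intro ell2_sum ell2_abs ell2_coef)
  \<comment> \<open>The sum of the moduli of the first \<open>N\<close> coefficients of \<open>y0\<close> is at most \<open>N * norm y0\<close>.\<close>
  define K1 where "K1 = K * (1 + real N)"
  have K1: "K1 > 0" using K(1) by (simp add: K1_def add_pos_nonneg)
  show ?thesis
  proof (rule controlled_decay[OF \<gamma> less_imp_le[OF T], where N = N])
  show "\<And>j. N \<le> j \<Longrightarrow> \<gamma> < Re (mu_plus \<delta> lam j) \<and> \<gamma> < Re (mu_minus \<delta> lam j)" by (rule fast)
  next
  fix C :: real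
  assume C: "C > 0" and Cd: "\<And>f m y0 t. continuous_on {0..} f \<Longrightarrow> ell2 m \<Longrightarrow>
      (\<And>j s. s \<ge> 0 \<Longrightarrow> \<bar>inner (f s) (\<phi> j)\<bar> \<le> m j) \<Longrightarrow> (\<And>s. s \<ge> T \<Longrightarrow> f s = 0) \<Longrightarrow>
      (\<And>j. j < N \<Longrightarrow> Y y0 f j T = 0 \<and> Z y0 f j T = 0) \<Longrightarrow> t \<ge> 0 \<Longrightarrow>
      norm (sol f y0 t) \<le> C * exp (- \<gamma> * t) * sqrt ((norm y0)\<^sup>2 + (\<Sum>j. (m j)\<^sup>2))"
  define S where "S = sqrt (1 + K1\<^sup>2 * (\<Sum>j. (\<beta> j)\<^sup>2))"
  have S0: "S \<ge> 0" using \<beta> by (simp add: S_def ell2_def suminf_nonneg)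
  have C2: "K1 + C * S > 0" using K1 C S0 by (simp add: add_pos_nonneg)
  show ?thesis
  proof (intro exI[of _ "K1 + C * S"] conjI C2 allI)
    fix y0
    obtain v v' v'' where pulse: "\<And>i. C2_pulse T (v i) (v' i) (v'' i)"
      and bound: "\<And>i t. i < M \<Longrightarrow> \<bar>v i t\<bar> + \<bar>v' i t\<bar> + \<bar>v'' i t\<bar> \<le> K * (\<Sum>j<N. \<bar>inner y0 (\<phi> j)\<bar>)"
      and null: "\<And>j. j < N \<Longrightarrow> mu_mode_y \<delta> lam j (inner y0 (\<phi> j)) (\<lambda>s. \<Sum>i<M. G j i * v i s) T = 0 \<and>
             mu_mode_z \<delta> lam j (inner y0 (\<phi> j)) (\<lambda>s. \<Sum>i<M. G j i * v i s) T = 0"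
      using spec[OF K(2), of "\<lambda>j. inner y0 (\<phi> j)"] unfolding pulse_family_def by blast
    have "(\<Sum>j<N. \<bar>inner y0 (\<phi> j)\<bar>) \<le> (\<Sum>j<N. norm y0)"
      by (intro sum_mono abs_coef_le)
    also have "\<dots> \<le> (1 + real N) * norm y0" by (simp add: algebra_simps)
    finally have "K * (\<Sum>j<N. \<bar>inner y0 (\<phi> j)\<bar>) \<le> K1 * norm y0"
      unfolding K1_def mult.assoc using K(1) by (intro mult_left_mono) auto
    then have b1: "\<bar>v i t\<bar> + \<bar>v' i t\<bar> + \<bar>v'' i t\<bar> \<le> K1 * norm y0" if "i < M" for i t
      using bound[OF that, of t] by linarith
    define f where "f t = (\<Sum>i<M. v i t *\<^sub>R b i)" for t
    define m where "m j = (K1 * norm y0) * \<beta> j" for j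
    have vc: "continuous_on R (v i)" for R i
      using pulse[of i] C2_function_cont unfolding C2_pulse_def by blast
    have f: "continuous_on {0..} f" unfolding f_def[abs_def] by (intro continuous_intros vc)
    have m: "ell2 m" unfolding m_def by (intro ell2_scale \<beta>)
    have fj: "inner (f s) (\<phi> j) = (\<Sum>i<M. G j i * v i s)" for s j
      by (simp add: f_def G_def inner_sum_left mult.commute)
    have fm: "\<bar>inner (f s) (\<phi> j)\<bar> \<le> m j" for j s
    proof -
      have "\<bar>inner (f s) (\<phi> j)\<bar> \<le> (\<Sum>i<M. \<bar>G j i * v i s\<bar>)" unfolding fj by (rule sum_abs)
      also have "\<dots> \<le> (\<Sum>i<M. (K1 * norm y0) * \<bar>G j i\<bar>)"
      proof (rule sum_mono)
        fix i assume "i \<in> {..<M}"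
        then have "\<bar>v i s\<bar> \<le> K1 * norm y0" using b1[of i s] by simp
        then show "\<bar>G j i * v i s\<bar> \<le> (K1 * norm y0) * \<bar>G j i\<bar>"
          by (simp add: abs_mult mult.commute mult_left_mono)
      qed
      finally show ?thesis by (simp add: m_def \<beta>_def sum_distrib_left)
    qed
    have supp: "f s = 0" if "s \<ge> T" for s
      unfolding f_def using pulse that by (simp add: C2_pulse_def)
    have nullf: "Y y0 f j T = 0 \<and> Z y0 f j T = 0" if "j < N" for j
      using null[OF that] by (simp only: fj)
    have "(\<Sum>j. (m j)\<^sup>2) = (K1 * norm y0)\<^sup>2 * (\<Sum>j. (\<beta> j)\<^sup>2)"
      unfolding m_def power_mult_distrib[of "K1 * norm y0"] by (rule suminf_mult) (use \<beta> in \<open>simp add: ell2_def\<close>)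
    then have "(norm y0)\<^sup>2 + (\<Sum>j. (m j)\<^sup>2) = (norm y0)\<^sup>2 * (1 + K1\<^sup>2 * (\<Sum>j. (\<beta> j)\<^sup>2))"
      by (simp add: power_mult_distrib algebra_simps)
    then have sq: "sqrt ((norm y0)\<^sup>2 + (\<Sum>j. (m j)\<^sup>2)) = norm y0 * S"
      by (simp add: real_sqrt_mult S_def)
    have decay: "norm (sol f y0 t) \<le> (K1 + C * S) * exp (- \<gamma> * t) * norm y0" if t: "t \<ge> 0" for t
    proof -
      have "norm (sol f y0 t) \<le> C * exp (- \<gamma> * t) * sqrt ((norm y0)\<^sup>2 + (\<Sum>j. (m j)\<^sup>2))"
        by (rule Cd[OF f m fm supp nullf t])
      also have "\<dots> = C * S * (exp (- \<gamma> * t) * norm y0)" unfolding sq by simp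
      also have "\<dots> \<le> (K1 + C * S) * (exp (- \<gamma> * t) * norm y0)"
        by (rule mult_right_mono) (use K1 in auto)
      finally show ?thesis by (simp add: mult.assoc)
    qed
    have bound': "\<bar>v i t\<bar> + \<bar>v' i t\<bar> + \<bar>v'' i t\<bar> \<le> (K1 + C * S) * norm y0" if "i < M" for i t
    proof -
      have "K1 * norm y0 \<le> (K1 + C * S) * norm y0"
        by (rule mult_right_mono) (use C S0 in auto)
      then show ?thesis using b1[OF that, of t] by linarith
    qed
    have "real_memory_solution D A \<delta> f y0 (sol f y0)" "y0 \<in> D \<longrightarrow> C1_on_halfline (sol f y0)"
      using sol_is_solution[OF f m fm] sol_C1[OF f m fm] by auto
    then show "?stabilizing (K1 + C * S) y0"
      using pulse bound' decay unfolding f_def[abs_def] pulse_family_def by blast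
  qed
  qed
qed

end

lemma stabilized_mono:
  assumes "stabilized D A \<delta> B \<gamma> C y0 u" "C \<le> C'"
  shows "stabilized D A \<delta> B \<gamma> C' y0 u"
proof -
  have "C * exp (- \<gamma> * t) * norm (cembed y0) \<le> C' * exp (- \<gamma> * t) * norm (cembed y0)" for t
    using assms(2) by (intro mult_right_mono) auto
  note le = this
  obtain y where y: "memory_solution D A \<delta> (\<lambda>t. complexify B (u t)) (cembed y0) y"
    "\<forall>z. memory_solution D A \<delta> (\<lambda>t. complexify B (u t)) (cembed y0) z \<longrightarrow> (\<forall>t\<ge>0. z t = y t)"
    "y0 \<in> D \<longrightarrow> C1_on_halfline y"
    and decay: "\<forall>t\<ge>0. norm (y t) \<le> C * exp (- \<gamma> * t) * norm (cembed y0)"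
    using assms(1) unfolding stabilized_def by (elim exE conjE)
  have "\<forall>t\<ge>0. norm (y t) \<le> C' * exp (- \<gamma> * t) * norm (cembed y0)"
    using decay le by (auto intro: order_trans)
  then show ?thesis unfolding stabilized_def by (intro exI[of _ y] conjI y)
qed

text \<open>
  The product \<open>mem_kernel \<delta> (t - s) * p s\<close> is a primitive in \<open>s\<close> and vanishes at \<open>s = T\<close>.
\<close>

lemma pulse_memory_representation:
  assumes p: "C2_pulse T p p' p''" and t: "t \<le> T"
  shows "((\<lambda>s. of_real (mem_kernel \<delta> (t - s)) * of_real (p' s + \<delta> * p s) :: complex) has_integral - of_real (p t)) {t..T}"
proof -
  have d: "(p has_real_derivative p' s) (at s)" for s
    using p by (simp add: C2_pulse_def C2_function_def)
  have "((\<lambda>s. mem_kernel \<delta> (t - s) * (p' s + \<delta> * p s)) has_integral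
      mem_kernel \<delta> (t - T) * p T - mem_kernel \<delta> (t - t) * p t) {t..T}"
  proof (rule fundamental_theorem_of_calculus[OF t])
    fix s
    have "((\<lambda>s. mem_kernel \<delta> (t - s) * p s) has_real_derivative mem_kernel \<delta> (t - s) * (p' s + \<delta> * p s)) (at s)"
      unfolding mem_kernel_def by (auto intro!: derivative_eq_intros d simp: algebra_simps)
    then show "((\<lambda>s. mem_kernel \<delta> (t - s) * p s) has_vector_derivative mem_kernel \<delta> (t - s) * (p' s + \<delta> * p s)) (at s within {t..T})"
      by (simp add: has_real_derivative_iff_has_vector_derivative has_vector_derivative_at_within)
  qed
  moreover have "p T = 0" using p by (simp add: C2_pulse_def)
  ultimately have "((\<lambda>s. mem_kernel \<delta> (t - s) * (p' s + \<delta> * p s)) has_integral - p t) {t..T}"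
    by (simp add: mem_kernel_def)
  from has_integral_linear[OF this bounded_linear_of_real[where 'a = complex]]
  show ?thesis by (simp only: o_def of_real_mult of_real_minus)
qed

text \<open>
  The difference lies in the span of the first \<open>N\<close> vectors and is orthogonal to all of them.
\<close>

lemma (in onb) biorthogonal_system_unique:
  assumes bi: "biorthogonal_system N \<phi> \<psi>" and j: "j < N"
  shows "\<psi> j = \<phi> j"
proof -
  let ?d = "\<psi> j - \<phi> j"
  have sp: "?d \<in> Real_Vector_Spaces.span (\<phi> ` {..<N})"
  proof (rule Real_Vector_Spaces.span_diff)
    show "\<psi> j \<in> Real_Vector_Spaces.span (\<phi> ` {..<N})" using bi j by (simp add: biorthogonal_system_def)
    show "\<phi> j \<in> Real_Vector_Spaces.span (\<phi> ` {..<N})" using j by (intro Real_Vector_Spaces.span_base) simp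
  qed
  have orth: "inner (\<phi> i) ?d = 0" if "i < N" for i
    using bi that j by (simp add: biorthogonal_system_def inner_diff_right inner_phi)
  have "inner v ?d = 0" if "v \<in> Real_Vector_Spaces.span (\<phi> ` {..<N})" for v
    using that
  proof (induction rule: Real_Vector_Spaces.span_induct_alt)
    case (step c w z)
    then show ?case using orth by (auto simp: inner_add_left)
  qed simp
  from this[OF sp] show ?thesis by simp
qed

lemma complex_of_real_has_vector_derivative:
  fixes f :: "real \<Rightarrow> real"
  assumes "(f has_real_derivative f') (at t)"
  shows "((\<lambda>t. complex_of_real (f t)) has_vector_derivative of_real f') (at t)"
  using bounded_linear.has_vector_derivative[OF bounded_linear_of_real] assms
  by (simp add: has_real_derivative_iff_has_vector_derivative)

theorem theorem4p1:
  fixes D :: "'h::{real_inner,banach} set"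
    and A :: "'h \<Rightarrow> 'h"
    and B :: "'u::{real_inner,banach} \<Rightarrow> 'h"
    and J :: "'h \<Rightarrow> 'u"
    and \<delta> \<gamma> :: real
    and lam :: "nat \<Rightarrow> real"
    and \<phi> \<phi>s :: "nat \<Rightarrow> 'h"
    and N M l :: nat
    and Q R Rinv :: "complex mat"
  assumes "densely_defined_linear D A"
    and "closed_operator D A"
    and "selfadjoint_operator D A"
    and "positive_definite_operator D A"
    and "compact_resolvent D A"
    and "bounded_linear B"
    and "linear J"
    and "\<delta> > 0"
    and "orthonormal_basis \<phi>"
    and "\<forall>j. \<phi> j \<in> D \<and> A (\<phi> j) = lam j *\<^sub>R \<phi> j"
    and "\<forall>i j k. i \<le> j \<and> j \<le> k \<and> lam i = lam k \<longrightarrow> lam j = lam i"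
    and "filterlim lam at_top sequentially"
    and "\<forall>j. \<delta> \<noteq> lam j + 2 * sqrt (lam j) \<and> \<delta> \<noteq> lam j - 2 * sqrt (lam j)"
    and "\<forall>j m. j \<noteq> m \<longrightarrow> mu_plus \<delta> lam j \<noteq> mu_minus \<delta> lam m"
    and "0 < \<gamma>" and "\<gamma> < 1 + \<delta>"
    and "N = num_modes \<delta> lam \<gamma>"
    and "l = num_distinct lam N"
    and "M = max_mult lam N"
    and "biorthogonal_system N \<phi> \<phi>s"
    and "Q = Q_mat B J \<phi>s N M"
    and "\<forall>j<N. semisimple_eigenvalue (P_mat \<delta> lam N) (- mu_plus \<delta> lam j) \<and>
                semisimple_eigenvalue (P_mat \<delta> lam N) (- mu_minus \<delta> lam j)"
    and "similar_mat_wit (P_mat \<delta> lam N) (D_mat \<delta> lam N) Rinv R"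
    and "\<forall>k<l. mat_rank (Qbar_plus R Q lam N k) = eig_mult lam N k \<and>
                mat_rank (Qbar_minus R Q lam N k) = eig_mult lam N k"
  shows
    "(\<exists>\<Phi>. \<exists>C>0. \<forall>y0. \<exists>v. stabilized D A \<delta> B \<gamma> C y0 (modal_control J M \<Phi> v)) \<and>
     (\<forall>i<M. eigenvector_of D A (\<phi>s i)) \<and>
     (\<forall>T>0. \<exists>C>0. \<forall>y0. \<exists>v v' w.
        stabilized D A \<delta> B \<gamma> C y0 (modal_control J M \<phi>s v) \<and>
        (\<forall>i<M.
           continuous_on {0..<T} (v i) \<and>
           (\<forall>t\<in>{0<..<T}. (v i has_vector_derivative v' i t) (at t) \<and>
              w i t = v' i t + of_real \<delta> * v i t) \<and>
           (\<forall>t\<in>{0..<T}. (\<lambda>s. of_real (mem_kernel \<delta> (t - s)) * w i s) integrable_on {t..T} \<and>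
              v i t = - integral {t..T} (\<lambda>s. of_real (mem_kernel \<delta> (t - s)) * w i s)) \<and>
           w i \<in> borel_measurable (lebesgue_on {0..T}) \<and>
           (\<lambda>t. (cmod (w i t))\<^sup>2) integrable_on {0..T} \<and>
           integral {0..T} (\<lambda>t. (cmod (w i t))\<^sup>2) \<le> C * (norm (cembed y0))\<^sup>2 \<and>
           (\<forall>t\<ge>T. v i t = 0 \<and> w i t = 0))) \<and>
     (\<exists>C>0. \<forall>y0. \<exists>v v' v''.
        stabilized D A \<delta> B \<gamma> C y0 (modal_control J M \<phi>s v) \<and>
        (\<forall>i<M.
           (\<forall>t\<ge>0. (v i has_vector_derivative v' i t) (at t within {0..}) \<and>
              (v' i has_vector_derivative v'' i t) (at t within {0..})) \<and>
           continuous_on {0..} (v'' i) \<and>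
           (\<forall>t>0. cmod (v i t) + cmod (v' i t) + cmod (v'' i t)
                    \<le> C * exp (- \<gamma> * t) * norm (cembed y0))))"
proof -
  have lam_pos: "lam j > 0" for j
  proof -
    have n: "inner (\<phi> j) (\<phi> j) = 1" using assms(9) by (simp add: orthonormal_basis_def)
    then have "\<phi> j \<noteq> 0" by auto
    then have "0 < inner (A (\<phi> j)) (\<phi> j)"
      using assms(4,10) unfolding positive_definite_operator_def by blast
    then show ?thesis using assms(10) n by simp
  qed
  have modes: "mode \<delta> (lam j) (mu_plus \<delta> lam j) (mu_minus \<delta> lam j)" for j
    by (rule mu_mode) (use lam_pos assms(8,13) in auto)
  interpret memory_system \<phi> D A \<delta> lam
    by (rule memory_system.intro[OF onb.intro[OF assms(9)]], rule memory_system_axioms.intro)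
      (use assms(3,10,12) modes in auto)
  have fast: "\<gamma> < Re (mu_plus \<delta> lam j) \<and> \<gamma> < Re (mu_minus \<delta> lam j)" if "N \<le> j" for j
    using num_modes_fast[OF assms(12,8,16)] that assms(17) by blast
  have cross: "mu_plus \<delta> lam j \<noteq> mu_minus \<delta> lam m" if "j \<noteq> m" for j m
    using assms(14) that by blast
  have phis: "\<phi>s j = \<phi> j" if j: "j < N" for j
    using biorthogonal_system_unique[OF assms(20) j] .
  have MN: "M \<le> N"
    unfolding assms(19) max_mult_def eig_mult_def
    by (rule Max.boundedI) (auto intro: order_trans[OF card_mono[of "{..<N}"]])
  define b where "b i = B (J (\<phi>s i))" for i
  have rows: "\<forall>c. (\<forall>i<M. (\<Sum>k\<in>{k. k < N \<and> lam k = lam j}. c k * complex_of_real (inner (b i) (\<phi> k))) = 0) \<longrightarrow> c j = 0"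
    if j: "j < N" for j
  proof (intro allI impI)
    fix c :: "nat \<Rightarrow> complex"
    assume z: "\<forall>i<M. (\<Sum>k\<in>{k. k < N \<and> lam k = lam j}. c k * complex_of_real (inner (b i) (\<phi> k))) = 0"
    show "c j = 0"
    proof (rule control_rows_independent[OF modes cross assms(11,23), where Cm = "C_mat B J \<phi>s N M" and M = M and j0 = j and j = j])
      show "C_mat B J \<phi>s N M \<in> carrier_mat N M" by (simp add: C_mat_def)
      show "mat_rank (Qbar_plus R (0\<^sub>m N M @\<^sub>r C_mat B J \<phi>s N M) lam N k) = eig_mult lam N k"
        if "k < num_distinct lam N" for k
        using assms(18,21,24) that by (simp add: Q_mat_def)
      fix i assume i: "i < M"
      have "(\<Sum>k\<in>{k. k < N \<and> lam k = lam j}. c k * C_mat B J \<phi>s N M $$ (k, i))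
          = (\<Sum>k\<in>{k. k < N \<and> lam k = lam j}. c k * complex_of_real (inner (b i) (\<phi> k)))"
        by (rule sum.cong) (use i in \<open>auto simp: C_mat_def b_def phis\<close>)
      then show "(\<Sum>k\<in>{k. k < N \<and> lam k = lam j}. c k * C_mat B J \<phi>s N M $$ (k, i)) = 0"
        using z i by simp
    qed (use j in auto)
  qed
  let ?steers = "\<lambda>T C y0 v v' v''. pulse_family T M (C * norm y0) v v' v'' \<and>
      stabilized D A \<delta> B \<gamma> C y0 (modal_control J M \<phi>s (\<lambda>i t. of_real (v i t)))"
  have steering: "\<exists>C>0. \<forall>y0. \<exists>v v' v''. ?steers T C y0 v v' v''" if T: "T > 0" for T
  proof -
    obtain C where C: "C > 0" and ex: "\<forall>y0. \<exists>v v' v'' y.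
      pulse_family T M (C * norm y0) v v' v'' \<and>
      real_memory_solution D A \<delta> (\<lambda>t. \<Sum>i<M. v i t *\<^sub>R b i) y0 y \<and>
      (y0 \<in> D \<longrightarrow> C1_on_halfline y) \<and>
      (\<forall>t\<ge>0. norm (y t) \<le> C * exp (- \<gamma> * t) * norm y0)"
      using stabilizing_pulses[OF assms(15) T fast cross rows] by blast
    show ?thesis
    proof (intro exI[of _ C] conjI C allI)
      fix y0
      obtain v v' v'' y where family: "pulse_family T M (C * norm y0) v v' v''"
        and y: "real_memory_solution D A \<delta> (\<lambda>t. \<Sum>i<M. v i t *\<^sub>R b i) y0 y"
        and C1: "y0 \<in> D \<longrightarrow> C1_on_halfline y"
        and decay: "\<forall>t\<ge>0. norm (y t) \<le> C * exp (- \<gamma> * t) * norm y0"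
        using spec[OF ex, of y0] by blast
      have "stabilized D A \<delta> B \<gamma> C y0 (modal_control J M \<phi>s (\<lambda>i t. of_real (v i t)))"
        by (rule stabilizedI[OF assms(6)], rule y[unfolded b_def]) (use C1 decay in auto)
      then show "\<exists>v v' v''. ?steers T C y0 v v' v''" using family by blast
    qed
  qed
  have part2: "\<forall>i<M. eigenvector_of D A (\<phi>s i)"
  proof (intro allI impI)
    fix i assume "i < M"
    then have "\<phi>s i = \<phi> i" using phis MN by simp
    then show "eigenvector_of D A (\<phi>s i)"
      using phi_D[of i] eig[of i] inner_phi[of i i] unfolding eigenvector_of_def by auto
  qed
  let ?finite_time = "\<lambda>T C y0 v v' w. \<forall>i<M.
           continuous_on {0..<T} (v i) \<and>
           (\<forall>t\<in>{0<..<T}. (v i has_vector_derivative v' i t) (at t) \<and>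
              w i t = v' i t + of_real \<delta> * v i t) \<and>
           (\<forall>t\<in>{0..<T}. (\<lambda>s. of_real (mem_kernel \<delta> (t - s)) * w i s) integrable_on {t..T} \<and>
              v i t = - integral {t..T} (\<lambda>s. of_real (mem_kernel \<delta> (t - s)) * w i s)) \<and>
           w i \<in> borel_measurable (lebesgue_on {0..T}) \<and>
           (\<lambda>t. (cmod (w i t))\<^sup>2) integrable_on {0..T} \<and>
           integral {0..T} (\<lambda>t. (cmod (w i t))\<^sup>2) \<le> C * (norm (cembed y0))\<^sup>2 \<and>
           (\<forall>t\<ge>T. v i t = 0 \<and> w i t = 0)"
  have part3: "\<exists>C>0. \<forall>y0. \<exists>v v' w. stabilized D A \<delta> B \<gamma> C y0 (modal_control J M \<phi>s v) \<and>
      ?finite_time T C y0 v v' w" if T: "T > 0" for T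
  proof -
    obtain C where C: "C > 0" and ex: "\<forall>y0. \<exists>v v' v''. ?steers T C y0 v v' v''"
      using steering[OF T] by blast
    \<comment> \<open>From \<open>cmod (w i t) \<le> (1 + \<delta>) * C * norm y0\<close>, integrated over an interval of length \<open>T\<close>.\<close>
    define K where "K = C + ((1 + \<delta>) * C)\<^sup>2 * T"
    have K: "K > 0" "C \<le> K" "((1 + \<delta>) * C)\<^sup>2 * T \<le> K"
      using C T by (auto simp: K_def intro!: add_pos_nonneg)
    show ?thesis
    proof (intro exI[of _ K] conjI K(1) allI)
      fix y0
      obtain v v' v'' where family: "pulse_family T M (C * norm y0) v v' v''"
        and stab: "stabilized D A \<delta> B \<gamma> C y0 (modal_control J M \<phi>s (\<lambda>i t. of_real (v i t)))"
        using spec[OF ex, of y0] by blast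
      note pulse = pulse_familyD(1)[OF family] and bound = pulse_familyD(2)[OF family]
      let ?v = "\<lambda>i t. complex_of_real (v i t)" and ?v' = "\<lambda>i t. complex_of_real (v' i t)"
        and ?w = "\<lambda>i t. complex_of_real (v' i t + \<delta> * v i t)"
      have "?finite_time T K y0 ?v ?v' ?w"
      proof (intro conjI ballI allI impI)
        fix i assume i: "i < M"
        have c2: "C2_function (v i) (v' i) (v'' i)" using pulse[of i] by (simp add: C2_pulse_def)
        note c = C2_function_cont[OF c2]
        show "continuous_on {0..<T} (?v i)" by (intro continuous_intros c)
        have wc: "continuous_on S (?w i)" for S by (intro continuous_intros c)
        show "?w i \<in> borel_measurable (lebesgue_on {0..T})"
          by (rule continuous_imp_measurable_on_sets_lebesgue[OF wc]) simp
        have w2c: "continuous_on {0..T} (\<lambda>t. (cmod (?w i t))\<^sup>2)" by (intro continuous_intros wc)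
        show w2: "(\<lambda>t. (cmod (?w i t))\<^sup>2) integrable_on {0..T}" by (rule integrable_continuous_real[OF w2c])
        have "integral {0..T} (\<lambda>t. (cmod (?w i t))\<^sup>2) \<le> integral {0..T} (\<lambda>t. ((1 + \<delta>) * C * norm y0)\<^sup>2)"
        proof (rule integral_le[OF w2])
          fix t
          have "\<bar>v' i t + \<delta> * v i t\<bar> \<le> \<bar>v' i t\<bar> + \<delta> * \<bar>v i t\<bar>"
            using assms(8) abs_triangle_ineq[of "v' i t" "\<delta> * v i t"] by (simp add: abs_mult)
          also have "\<dots> \<le> (C * norm y0) + \<delta> * (C * norm y0)"
            using bound[OF i, of t] assms(8) by (intro add_mono mult_left_mono) auto
          also have "\<dots> = (1 + \<delta>) * C * norm y0" by (simp add: algebra_simps)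
          finally show "(cmod (?w i t))\<^sup>2 \<le> ((1 + \<delta>) * C * norm y0)\<^sup>2"
            unfolding norm_of_real by (rule power_mono) simp
        qed auto
        also have "\<dots> = (((1 + \<delta>) * C)\<^sup>2 * T) * (norm y0)\<^sup>2"
          using T by (simp add: power_mult_distrib)
        also have "\<dots> \<le> K * (norm y0)\<^sup>2" by (rule mult_right_mono[OF K(3)]) simp
        finally show "integral {0..T} (\<lambda>t. (cmod (?w i t))\<^sup>2) \<le> K * (norm (cembed y0))\<^sup>2"
          by (simp only: norm_cembed)
      next
        fix i t assume "t \<in> {0<..<T}"
        have "(v i has_real_derivative v' i t) (at t)"
          using pulse[of i] by (simp add: C2_pulse_def C2_function_def)
        then show "(?v i has_vector_derivative ?v' i t) (at t)"
          by (rule complex_of_real_has_vector_derivative)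
        show "?w i t = ?v' i t + of_real \<delta> * ?v i t" by simp
      next
        fix i t assume t: "t \<in> {0..<T}"
        have h: "((\<lambda>s. of_real (mem_kernel \<delta> (t - s)) * ?w i s) has_integral - ?v i t) {t..T}"
          by (rule pulse_memory_representation[OF pulse]) (use t in simp)
        show "(\<lambda>s. of_real (mem_kernel \<delta> (t - s)) * ?w i s) integrable_on {t..T}"
          using h by (rule has_integral_integrable)
        show "?v i t = - integral {t..T} (\<lambda>s. of_real (mem_kernel \<delta> (t - s)) * ?w i s)"
          unfolding integral_unique[OF h] by simp
      next
        fix i t assume "T \<le> t"
        then have z: "v i t = 0" "v' i t = 0" using pulse[of i] by (simp_all add: C2_pulse_def)
        show "?v i t = 0" "?w i t = 0" using z by simp_all
      qed
      then show "\<exists>v v' w. stabilized D A \<delta> B \<gamma> K y0 (modal_control J M \<phi>s v) \<and> ?finite_time T K y0 v v' w"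
        by (intro exI[of _ ?v] exI[of _ ?v'] exI[of _ ?w] conjI[OF stabilized_mono[OF stab K(2)]])
    qed
  qed
  let ?decaying = "\<lambda>C y0 v v' v''. \<forall>i<M.
           (\<forall>t\<ge>0. (v i has_vector_derivative v' i t) (at t within {0..}) \<and>
              (v' i has_vector_derivative v'' i t) (at t within {0..})) \<and>
           continuous_on {0..} (v'' i) \<and>
           (\<forall>t>0. cmod (v i t) + cmod (v' i t) + cmod (v'' i t)
                    \<le> C * exp (- \<gamma> * t) * norm (cembed y0))"
  have part4: "\<exists>C>0. \<forall>y0. \<exists>v v' v''. stabilized D A \<delta> B \<gamma> C y0 (modal_control J M \<phi>s v) \<and>
      ?decaying C y0 v v' v''"
  proof -
    obtain C where C: "C > 0" and ex: "\<forall>y0. \<exists>v v' v''. ?steers 1 C y0 v v' v''"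
      using steering[of 1] by auto
    \<comment> \<open>The pulses live on \<open>[0, 1]\<close>, where \<open>exp (- \<gamma> * t)\<close> is at least \<open>exp (- \<gamma>)\<close>.\<close>
    define K where "K = C * exp \<gamma>"
    have "C * 1 \<le> C * exp \<gamma>" using C assms(15) by (intro mult_left_mono) auto
    then have K: "K > 0" "C \<le> K" using C by (simp_all add: K_def)
    show ?thesis
    proof (intro exI[of _ K] conjI K(1) allI)
      fix y0
      obtain v v' v'' where family: "pulse_family 1 M (C * norm y0) v v' v''"
        and stab: "stabilized D A \<delta> B \<gamma> C y0 (modal_control J M \<phi>s (\<lambda>i t. of_real (v i t)))"
        using spec[OF ex, of y0] by blast
      note pulse = pulse_familyD(1)[OF family] and bound = pulse_familyD(2)[OF family]
      let ?v = "\<lambda>i t. complex_of_real (v i t)" and ?v' = "\<lambda>i t. complex_of_real (v' i t)"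
        and ?v'' = "\<lambda>i t. complex_of_real (v'' i t)"
      have "?decaying K y0 ?v ?v' ?v''"
      proof (intro conjI allI impI)
        fix i assume i: "i < M"
        have c2: "C2_function (v i) (v' i) (v'' i)" using pulse[of i] by (simp add: C2_pulse_def)
        note c = C2_function_cont[OF c2]
        show "continuous_on {0..} (?v'' i)" by (intro continuous_intros c)
        fix t :: real
        have d: "(v i has_real_derivative v' i t) (at t)" "(v' i has_real_derivative v'' i t) (at t)"
          using c2 by (simp_all add: C2_function_def)
        show "(?v i has_vector_derivative ?v' i t) (at t within {0..})"
          "(?v' i has_vector_derivative ?v'' i t) (at t within {0..})"
          using d by (auto intro: has_vector_derivative_at_within complex_of_real_has_vector_derivative)
        show "cmod (?v i t) + cmod (?v' i t) + cmod (?v'' i t) \<le> K * exp (- \<gamma> * t) * norm (cembed y0)"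
        proof (cases "t < 1")
          case True
          have "\<gamma> * t \<le> \<gamma> * 1" using True assms(15) by (intro mult_left_mono) auto
          then have "1 \<le> exp \<gamma> * exp (- \<gamma> * t)" by (simp flip: exp_add)
          then have "C * norm y0 * 1 \<le> C * norm y0 * (exp \<gamma> * exp (- \<gamma> * t))"
            using C by (intro mult_left_mono) auto
          then show ?thesis using bound[OF i, of t] by (simp add: K_def norm_cembed mult_ac)
        next
          case False
          then have "v i t = 0" "v' i t = 0" "v'' i t = 0" using pulse[of i] by (simp_all add: C2_pulse_def)
          then show ?thesis using K(1) by simp
        qed
      qed
      then show "\<exists>v v' v''. stabilized D A \<delta> B \<gamma> K y0 (modal_control J M \<phi>s v) \<and> ?decaying K y0 v v' v''"
        by (intro exI[of _ ?v] exI[of _ ?v'] exI[of _ ?v''] conjI[OF stabilized_mono[OF stab K(2)]])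
    qed
  qed
  have part1: "\<exists>\<Phi>. \<exists>C>0. \<forall>y0. \<exists>v. stabilized D A \<delta> B \<gamma> C y0 (modal_control J M \<Phi> v)"
  proof -
    obtain C where C: "C > 0" and ex: "\<forall>y0. \<exists>v v' v''. stabilized D A \<delta> B \<gamma> C y0 (modal_control J M \<phi>s v) \<and>
      ?decaying C y0 v v' v''" using part4 by (elim exE conjE)
    show ?thesis
      by (intro exI[of _ \<phi>s] exI[of _ C] conjI C allI) (use ex in blast)
  qed
  show ?thesis
    by (intro conjI part1 part2 part4 allI impI part3)
qed

end
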